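(* Let $G$ be a torsion free Gromov hyperbolic group which is not almost cyclic, let $(\pi,H)$ be a tempered unitary representation of $G$ and let $v\in H$. Then there exists a finite positive Borel measure $\mu$ on $\partial G$, quasi-invariant under $G$, such that for all $x\in G$ $$|\langle\pi(x)v,v\rangle|\leq\|v\|^2\,|\langle\rho(x)\mathbf{1}_{\partial G},\mathbf{1}_{\partial G}\rangle|,$$ where $\rho$ is the quasi-regular representation of $G$ on $L^2(\partial G,d\mu)$ and $\mathbf{1}_{\partial G}$ is the constant function $1$ on $\partial G$.
   Context: A unitary representation is tempered if it is weakly contained in the regular representation. "Almost cyclic" means having a cyclic subgroup of finite index. $\partial G$ is the Gromov boundary of $G$ (boundary at infinity of a Cayley graph with respect to a finite generating set), a compact metrizable space on which $G$ acts by homeomorphisms. For a $G$-quasi-invariant measure $\mu$ on $\partial G$ with Radon–Nikodym cocycle $P(x,\omega)=\frac{d\mu(x^{-1}\omega)}{d\mu(\omega)}$, the quasi-regular representation on $L^2(\partial G,d\mu)$ is $(\rho(x)F)(\omega)=P^{1/2}(x,\omega)F(x^{-1}\omega)$. *)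

theory Defs
  imports "HOL-Algebra.Algebra" "HOL-Probability.Probability"
begin

class complex_hilbert = banach +
  fixes scaleC :: "complex \<Rightarrow> 'a \<Rightarrow> 'a"
    and cinner :: "'a \<Rightarrow> 'a \<Rightarrow> complex"
  assumes scaleC_add_right: "scaleC a (x + y) = scaleC a x + scaleC a y"
    and scaleC_add_left: "scaleC (a + b) x = scaleC a x + scaleC b x"
    and scaleC_scaleC: "scaleC a (scaleC b x) = scaleC (a * b) x"
    and scaleC_one: "scaleC 1 x = x"
    and scaleR_scaleC: "scaleR r x = scaleC (complex_of_real r) x"
    and cinner_conj: "cinner x y = cnj (cinner y x)"
    and cinner_add_left: "cinner (x + y) z = cinner x z + cinner y z"
    and cinner_scaleC_left: "cinner (scaleC a x) y = a * cinner x y"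
    and cinner_self_norm: "cinner x x = complex_of_real ((norm x)\<^sup>2)"

definition unitary_rep :: "('g, 'b) monoid_scheme \<Rightarrow> ('g \<Rightarrow> 'h::complex_hilbert \<Rightarrow> 'h) \<Rightarrow> bool" where
  "unitary_rep G \<pi> \<longleftrightarrow>
     (\<forall>x\<in>carrier G.
        (\<forall>u w. \<pi> x (u + w) = \<pi> x u + \<pi> x w) \<and>
        (\<forall>a u. \<pi> x (scaleC a u) = scaleC a (\<pi> x u)) \<and>
        (\<forall>u w. cinner (\<pi> x u) (\<pi> x w) = cinner u w) \<and>
        surj (\<pi> x)) \<and>
     \<pi> \<one>\<^bsub>G\<^esub> = id \<and>
     (\<forall>x\<in>carrier G. \<forall>y\<in>carrier G. \<pi> (x \<otimes>\<^bsub>G\<^esub> y) = \<pi> x \<circ> \<pi> y)"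

definition ell2 :: "('g, 'b) monoid_scheme \<Rightarrow> ('g \<Rightarrow> complex) \<Rightarrow> bool" where
  "ell2 G f \<longleftrightarrow> (\<lambda>y. (cmod (f y))\<^sup>2) summable_on carrier G"

text \<open>Matrix coefficient \<open>\<langle>\<lambda>(x) f, f\<rangle>\<close> of the left regular representation on \<open>\<ell>\<^sup>2(G)\<close>,
  where \<open>(\<lambda>(x) f)(y) = f(x\<^sup>-\<^sup>1 y)\<close>.\<close>

definition reg_coeff :: "('g, 'b) monoid_scheme \<Rightarrow> ('g \<Rightarrow> complex) \<Rightarrow> 'g \<Rightarrow> complex" where
  "reg_coeff G f x = (\<Sum>\<^sub>\<infinity>y\<in>carrier G. f (inv\<^bsub>G\<^esub> x \<otimes>\<^bsub>G\<^esub> y) * cnj (f y))"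

text \<open>Weak containment in the regular representation (G discrete, so compact = finite):
  every diagonal matrix coefficient of \<open>\<pi>\<close> is, uniformly on finite sets, a limit of
  finite sums of diagonal coefficients of the regular representation.\<close>

definition tempered :: "('g, 'b) monoid_scheme \<Rightarrow> ('g \<Rightarrow> 'h::complex_hilbert \<Rightarrow> 'h) \<Rightarrow> bool" where
  "tempered G \<pi> \<longleftrightarrow>
     (\<forall>v K \<epsilon>. finite K \<and> K \<subseteq> carrier G \<and> \<epsilon> > (0::real) \<longrightarrow>
        (\<exists>fs. (\<forall>f\<in>set fs. ell2 G f) \<and>
              (\<forall>x\<in>K. cmod (cinner (\<pi> x v) v - (\<Sum>f\<leftarrow>fs. reg_coeff G f x)) < \<epsilon>)))"

definition torsion_free :: "('g, 'b) monoid_scheme \<Rightarrow> bool" where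
  "torsion_free G \<longleftrightarrow>
     (\<forall>x\<in>carrier G. \<forall>n::nat. n > 0 \<and> x [^]\<^bsub>G\<^esub> n = \<one>\<^bsub>G\<^esub> \<longrightarrow> x = \<one>\<^bsub>G\<^esub>)"

definition almost_cyclic :: "('g, 'b) monoid_scheme \<Rightarrow> bool" where
  "almost_cyclic G \<longleftrightarrow> (\<exists>g\<in>carrier G. finite (rcosets\<^bsub>G\<^esub> (generate G {g})))"

definition fin_gen_set :: "('g, 'b) monoid_scheme \<Rightarrow> 'g set \<Rightarrow> bool" where
  "fin_gen_set G S \<longleftrightarrow> finite S \<and> S \<subseteq> carrier G \<and> generate G S = carrier G"

definition word_length :: "('g, 'b) monoid_scheme \<Rightarrow> 'g set \<Rightarrow> 'g \<Rightarrow> nat" where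
  "word_length G S x =
     (LEAST n. \<exists>l. length l = n \<and> set l \<subseteq> S \<union> m_inv G ` S \<and>
                   foldr (\<lambda>a b. a \<otimes>\<^bsub>G\<^esub> b) l \<one>\<^bsub>G\<^esub> = x)"

definition word_dist :: "('g, 'b) monoid_scheme \<Rightarrow> 'g set \<Rightarrow> 'g \<Rightarrow> 'g \<Rightarrow> real" where
  "word_dist G S x y = real (word_length G S (inv\<^bsub>G\<^esub> x \<otimes>\<^bsub>G\<^esub> y))"

definition gromov_prod :: "('g, 'b) monoid_scheme \<Rightarrow> 'g set \<Rightarrow> 'g \<Rightarrow> 'g \<Rightarrow> 'g \<Rightarrow> real" where
  "gromov_prod G S w x y = (word_dist G S w x + word_dist G S w y - word_dist G S x y) / 2"

definition hyperbolic_group :: "('g, 'b) monoid_scheme \<Rightarrow> bool" where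
  "hyperbolic_group G \<longleftrightarrow> group G \<and>
     (\<exists>S \<delta>. fin_gen_set G S \<and>
        (\<forall>w\<in>carrier G. \<forall>x\<in>carrier G. \<forall>y\<in>carrier G. \<forall>z\<in>carrier G.
           gromov_prod G S w x z \<ge> min (gromov_prod G S w x y) (gromov_prod G S w y z) - \<delta>))"

definition conv_infty :: "('g, 'b) monoid_scheme \<Rightarrow> 'g set \<Rightarrow> (nat \<Rightarrow> 'g) \<Rightarrow> bool" where
  "conv_infty G S s \<longleftrightarrow> (\<forall>n. s n \<in> carrier G) \<and>
     (\<forall>R. \<exists>N. \<forall>m\<ge>N. \<forall>n\<ge>N. gromov_prod G S \<one>\<^bsub>G\<^esub> (s m) (s n) \<ge> R)"

definition seq_equiv :: "('g, 'b) monoid_scheme \<Rightarrow> 'g set \<Rightarrow> (nat \<Rightarrow> 'g) \<Rightarrow> (nat \<Rightarrow> 'g) \<Rightarrow> bool" where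
  "seq_equiv G S s t \<longleftrightarrow>
     (\<forall>R. \<exists>N. \<forall>m\<ge>N. \<forall>n\<ge>N. gromov_prod G S \<one>\<^bsub>G\<^esub> (s m) (t n) \<ge> R)"

definition gromov_boundary :: "('g, 'b) monoid_scheme \<Rightarrow> 'g set \<Rightarrow> (nat \<Rightarrow> 'g) set set" where
  "gromov_boundary G S =
     {{t. conv_infty G S t \<and> seq_equiv G S s t} | s. conv_infty G S s}"

definition bd_gromov_prod :: "('g, 'b) monoid_scheme \<Rightarrow> 'g set \<Rightarrow> (nat \<Rightarrow> 'g) set \<Rightarrow> (nat \<Rightarrow> 'g) set \<Rightarrow> ereal" where
  "bd_gromov_prod G S \<xi> \<eta> =
     (SUP s\<in>\<xi>. SUP t\<in>\<eta>. SUP N. INF p\<in>{p. fst p \<ge> N \<and> snd p \<ge> N}.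
        ereal (gromov_prod G S \<one>\<^bsub>G\<^esub> (s (fst p)) (t (snd p))))"

definition boundary_topology :: "('g, 'b) monoid_scheme \<Rightarrow> 'g set \<Rightarrow> (nat \<Rightarrow> 'g) set topology" where
  "boundary_topology G S = topology (\<lambda>U. U \<subseteq> gromov_boundary G S \<and>
     (\<forall>\<xi>\<in>U. \<exists>r::real. {\<eta>\<in>gromov_boundary G S. bd_gromov_prod G S \<xi> \<eta> > ereal r} \<subseteq> U))"

definition borel_of :: "'a topology \<Rightarrow> 'a measure" where
  "borel_of T = sigma (topspace T) {U. openin T U}"

definition bd_act :: "('g, 'b) monoid_scheme \<Rightarrow> 'g \<Rightarrow> (nat \<Rightarrow> 'g) set \<Rightarrow> (nat \<Rightarrow> 'g) set" where
  "bd_act G x \<xi> = (\<lambda>s n. x \<otimes>\<^bsub>G\<^esub> s n) ` \<xi>"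

definition quasi_invariant :: "('g, 'b) monoid_scheme \<Rightarrow> ('g \<Rightarrow> 'x \<Rightarrow> 'x) \<Rightarrow> 'x measure \<Rightarrow> bool" where
  "quasi_invariant G act \<mu> \<longleftrightarrow>
     (\<forall>x\<in>carrier G. act x \<in> measurable \<mu> \<mu> \<and> null_sets (distr \<mu> \<mu> (act x)) = null_sets \<mu>)"

text \<open>Radon--Nikodym cocycle \<open>P(x,\<omega>) = d\<mu>(x\<^sup>-\<^sup>1\<omega>)/d\<mu>(\<omega>)\<close>; the measure \<open>A \<mapsto> \<mu>(x\<^sup>-\<^sup>1 A)\<close>
  is the push-forward of \<open>\<mu>\<close> under \<open>\<omega> \<mapsto> x\<omega>\<close>.\<close>

definition RN_cocycle :: "('g \<Rightarrow> 'x \<Rightarrow> 'x) \<Rightarrow> 'x measure \<Rightarrow> 'g \<Rightarrow> 'x \<Rightarrow> real" where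
  "RN_cocycle act \<mu> x \<omega> = enn2real (RN_deriv \<mu> (distr \<mu> \<mu> (act x)) \<omega>)"

definition quasi_regular :: "('g, 'b) monoid_scheme \<Rightarrow> ('g \<Rightarrow> 'x \<Rightarrow> 'x) \<Rightarrow> 'x measure
    \<Rightarrow> 'g \<Rightarrow> ('x \<Rightarrow> complex) \<Rightarrow> ('x \<Rightarrow> complex)" where
  "quasi_regular G act \<mu> x F =
     (\<lambda>\<omega>. complex_of_real (sqrt (RN_cocycle act \<mu> x \<omega>)) * F (act (inv\<^bsub>G\<^esub> x) \<omega>))"

definition L2_inner :: "'x measure \<Rightarrow> ('x \<Rightarrow> complex) \<Rightarrow> ('x \<Rightarrow> complex) \<Rightarrow> complex" where
  "L2_inner \<mu> F F' = (LINT \<omega>|\<mu>. F \<omega> * cnj (F' \<omega>))"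

end

theory Submission
  imports Defs "HOL-Real_Asymp.Real_Asymp"
begin

text \<open>
  For square summable \<open>f\<close> the coefficients of the regular representation are dominated by
  \<open>\<Sum>\<^sub>y (w(x\<^sup>-\<^sup>1y) w(y))\<^sup>1\<^sup>/\<^sup>2\<close> with \<open>w = |f|\<^sup>2\<close>, the Hellinger affinity of the measure \<open>w\<close> with its translate
  by \<open>x\<close>; by Cauchy--Schwarz a finite sum of such coefficients is dominated by a single \<open>w\<close>. The affinity is an infimum
  of linear functionals, so the bound survives a limit of the measures \<open>w\<close> (a finitely additive limit exists
  by Tychonoff), and it only increases under equivariant maps and under enlarging the measure. The limit
  content is transported to the compact space of descending fields along one orbit, extended to a countably
  additive measure there, averaged over \<open>G\<close> to make it quasi-invariant, and pushed to the boundary by sending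
  a field to the endpoint of its descending ray. The finite total mass is not prescribed, which absorbs the
  constant lost in averaging. Half of the Morse lemma shows that the boundary does not depend on the
  generating set.
\<close>

section \<open>Gromov products and quasi-geodesics\<close>

text \<open>A pointwise limit of the weights on the group may lose mass at infinity, so the limit is
  taken among finitely additive functions \<open>m\<close> of all subsets. There the affinity has no
  direct meaning; it is replaced by the inequalities \<open>content_bound\<close>, one for each
  positive function with finitely many values. Each of them involves finitely many values of
  \<open>m\<close> and therefore survives limits. Countable additivity is recovered on a compact
  totally disconnected space, where a content on clopen sets extends automatically. The boundary
  need not be such a space, while the space of fields sits inside a Boolean product. The orbit map y
  -> y a0 is equivariant and lands in the fields whether or not the mass has escaped. Two measures
  are kept: \<open>M\<close> carries the inequality, and its average \<open>N\<close> has invariant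
  null sets and dominates \<open>M\<close> up to the factor 2^(n1+1), where \<open>n1\<close> is the
  index of the identity in the enumeration of the group. The argument is run for the coefficient
  multiplied by this factor and divided by the squared norm of \<open>v\<close>, so that the factor
  cancels at the end.\<close>

definition gprod :: "('a \<Rightarrow> 'a \<Rightarrow> real) \<Rightarrow> 'a \<Rightarrow> 'a \<Rightarrow> 'a \<Rightarrow> real" where
  "gprod d w x y = (d w x + d w y - d x y) / 2"

locale discrete_geodesic =
  fixes V :: "'a set" and d :: "'a \<Rightarrow> 'a \<Rightarrow> real"
  assumes dist_self: "x \<in> V \<Longrightarrow> d x x = 0"
    and dist_nonneg: "\<lbrakk>x \<in> V; y \<in> V\<rbrakk> \<Longrightarrow> 0 \<le> d x y"
    and dist_sym: "\<lbrakk>x \<in> V; y \<in> V\<rbrakk> \<Longrightarrow> d x y = d y x"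
    and dist_tri: "\<lbrakk>x \<in> V; y \<in> V; z \<in> V\<rbrakk> \<Longrightarrow> d x z \<le> d x y + d y z"
    and geodesic: "\<lbrakk>x \<in> V; y \<in> V\<rbrakk> \<Longrightarrow> \<exists>\<gamma> n. d x y = real n \<and> \<gamma> 0 = x \<and> \<gamma> n = y \<and>
        (\<forall>i\<le>n. \<gamma> i \<in> V) \<and> (\<forall>i j. i \<le> j \<and> j \<le> n \<longrightarrow> d (\<gamma> i) (\<gamma> j) = real (j - i))"
begin

lemma gprod_le:
  assumes "w \<in> V" "x \<in> V" "y \<in> V"
  shows "gprod d w x y \<le> d w x" "gprod d w x y \<le> d w y" "0 \<le> gprod d w x y"
  using assms dist_tri[of w x y] dist_tri[of w y x] dist_sym[of x y] dist_tri[of x w y] dist_sym[of w x]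
  by (auto simp: gprod_def)

lemma gprod_sym: "\<lbrakk>x \<in> V; y \<in> V\<rbrakk> \<Longrightarrow> gprod d w x y = gprod d w y x"
  by (simp add: gprod_def dist_sym)

lemma gprod_ge_of_far:
  assumes "z \<in> V" "x \<in> V" "y \<in> V" "D \<le> d z x" "D \<le> d z y" "d x y \<le> L"
  shows "D - L / 2 \<le> gprod d z x y"
  using assms by (auto simp: gprod_def)

end

section \<open>Gromov products along chains of points in a hyperbolic space\<close>

locale gromov_hyperbolic = discrete_geodesic +
  fixes \<delta> :: real
  assumes hyp: "\<lbrakk>w \<in> V; x \<in> V; y \<in> V; z \<in> V\<rbrakk> \<Longrightarrow>
      min (gprod d w x y) (gprod d w y z) - \<delta> \<le> gprod d w x z"
begin

text \<open>Bisecting the chain costs one \<open>\<delta>\<close> per level of the bisection, so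
  \<open>\<delta>\<close> is multiplied by the logarithm of the number of steps and not by the
  number itself.\<close>

lemma path_gprod_pow2:
  assumes "z \<in> V" "\<And>i. q i \<in> V" "\<And>i. i < 2 ^ k \<Longrightarrow> c \<le> gprod d z (q i) (q (Suc i))"
  shows "c - real k * \<delta> \<le> gprod d z (q 0) (q (2 ^ k))"
  using assms
proof (induction k arbitrary: q)
  case 0
  then show ?case by auto
next
  case (Suc k)
  have "c - real k * \<delta> \<le> gprod d z (q 0) (q (2 ^ k))"
    using Suc.prems by (intro Suc.IH) auto
  moreover have "c - real k * \<delta> \<le> gprod d z (q (0 + 2 ^ k)) (q (2 ^ k + 2 ^ k))"
    using Suc.prems(3)[of "_ + 2 ^ k"] Suc.prems(1,2) by (intro Suc.IH[of "\<lambda>i. q (i + 2 ^ k)"]) auto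
  ultimately have "c - real k * \<delta> - \<delta> \<le> gprod d z (q 0) (q (2 ^ k + 2 ^ k))"
    using hyp[of z "q 0" "q (2 ^ k)" "q (2 ^ k + 2 ^ k)"] Suc.prems by auto
  then show ?case by (simp add: algebra_simps mult_2)
qed

lemma path_gprod:
  assumes z: "z \<in> V" and q: "\<And>i. i \<le> n \<Longrightarrow> q i \<in> V" and D: "\<And>i. i \<le> n \<Longrightarrow> D \<le> d z (q i)"
    and L: "0 \<le> L" "\<And>i. i < n \<Longrightarrow> d (q i) (q (Suc i)) \<le> L" and n: "n \<le> 2 ^ k"
  shows "D - L / 2 - real k * \<delta> \<le> gprod d z (q 0) (q n)"
proof -
  \<comment> \<open>The path is prolonged by staying at its last point until its length is a power
    of two; the added steps have length 0, which is admissible because \<open>L\<close> is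
    nonnegative.\<close>
  define q' where "q' i = q (min i n)" for i
  have "D - L / 2 - real k * \<delta> \<le> gprod d z (q' 0) (q' (2 ^ k))"
  proof (rule path_gprod_pow2[OF z])
    show "q' i \<in> V" for i using q by (simp add: q'_def)
    show "D - L / 2 \<le> gprod d z (q' i) (q' (Suc i))" for i
    proof (rule gprod_ge_of_far[OF z])
      show "d (q' i) (q' (Suc i)) \<le> L"
      proof (cases "i < n")
        case True
        then show ?thesis using L(2)[OF True] by (simp add: q'_def min_def)
      next
        case False
        then show ?thesis using L(1) q by (auto simp: q'_def min_def dist_self)
      qed
    qed (use q D in \<open>auto simp: q'_def\<close>)
  qed
  then show ?thesis using n by (simp add: q'_def)
qed

text \<open>With truncated subtraction \<open>(i - j) + (j - i)\<close> is the distance between the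
  two indices, so the two points may be given in either order.\<close>

lemma path_gprod_either:
  assumes z: "z \<in> V" and q: "\<And>i. i \<le> n \<Longrightarrow> q i \<in> V" and D: "\<And>i. i \<le> n \<Longrightarrow> D \<le> d z (q i)"
    and L: "0 \<le> L" "\<And>i. i < n \<Longrightarrow> d (q i) (q (Suc i)) \<le> L"
    and ij: "i \<le> n" "j \<le> n" "(i - j) + (j - i) \<le> 2 ^ k"
  shows "D - L / 2 - real k * \<delta> \<le> gprod d z (q i) (q j)"
proof -
  have *: "D - L / 2 - real k * \<delta> \<le> gprod d z (q i) (q j)"
    if "i \<le> j" "j \<le> n" "j - i \<le> 2 ^ k" for i j
    using path_gprod[of z "j - i" "\<lambda>t. q (i + t)" D L k] that assms by auto
  show ?thesis
  proof (cases "i \<le> j")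
    case True
    then show ?thesis using *[of i j] ij by auto
  next
    case False
    then show ?thesis using *[of j i] ij gprod_sym[OF q q, of i j] by auto
  qed
qed

end

text \<open>The scale beyond which a path cannot avoid a ball around a geodesic point: an avoiding path
  of \<open>2\<^sup>k\<close> steps changes Gromov products by at most \<open>k \<delta>\<close>, while its length is linear in \<open>D\<close>.\<close>

lemma log_beats_linear:
  fixes L \<delta> :: real
  assumes "0 < L" "0 \<le> \<delta>"
  obtains D0 where "D0 \<ge> 1" "\<And>D. D > D0 \<Longrightarrow> \<exists>k. 8 * L * D \<le> 2 ^ k \<and> L / 2 + real k * \<delta> + 2 * \<delta> < D"
proof -
  have "eventually (\<lambda>D. L / 2 + (log 2 (8 * L * D) + 1) * \<delta> + 2 * \<delta> < D) at_top"
    using assms by real_asymp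
  then obtain D1 where D1: "\<And>D. D \<ge> D1 \<Longrightarrow> L / 2 + (log 2 (8 * L * D) + 1) * \<delta> + 2 * \<delta> < D"
    by (auto simp: eventually_at_top_linorder)
  show thesis
  proof (rule that[of "max D1 (max 1 (1 / (8 * L)))"])
    fix D assume D: "D > max D1 (max 1 (1 / (8 * L)))"
    \<comment> \<open>The bound 1 / (8L) on \<open>D\<close> makes the logarithm positive, so that
      rounding it up to a natural number is harmless.\<close>
    then have pos: "8 * L * D > 1" using assms by (auto simp: field_simps)
    define k where "k = nat \<lceil>log 2 (8 * L * D)\<rceil>"
    have l0: "log 2 (8 * L * D) \<ge> 0" using pos order_less_trans[OF zero_less_one pos]
      by (metis less_imp_le one_less_numeral_iff semiring_norm(76) zero_le_log_cancel_iff)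
    have k: "log 2 (8 * L * D) \<le> real k" "real k \<le> log 2 (8 * L * D) + 1"
      using l0 unfolding k_def by linarith+
    have "8 * L * D = 2 powr log 2 (8 * L * D)"
      by (rule powr_log_cancel[symmetric]) (use order_less_trans[OF zero_less_one pos] in simp_all)
    also have "\<dots> \<le> 2 powr real k" using k by simp
    finally have "8 * L * D \<le> 2 ^ k" by (simp add: powr_realpow)
    moreover have "real k * \<delta> \<le> (log 2 (8 * L * D) + 1) * \<delta>" using k assms by (intro mult_right_mono) auto
    ultimately show "\<exists>k. 8 * L * D \<le> 2 ^ k \<and> L / 2 + real k * \<delta> + 2 * \<delta> < D"
      using D1[of D] D by (intro exI[of _ k]) auto
  qed auto
qed

context gromov_hyperbolic
begin

lemma delta_nonneg: "x \<in> V \<Longrightarrow> 0 \<le> \<delta>"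
  using hyp[of x x x x] by (auto simp: gprod_def dist_self)

end

text \<open>Only \<open>d\<close> is assumed hyperbolic; the geodesics of the comparable metric
  \<open>e\<close> are quasi-geodesics for \<open>d\<close>. This asymmetry matches the theorem,
  where hyperbolicity is known for one generating set and the boundary is formed with
  another.\<close>

locale two_word_metrics = gromov_hyperbolic V d \<delta> + E: discrete_geodesic V e
  for V :: "'a set" and d \<delta> e +
  fixes L :: real
  assumes Lpos: "0 < L"
    and de: "\<lbrakk>x \<in> V; y \<in> V\<rbrakk> \<Longrightarrow> d x y \<le> L * e x y"
    and ed: "\<lbrakk>x \<in> V; y \<in> V\<rbrakk> \<Longrightarrow> e x y \<le> L * d x y"
begin

text \<open>Let \<open>z\<close> be the point of the \<open>d\<close>-geodesic farthest from the
  \<open>e\<close>-geodesic \<open>q\<close>, at distance \<open>D\<close>. Going about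
  \<open>2 * D\<close> along the \<open>d\<close>-geodesic to either side and then across to
  \<open>q\<close> gives two points of \<open>q\<close> whose product at \<open>z\<close> is at most
  \<open>2 * \<delta>\<close>. The part of \<open>q\<close> between them avoids the open
  \<open>D\<close>-ball around \<open>z\<close> and has length linear in \<open>D\<close>, so the
  same product is at least \<open>D\<close> minus a logarithm of \<open>D\<close>. This bounds
  \<open>D\<close>.\<close>

lemma half_morse:
  obtains D0 where "D0 > 0"
    "\<And>\<gamma> N q n. \<lbrakk>\<And>i. i \<le> N \<Longrightarrow> \<gamma> i \<in> V; \<And>i j. \<lbrakk>i \<le> j; j \<le> N\<rbrakk> \<Longrightarrow> d (\<gamma> i) (\<gamma> j) = real (j - i);
       \<And>i. i \<le> n \<Longrightarrow> q i \<in> V; \<And>i j. \<lbrakk>i \<le> j; j \<le> n\<rbrakk> \<Longrightarrow> e (q i) (q j) = real (j - i);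
       q 0 = \<gamma> 0; q n = \<gamma> N\<rbrakk> \<Longrightarrow> \<forall>i\<le>N. \<exists>j\<le>n. d (\<gamma> i) (q j) \<le> D0"
proof (cases "V = {}")
  case True
  show thesis by (rule that[of 1]) (use True in auto)
next
  case False
  then have d0: "0 \<le> \<delta>" using delta_nonneg by auto
  obtain D0 where D0: "D0 \<ge> 1"
    "\<And>D. D > D0 \<Longrightarrow> \<exists>k. 8 * L * D \<le> 2 ^ k \<and> L / 2 + real k * \<delta> + 2 * \<delta> < D"
    using log_beats_linear[OF Lpos d0] by metis
  show thesis
  proof (rule that[of "max D0 (2 * \<delta>)"])
    fix \<gamma> N q n
    assume g: "\<And>i. i \<le> N \<Longrightarrow> \<gamma> i \<in> V" and gd: "\<And>i j. \<lbrakk>i \<le> j; j \<le> N\<rbrakk> \<Longrightarrow> d (\<gamma> i) (\<gamma> j) = real (j - i)"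
      and q: "\<And>i. i \<le> n \<Longrightarrow> q i \<in> V" and qe: "\<And>i j. \<lbrakk>i \<le> j; j \<le> n\<rbrakk> \<Longrightarrow> e (q i) (q j) = real (j - i)"
      and ends: "q 0 = \<gamma> 0" "q n = \<gamma> N"
    define h where "h i = Min ((\<lambda>j. d (\<gamma> i) (q j)) ` {..n})" for i
    have h_le: "h i \<le> d (\<gamma> i) (q j)" if "j \<le> n" for i j
      unfolding h_def using that by (intro Min_le) auto
    have h_ex: "\<exists>j\<le>n. d (\<gamma> i) (q j) = h i" for i
    proof -
      have "h i \<in> (\<lambda>j. d (\<gamma> i) (q j)) ` {..n}" unfolding h_def by (intro Min_in) auto
      then show ?thesis by auto
    qed
    define D where "D = Max (h ` {..N})"
    have "D \<in> h ` {..N}" unfolding D_def by (intro Max_in) auto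
    then obtain i0 where i0: "i0 \<le> N" "h i0 = D" by auto
    have hD: "h i \<le> D" if "i \<le> N" for i unfolding D_def using that by (intro Max_ge) auto
    define z where "z = \<gamma> i0"
    have zV: "z \<in> V" using g i0 by (simp add: z_def)
    have zq: "D \<le> d z (q j)" if "j \<le> n" for j using h_le[OF that, of i0] i0 by (simp add: z_def)
    have Dnn: "0 \<le> D" using h_ex[of i0] i0 g q dist_nonneg by (metis)
    have qd: "d (q i) (q (Suc i)) \<le> L" if "i < n" for i
      using de[of "q i" "q (Suc i)"] q qe[of i "Suc i"] that by auto
    \<comment> \<open>At a far point the product is at least (2D + D - D) / 2; at an end of the
      geodesic the point already lies on \<open>q\<close>, and the product is its distance to
      \<open>z\<close>.\<close>
    have near: "\<exists>j\<le>n. d (\<gamma> i) (q j) \<le> D \<and> D \<le> gprod d z (\<gamma> i) (q j)"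
      if i: "i \<le> N" and far: "d z (\<gamma> i) \<ge> 2 * D \<or> i = 0 \<or> i = N" for i
    proof (cases "d z (\<gamma> i) \<ge> 2 * D")
      case True
      obtain j where j: "j \<le> n" "d (\<gamma> i) (q j) = h i" using h_ex by blast
      have "D \<le> gprod d z (\<gamma> i) (q j)"
        using True zq[OF j(1)] j hD[OF i] by (auto simp: gprod_def)
      then show ?thesis using j hD[OF i] by auto
    next
      case False
      then have "\<gamma> i = q 0 \<or> \<gamma> i = q n" using far ends by auto
      then obtain j where j: "j \<le> n" "\<gamma> i = q j" by auto
      then have "D \<le> gprod d z (\<gamma> i) (q j)"
        using zq[OF j(1)] q by (auto simp: gprod_def dist_self)
      then show ?thesis using j q Dnn by (intro exI[of _ j]) (auto simp: dist_self)
    qed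
    define s where "s = nat \<lceil>2 * D\<rceil>"
    have s: "2 * D \<le> real s" "real s \<le> 2 * D + 1" using Dnn unfolding s_def by linarith+
    \<comment> \<open>Truncation sends \<open>i1\<close> to 0 when fewer than \<open>s\<close> steps
      are available, which is the end case of \<open>near\<close>; \<open>i2\<close> is cut off at
      \<open>N\<close> for the same reason.\<close>
    define i1 where "i1 = i0 - s"
    define i2 where "i2 = min N (i0 + s)"
    have i12: "i1 \<le> i0" "i0 \<le> i2" "i2 \<le> N" using i0 by (auto simp: i1_def i2_def)
    have dz1: "d z (\<gamma> i1) = real (i0 - i1)" using gd[of i1 i0] i0 i12 dist_sym g by (auto simp: z_def)
    have dz2: "d z (\<gamma> i2) = real (i2 - i0)" using gd[of i0 i2] i12 by (auto simp: z_def)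
    have "d z (\<gamma> i1) \<ge> 2 * D \<or> i1 = 0" "d z (\<gamma> i2) \<ge> 2 * D \<or> i2 = N"
      using dz1 dz2 s by (auto simp: i1_def i2_def)
    then have "\<exists>j\<le>n. d (\<gamma> i1) (q j) \<le> D \<and> D \<le> gprod d z (\<gamma> i1) (q j)"
        "\<exists>j\<le>n. d (\<gamma> i2) (q j) \<le> D \<and> D \<le> gprod d z (\<gamma> i2) (q j)"
      using near[of i1] near[of i2] i12 i0 by auto
    then obtain j1 j2 where j1: "j1 \<le> n" "d (\<gamma> i1) (q j1) \<le> D" "D \<le> gprod d z (\<gamma> i1) (q j1)"
      and j2: "j2 \<le> n" "d (\<gamma> i2) (q j2) \<le> D" "D \<le> gprod d z (\<gamma> i2) (q j2)"
      by blast
    have gV: "\<gamma> i1 \<in> V" "\<gamma> i2 \<in> V" using g i12 i0 by auto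
    have qV: "q j1 \<in> V" "q j2 \<in> V" using q j1 j2 by auto
    \<comment> \<open>The point \<open>z\<close> lies on the geodesic between these two points.
      Replacing each of them by its partner on \<open>q\<close> costs one
      \<open>\<delta>\<close>.\<close>
    have "gprod d z (\<gamma> i1) (\<gamma> i2) = 0"
      using gd[of i1 i2] i12 dz1 dz2 by (auto simp: gprod_def of_nat_diff)
    moreover have "gprod d z (q j2) (\<gamma> i2) = gprod d z (\<gamma> i2) (q j2)" using gV qV by (intro gprod_sym)
    ultimately have min0: "min D (gprod d z (q j1) (q j2)) \<le> 2 * \<delta>"
      using hyp[OF zV gV(1) qV(1) gV(2)] hyp[OF zV qV(1) qV(2) gV(2)] j1 j2 d0 by auto
    \<comment> \<open>The bound \<open>2 * \<delta>\<close> ensures that the minimum in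
      \<open>min0\<close> is not \<open>D\<close> itself; \<open>D0\<close> is the scale where the
      linear term beats the logarithm.\<close>
    have "D \<le> max D0 (2 * \<delta>)"
    proof (rule ccontr)
      assume "\<not> ?thesis"
      then have big: "D > D0" "D > 2 * \<delta>" by auto
      obtain k where k: "8 * L * D \<le> 2 ^ k" "L / 2 + real k * \<delta> + 2 * \<delta> < D" using D0(2)[OF big(1)] by auto
      have "e (q j1) (q j2) = real ((j1 - j2) + (j2 - j1))"
        using qe[of j1 j2] qe[of j2 j1] j1 j2 E.dist_sym[OF qV] by (cases "j1 \<le> j2") auto
      moreover have "e (q j1) (q j2) \<le> L * d (q j1) (q j2)" using ed qV by auto
      moreover have "real (i0 - i1) \<le> real s" "real (i2 - i0) \<le> real s" by (auto simp: i1_def i2_def)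
      \<comment> \<open>The route through \<open>z\<close> has length at most D + s + s + D with s
        at most 2D + 1, hence at most 6D + 2, and D exceeds 1. This is the origin of the constant
        8.\<close>
      then have "d (q j1) (q j2) \<le> 8 * D"
        using dist_tri[OF qV(1) gV(1) qV(2)] dist_tri[OF gV(1) gV(2) qV(2)] dist_sym[OF qV(1) gV(1)]
          dist_tri[OF gV(1) zV gV(2)] dist_sym[OF zV gV(1)] j1 j2 dz1 dz2 s big D0(1)
        by linarith
      then have "L * d (q j1) (q j2) \<le> L * (8 * D)" using Lpos by (intro mult_left_mono) auto
      ultimately have "real ((j1 - j2) + (j2 - j1)) \<le> 2 ^ k" using k(1) by (simp add: mult_ac)
      then have "(j1 - j2) + (j2 - j1) \<le> 2 ^ k" by (metis of_nat_le_iff of_nat_numeral of_nat_power)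
      then have "D - L / 2 - real k * \<delta> \<le> gprod d z (q j1) (q j2)"
        using q zq qd j1(1) j2(1) Lpos by (intro path_gprod_either[OF zV, of n]) auto
      then show False using min0 big k(2) by linarith
    qed
    then show "\<forall>i\<le>N. \<exists>j\<le>n. d (\<gamma> i) (q j) \<le> max D0 (2 * \<delta>)"
      using h_ex hD by (metis order_trans)
  qed (use D0 in auto)
qed

text \<open>A small product at \<open>z\<close> means that \<open>z\<close> is near the
  \<open>d\<close>-geodesic from \<open>a\<close> to \<open>b\<close>, hence by
  \<open>half_morse\<close> near the \<open>e\<close>-geodesic, and the \<open>e\<close>-distance
  from \<open>z\<close> to any point of that geodesic bounds the \<open>e\<close>-product.\<close>

lemma gprod_transfer:
  obtains K where "K \<ge> 0"
    "\<And>a b z. \<lbrakk>a \<in> V; b \<in> V; z \<in> V; gprod d z a b \<le> c\<rbrakk> \<Longrightarrow> gprod e z a b \<le> K"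
proof -
  obtain D0 where D0: "D0 > 0"
    "\<And>\<gamma> N q n. \<lbrakk>\<And>i. i \<le> N \<Longrightarrow> \<gamma> i \<in> V; \<And>i j. \<lbrakk>i \<le> j; j \<le> N\<rbrakk> \<Longrightarrow> d (\<gamma> i) (\<gamma> j) = real (j - i);
       \<And>i. i \<le> n \<Longrightarrow> q i \<in> V; \<And>i j. \<lbrakk>i \<le> j; j \<le> n\<rbrakk> \<Longrightarrow> e (q i) (q j) = real (j - i);
       q 0 = \<gamma> 0; q n = \<gamma> N\<rbrakk> \<Longrightarrow> \<forall>i\<le>N. \<exists>j\<le>n. d (\<gamma> i) (q j) \<le> D0"
    by (rule half_morse) blast
  define K where "K = L * (\<bar>c\<bar> + 1 + 2 * \<bar>\<delta>\<bar> + D0)"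
  show thesis
  proof (rule that)
    show "K \<ge> 0" using Lpos D0(1) by (simp add: K_def)
    fix a b z
    assume V: "a \<in> V" "b \<in> V" "z \<in> V" and c: "gprod d z a b \<le> c"
    obtain \<gamma> N where g: "d a b = real N" "\<gamma> 0 = a" "\<gamma> N = b" "\<forall>i\<le>N. \<gamma> i \<in> V"
      "\<forall>i j. i \<le> j \<and> j \<le> N \<longrightarrow> d (\<gamma> i) (\<gamma> j) = real (j - i)"
      using geodesic[OF V(1,2)] by blast
    obtain q n where q: "e a b = real n" "q 0 = a" "q n = b" "\<forall>i\<le>n. q i \<in> V"
      "\<forall>i j. i \<le> j \<and> j \<le> n \<longrightarrow> e (q i) (q j) = real (j - i)"
      using E.geodesic[OF V(1,2)] by blast
    \<comment> \<open>Up to rounding, \<open>\<gamma> i\<close> is the point of the side from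
      \<open>a\<close> to \<open>b\<close> where the tripod of the triangle \<open>a\<close>,
      \<open>b\<close>, \<open>z\<close> branches. The 1 in \<open>K\<close> comes from the rounding
      and \<open>2 * \<bar>\<delta>\<bar>\<close> from hyperbolicity.\<close>
    define i where "i = nat \<lfloor>gprod d a z b\<rfloor>"
    have "gprod d a z b \<le> d a b" "0 \<le> gprod d a z b" using gprod_le[OF V(1,3,2)] by auto
    then have i: "i \<le> N" "real i \<le> gprod d a z b" "gprod d a z b \<le> real i + 1"
      using g(1) unfolding i_def by linarith+
    have mV: "\<gamma> i \<in> V" using g i by auto
    obtain j where j: "j \<le> n" "d (\<gamma> i) (q j) \<le> D0"
    proof -
      have "\<forall>i\<le>N. \<exists>j\<le>n. d (\<gamma> i) (q j) \<le> D0" by (rule D0(2)) (use g q in auto)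
      then show ?thesis using i that by blast
    qed
    have qV: "q j \<in> V" using q j by auto
    have dm: "d a (\<gamma> i) = real i" "d (\<gamma> i) b = real N - real i"
      using g(5)[rule_format, of 0 i] g(5)[rule_format, of i N] g(2,3) i by (auto simp: of_nat_diff)
    have "gprod d a b (\<gamma> i) = real i"
      using dm g dist_sym[OF mV V(2)] by (simp add: gprod_def)
    then have "real i - \<delta> \<le> gprod d a z (\<gamma> i)"
      using hyp[OF V(1,3,2) mV] i by auto
    then have "d z (\<gamma> i) \<le> d a z - real i + 2 * \<delta>" using dm by (simp add: gprod_def)
    moreover have "gprod d a z b + gprod d z a b = d a z"
      using dist_sym V by (simp add: gprod_def field_simps)
    ultimately have "d z (\<gamma> i) \<le> c + 1 + 2 * \<delta>" using i c by linarith
    then have "d z (q j) \<le> \<bar>c\<bar> + 1 + 2 * \<bar>\<delta>\<bar> + D0"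
      using dist_tri[OF V(3) mV qV] j by linarith
    then have "L * d z (q j) \<le> K" unfolding K_def using Lpos by (intro mult_left_mono) auto
    then have "e z (q j) \<le> K" using ed[OF V(3) qV] by simp
    moreover have "e a (q j) + e (q j) b = e a b"
      using q(5)[rule_format, of 0 j] q(5)[rule_format, of j n] q j by auto
    ultimately show "gprod e z a b \<le> K"
      using E.dist_tri[OF V(3) qV V(1)] E.dist_tri[OF V(3) qV V(2)] E.dist_sym[OF qV V(1)]
      by (simp add: gprod_def)
  qed
qed

text \<open>Both products \<open>(a|b)\<^sub>w\<close> are measured by the distance from \<open>w\<close> to the same quasi-centre \<open>m\<close> of the triple.\<close>

lemma gprod_comparable:
  obtains A B where "A > 0"
    "\<And>w a b. \<lbrakk>w \<in> V; a \<in> V; b \<in> V\<rbrakk> \<Longrightarrow> gprod d w a b \<le> A * gprod e w a b + B"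
    "\<And>w a b. \<lbrakk>w \<in> V; a \<in> V; b \<in> V\<rbrakk> \<Longrightarrow> gprod e w a b \<le> A * gprod d w a b + B"
proof -
  obtain K where K: "K \<ge> 0"
    "\<And>a b z. \<lbrakk>a \<in> V; b \<in> V; z \<in> V; gprod d z a b \<le> 1 + \<bar>\<delta>\<bar>\<rbrakk> \<Longrightarrow> gprod e z a b \<le> K"
    by (rule gprod_transfer) blast
  have *: "gprod d w a b \<le> L * gprod e w a b + (K + 2 * L * K + 1) \<and>
      gprod e w a b \<le> L * gprod d w a b + (K + 2 * L * K + 1)"
    if V: "w \<in> V" "a \<in> V" "b \<in> V" for w a b
  proof -
    obtain \<gamma> N where g: "d w a = real N" "\<gamma> 0 = w" "\<gamma> N = a" "\<forall>i\<le>N. \<gamma> i \<in> V"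
      "\<forall>i j. i \<le> j \<and> j \<le> N \<longrightarrow> d (\<gamma> i) (\<gamma> j) = real (j - i)"
      using geodesic[OF V(1,2)] by blast
    \<comment> \<open>This is the index of the quasi-centre: the branch point of the triangle on the
      side from \<open>w\<close> to \<open>a\<close>. All three products based there are at most
      \<open>1 + \<bar>\<delta>\<bar>\<close>.\<close>
    define i where "i = nat \<lfloor>gprod d w a b\<rfloor>"
    have "gprod d w a b \<le> d w a" "0 \<le> gprod d w a b" using gprod_le[OF V] by auto
    then have i: "i \<le> N" "real i \<le> gprod d w a b" "gprod d w a b \<le> real i + 1"
      using g(1) unfolding i_def by linarith+
    define m where "m = \<gamma> i"
    have mV: "m \<in> V" using g i by (auto simp: m_def)
    have dm: "d w m = real i" "d m a = d w a - real i"
      using g(5)[rule_format, of 0 i] g(5)[rule_format, of i N] g(1-3) i by (auto simp: of_nat_diff m_def)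
    have wm: "gprod d w m a = real i"
      using dm g by (simp add: gprod_def)
    then have wmb: "real i - \<delta> \<le> gprod d w m b"
      using hyp[OF V(1) mV V(2,3)] i by auto
    have 1: "gprod d m w a \<le> 1 + \<bar>\<delta>\<bar>"
      using dm dist_sym[OF mV V(1)] by (simp add: gprod_def)
    have 2: "gprod d m w b \<le> 1 + \<bar>\<delta>\<bar>"
      using dm wmb dist_sym[OF mV V(1)] abs_ge_self[of \<delta>] unfolding gprod_def by (simp add: field_simps)
    have 3: "gprod d m a b \<le> 1 + \<bar>\<delta>\<bar>"
      using dm wmb i abs_ge_self[of \<delta>] unfolding gprod_def by (simp add: field_simps)
    have "gprod e m w a \<le> K" "gprod e m w b \<le> K" "gprod e m a b \<le> K"
      using K(2) V mV 1 2 3 by auto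
    moreover have "0 \<le> gprod e m w a" "0 \<le> gprod e m w b" "0 \<le> gprod e m a b"
      using E.gprod_le V mV by auto
    \<comment> \<open>This identity holds for any symmetric distance and any \<open>m\<close>. The
      three products at \<open>m\<close> are bounded by \<open>K\<close>, so the product at
      \<open>w\<close> is \<open>e w m\<close> up to a constant, just as the
      \<open>d\<close>-product is \<open>d w m\<close> up to rounding.\<close>
    moreover have "gprod e w a b = e w m + gprod e m a b - gprod e m w a - gprod e m w b"
      using E.dist_sym[OF mV V(1)] by (simp add: gprod_def field_simps)
    ultimately have e: "e w m - 2 * K \<le> gprod e w a b" "gprod e w a b \<le> e w m + K" by linarith+
    have "gprod d w a b \<le> L * e w m + 1" using i dm de[OF V(1) mV] by linarith
    moreover have "L * e w m \<le> L * (gprod e w a b + 2 * K)" using e Lpos by (intro mult_left_mono) auto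
    ultimately have A: "gprod d w a b \<le> L * gprod e w a b + (K + 2 * L * K + 1)"
      using K(1) by (simp add: algebra_simps)
    have "L * d w m \<le> L * gprod d w a b" using i dm Lpos by (intro mult_left_mono) auto
    moreover have "0 \<le> 2 * L * K" using Lpos K by simp
    ultimately have "gprod e w a b \<le> L * gprod d w a b + (K + 2 * L * K + 1)"
      using e ed[OF V(1) mV] by linarith
    then show ?thesis using A by simp
  qed
  show thesis by (rule that[OF Lpos]) (use * in blast)+
qed

end

section \<open>Word metrics\<close>

lemma foldr_mult_append:
  fixes G (structure)
  assumes "group G" "set l \<subseteq> carrier G" "set l' \<subseteq> carrier G"
  shows "foldr (\<otimes>) (l @ l') \<one> = foldr (\<otimes>) l \<one> \<otimes> foldr (\<otimes>) l' \<one> \<and> foldr (\<otimes>) l \<one> \<in> carrier G"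
proof -
  interpret group G by fact
  have c: "foldr (\<otimes>) l' \<one> \<in> carrier G" using assms(3) by (induction l') auto
  show ?thesis using assms(2) c by (induction l) (auto simp: m_assoc)
qed

locale fg_group = group G for G (structure) +
  fixes S :: "'a set"
  assumes gen: "fin_gen_set G S"
begin

definition T where "T = S \<union> m_inv G ` S"

abbreviation word where "word l \<equiv> foldr (\<otimes>) l \<one>"

abbreviation d where "d \<equiv> word_dist G S"

lemma inv_cancel [simp]: "\<lbrakk>x \<in> carrier G; y \<in> carrier G\<rbrakk> \<Longrightarrow> inv x \<otimes> (x \<otimes> y) = y"
  "\<lbrakk>x \<in> carrier G; y \<in> carrier G\<rbrakk> \<Longrightarrow> x \<otimes> (inv x \<otimes> y) = y"
  by (simp_all add: m_assoc[symmetric])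

lemma T_carrier: "T \<subseteq> carrier G" and T_finite: "finite T"
  using gen by (auto simp: T_def fin_gen_set_def)

lemma T_inv: "s \<in> T \<Longrightarrow> inv s \<in> T"
  using gen by (auto simp: T_def fin_gen_set_def)

lemma word_closed: "set l \<subseteq> T \<Longrightarrow> word l \<in> carrier G"
  using foldr_mult_append[OF is_group, of l "[]"] T_carrier by auto

lemma word_append: "\<lbrakk>set l \<subseteq> T; set l' \<subseteq> T\<rbrakk> \<Longrightarrow> word (l @ l') = word l \<otimes> word l'"
  using foldr_mult_append[OF is_group, of l l'] T_carrier by auto

lemma word_exists:
  assumes "x \<in> carrier G"
  shows "\<exists>l. set l \<subseteq> T \<and> word l = x"
proof -
  have "x \<in> generate G S" using assms gen by (auto simp: fin_gen_set_def)
  then show ?thesis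
  proof induction
    case one
    then show ?case by (intro exI[of _ "[]"]) auto
  next
    case (incl h)
    then show ?case using T_carrier by (intro exI[of _ "[h]"]) (auto simp: T_def)
  next
    case (inv h)
    then show ?case using T_carrier by (intro exI[of _ "[inv h]"]) (auto simp: T_def)
  next
    case (eng h1 h2)
    then obtain l1 l2 where "set l1 \<subseteq> T" "word l1 = h1" "set l2 \<subseteq> T" "word l2 = h2" by auto
    then show ?case using word_append[of l1 l2] by (intro exI[of _ "l1 @ l2"]) auto
  qed
qed

lemma word_length_attained:
  assumes "x \<in> carrier G"
  obtains l where "set l \<subseteq> T" "word l = x" "length l = word_length G S x"
proof -
  have "\<exists>n l. length l = n \<and> set l \<subseteq> T \<and> word l = x" using word_exists[OF assms] by auto
  from LeastI_ex[OF this] show thesis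
    using that unfolding word_length_def T_def by blast
qed

lemma word_length_le: "set l \<subseteq> T \<Longrightarrow> word_length G S (word l) \<le> length l"
  unfolding word_length_def T_def by (rule Least_le) auto

lemma word_length_mult:
  assumes "x \<in> carrier G" "y \<in> carrier G"
  shows "word_length G S (x \<otimes> y) \<le> word_length G S x + word_length G S y"
proof -
  obtain l l' where "set l \<subseteq> T" "word l = x" "length l = word_length G S x"
    "set l' \<subseteq> T" "word l' = y" "length l' = word_length G S y"
    using assms by (meson word_length_attained)
  then show ?thesis using word_append[of l l'] word_length_le[of "l @ l'"] by auto
qed

lemma word_length_one [simp]: "word_length G S \<one> = 0"
  using word_length_le[of "[]"] by simp

lemma word_rev_inv:
  assumes "set l \<subseteq> T"
  shows "word (rev (map (m_inv G) l)) = inv (word l)"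
  using assms
proof (induction l)
  case (Cons s l)
  have "word (rev (map (m_inv G) l) @ [inv s]) = word (rev (map (m_inv G) l)) \<otimes> word [inv s]"
    using Cons.prems T_inv by (intro word_append) auto
  also have "\<dots> = inv (word l) \<otimes> inv s" using Cons T_carrier by auto
  also have "\<dots> = inv (s \<otimes> word l)"
    using Cons.prems T_carrier word_closed[of l] by (intro inv_mult_group[symmetric]) auto
  finally show ?case by simp
qed auto

lemma word_length_inv:
  assumes "x \<in> carrier G"
  shows "word_length G S (inv x) = word_length G S x"
proof -
  have *: "word_length G S (inv x) \<le> word_length G S x" if x: "x \<in> carrier G" for x
  proof -
    obtain l where l: "set l \<subseteq> T" "word l = x" "length l = word_length G S x"
      using word_length_attained[OF x] .
    then show ?thesis using word_length_le[of "rev (map (m_inv G) l)"] T_inv word_rev_inv[of l]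
      by (auto simp: image_subset_iff subset_iff)
  qed
  show ?thesis using *[OF assms] *[of "inv x"] assms by auto
qed

lemma word_length_shorten:
  assumes "x \<in> carrier G" "x \<noteq> \<one>"
  obtains s y where "s \<in> T" "y \<in> carrier G" "x = s \<otimes> y" "word_length G S x = Suc (word_length G S y)"
proof -
  obtain l where l: "set l \<subseteq> T" "word l = x" "length l = word_length G S x"
    using word_length_attained[OF assms(1)] .
  with assms obtain s l' where l': "l = s # l'" by (cases l) auto
  then have *: "s \<in> T" "set l' \<subseteq> T" "x = s \<otimes> word l'" using l by auto
  moreover have y: "word l' \<in> carrier G" using word_closed * by auto
  moreover have "word_length G S x \<le> word_length G S s + word_length G S (word l')"
    using * y word_length_mult[of s "word l'"] T_carrier by auto
  moreover have "word_length G S s \<le> 1" using word_length_le[of "[s]"] * T_carrier by auto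
  moreover have "word_length G S (word l') \<le> length l'" using word_length_le * by auto
  ultimately show thesis using l l' by (intro that[of s "word l'"]) auto
qed

lemma dist_invariant: "\<lbrakk>x \<in> carrier G; y \<in> carrier G; z \<in> carrier G\<rbrakk> \<Longrightarrow> d (x \<otimes> y) (x \<otimes> z) = d y z"
  by (simp add: word_dist_def inv_mult_group m_assoc)

lemma word_dist_triangle: "\<lbrakk>x \<in> carrier G; y \<in> carrier G; z \<in> carrier G\<rbrakk> \<Longrightarrow> d x z \<le> d x y + d y z"
  using word_length_mult[of "inv x \<otimes> y" "inv y \<otimes> z"]
  by (simp add: word_dist_def m_assoc flip: of_nat_add)

lemma word_dist_commute: "\<lbrakk>x \<in> carrier G; y \<in> carrier G\<rbrakk> \<Longrightarrow> d x y = d y x"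
  using word_length_inv[of "inv x \<otimes> y"] by (simp add: word_dist_def inv_mult_group)

lemma dist_generator: "\<lbrakk>g \<in> carrier G; s \<in> T\<rbrakk> \<Longrightarrow> d g (g \<otimes> s) \<le> 1"
  using word_length_le[of "[s]"] T_carrier by (auto simp: word_dist_def)

lemma dist_integer: "\<exists>n. d x y = real n"
  by (auto simp: word_dist_def)

lemma descending_generator:
  assumes "g \<in> carrier G" "z \<in> carrier G" "g \<noteq> z"
  shows "\<exists>s\<in>T. d (g \<otimes> s) z < d g z"
proof -
  have "inv g \<otimes> z \<noteq> \<one>" using assms by (metis inv_solve_left one_closed r_one)
  then obtain s y where s: "s \<in> T" "y \<in> carrier G" "inv g \<otimes> z = s \<otimes> y"
    "word_length G S (inv g \<otimes> z) = Suc (word_length G S y)"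
    using word_length_shorten[of "inv g \<otimes> z"] assms by auto
  then have "inv (g \<otimes> s) \<otimes> z = y"
    using assms T_carrier by (auto simp: inv_mult_group m_assoc)
  then show ?thesis using s by (intro bexI[of _ s]) (auto simp: word_dist_def)
qed

text \<open>Distances are integers and change by at most one along an edge. Hence one Boolean per
  edge suffices to record how the distance to a vertex decreases.\<close>

lemma descending_drop:
  assumes "g \<in> carrier G" "s \<in> T" "z \<in> carrier G" "d (g \<otimes> s) z < d g z"
  shows "d g z = d (g \<otimes> s) z + 1"
proof -
  have "d g z \<le> 1 + d (g \<otimes> s) z"
    using word_dist_triangle[of g "g \<otimes> s" z] dist_generator assms T_carrier by force
  moreover obtain n m where "d g z = real n" "d (g \<otimes> s) z = real m" using dist_integer by metis
  ultimately show ?thesis using assms(4) by auto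
qed

sublocale W: discrete_geodesic "carrier G" d
proof
  fix x y assume xy: "x \<in> carrier G" "y \<in> carrier G"
  obtain l where l: "set l \<subseteq> T" "word l = inv x \<otimes> y" "length l = word_length G S (inv x \<otimes> y)"
    using word_length_attained[of "inv x \<otimes> y"] xy by auto
  define n where "n = length l"
  define \<gamma> where "\<gamma> i = x \<otimes> word (take i l)" for i
  have sub: "set (take i l) \<subseteq> T" "set (drop i l) \<subseteq> T" for i
    using l set_take_subset[of i l] set_drop_subset[of i l] by auto
  have wc: "word (take i l) \<in> carrier G" for i using word_closed sub by auto
  have g: "\<gamma> i \<in> carrier G" for i using wc xy by (auto simp: \<gamma>_def)
  have ends: "\<gamma> 0 = x" "\<gamma> n = y" using xy l by (auto simp: \<gamma>_def n_def)
  have dxy: "d x y = real n" using l by (simp add: word_dist_def n_def)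
  have le: "d (\<gamma> i) (\<gamma> j) \<le> real (j - i)" if "i \<le> j" for i j
  proof -
    have "take j l = take i l @ take (j - i) (drop i l)"
      using that by (metis le_add_diff_inverse take_add)
    then have "word (take j l) = word (take i l) \<otimes> word (take (j - i) (drop i l))"
      using word_append sub set_take_subset by (metis order_trans)
    moreover have *: "set (take (j - i) (drop i l)) \<subseteq> T" using sub set_take_subset by (metis order_trans)
    ultimately have "inv (\<gamma> i) \<otimes> \<gamma> j = word (take (j - i) (drop i l))"
      using wc[of i] xy word_closed[OF *] by (simp add: \<gamma>_def inv_mult_group m_assoc)
    then show ?thesis using word_length_le[OF *] by (simp add: word_dist_def)
  qed
  \<comment> \<open>The prefixes of a shortest word give only upper bounds; the three bounds add up
    to \<open>d x y\<close>, so the triangle inequality forces equality in each.\<close>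
  have "d (\<gamma> i) (\<gamma> j) = real (j - i)" if "i \<le> j" "j \<le> n" for i j
    using word_dist_triangle[OF g[of 0] g[of i] g[of n]] word_dist_triangle[OF g[of i] g[of j] g[of n]]
      le[of 0 i] le[OF that(1)] le[OF that(2)] that dxy ends by auto
  then show "\<exists>\<gamma> n. d x y = real n \<and> \<gamma> 0 = x \<and> \<gamma> n = y \<and> (\<forall>i\<le>n. \<gamma> i \<in> carrier G) \<and>
      (\<forall>i j. i \<le> j \<and> j \<le> n \<longrightarrow> d (\<gamma> i) (\<gamma> j) = real (j - i))"
    using dxy ends g by (intro exI[of _ \<gamma>] exI[of _ n]) auto
qed (use word_dist_triangle word_dist_commute in \<open>auto simp: word_dist_def\<close>)

lemma gromov_prod_eq: "gromov_prod G S = gprod d"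
  by (intro ext) (simp add: gromov_prod_def gprod_def)

lemma countable_carrier: "countable (carrier G)"
proof -
  have "carrier G \<subseteq> word ` lists T" using word_exists by force
  moreover have "countable (lists T)" using T_finite by (intro countable_lists countable_finite)
  ultimately show ?thesis by (metis countable_image countable_subset)
qed

end

lemma word_dist_dominated:
  assumes "group G" "fin_gen_set G S" "fin_gen_set G S'"
  obtains L where "L > 0" "\<And>x y. \<lbrakk>x \<in> carrier G; y \<in> carrier G\<rbrakk> \<Longrightarrow> word_dist G S x y \<le> L * word_dist G S' x y"
proof -
  interpret A: fg_group G S using assms by (simp add: fg_group_def fg_group_axioms_def)
  interpret B: fg_group G S' using assms by (simp add: fg_group_def fg_group_axioms_def)
  \<comment> \<open>The inserted 1 keeps the constant positive and the maximum defined even without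
    generators.\<close>
  define L where "L = Max (insert 1 (word_length G S ` B.T))"
  have L: "L \<ge> 1" "\<And>s. s \<in> B.T \<Longrightarrow> word_length G S s \<le> L"
    unfolding L_def using B.T_finite by (auto intro: Max_ge)
  have *: "word_length G S (B.word l) \<le> L * length l" if "set l \<subseteq> B.T" for l
    using that
  proof (induction l)
    case (Cons s l)
    have "word_length G S (B.word (s # l)) \<le> word_length G S s + word_length G S (B.word l)"
      using Cons.prems B.T_carrier B.word_closed[of l] by (auto intro!: A.word_length_mult)
    then show ?case using Cons L(2)[of s] by auto
  qed auto
  have **: "word_length G S x \<le> L * word_length G S' x" if x: "x \<in> carrier G" for x
  proof -
    obtain l where "set l \<subseteq> B.T" "B.word l = x" "length l = word_length G S' x"
      using B.word_length_attained[OF x] .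
    then show ?thesis using *[of l] by auto
  qed
  show thesis
  proof (rule that[of "real L"])
    show "real L > 0" using L by auto
    fix x y assume "x \<in> carrier G" "y \<in> carrier G"
    then show "word_dist G S x y \<le> real L * word_dist G S' x y"
      using **[of "inv\<^bsub>G\<^esub> x \<otimes>\<^bsub>G\<^esub> y"] unfolding word_dist_def
      by (metis A.inv_closed A.m_closed of_nat_le_iff of_nat_mult)
  qed
qed

text \<open>Only \<open>S\<close> is required to satisfy the four-point condition. This is the
  bridge from the generating set that witnesses hyperbolicity to an arbitrary one.\<close>

lemma gromov_prod_comparable:
  assumes "group G" "fin_gen_set G S" "fin_gen_set G S'"
    and "\<forall>w\<in>carrier G. \<forall>x\<in>carrier G. \<forall>y\<in>carrier G. \<forall>z\<in>carrier G.
           gromov_prod G S w x z \<ge> min (gromov_prod G S w x y) (gromov_prod G S w y z) - \<delta>"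
  obtains A B where "A > 0"
    "\<And>w a b. \<lbrakk>w \<in> carrier G; a \<in> carrier G; b \<in> carrier G\<rbrakk> \<Longrightarrow> gromov_prod G S w a b \<le> A * gromov_prod G S' w a b + B"
    "\<And>w a b. \<lbrakk>w \<in> carrier G; a \<in> carrier G; b \<in> carrier G\<rbrakk> \<Longrightarrow> gromov_prod G S' w a b \<le> A * gromov_prod G S w a b + B"
proof -
  interpret A: fg_group G S using assms by (simp add: fg_group_def fg_group_axioms_def)
  interpret B: fg_group G S' using assms by (simp add: fg_group_def fg_group_axioms_def)
  obtain L1 where L1: "L1 > 0" "\<And>x y. \<lbrakk>x \<in> carrier G; y \<in> carrier G\<rbrakk> \<Longrightarrow> A.d x y \<le> L1 * B.d x y"
    using word_dist_dominated[OF assms(1-3)] by metis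
  obtain L2 where L2: "L2 > 0" "\<And>x y. \<lbrakk>x \<in> carrier G; y \<in> carrier G\<rbrakk> \<Longrightarrow> B.d x y \<le> L2 * A.d x y"
    using word_dist_dominated[OF assms(1,3,2)] by metis
  interpret two_word_metrics "carrier G" A.d \<delta> B.d "max L1 L2"
  proof unfold_locales
    fix x y assume xy: "x \<in> carrier G" "y \<in> carrier G"
    have "L1 * B.d x y \<le> max L1 L2 * B.d x y" "L2 * A.d x y \<le> max L1 L2 * A.d x y"
      using A.W.dist_nonneg[OF xy] B.W.dist_nonneg[OF xy] by (auto intro!: mult_right_mono)
    then show "A.d x y \<le> max L1 L2 * B.d x y" "B.d x y \<le> max L1 L2 * A.d x y"
      using L1(2)[OF xy] L2(2)[OF xy] by linarith+
  qed (use L1 assms(4) in \<open>auto simp: A.gromov_prod_eq\<close>)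
  show thesis by (rule gprod_comparable) (rule that[unfolded A.gromov_prod_eq B.gromov_prod_eq])
qed

section \<open>The boundary and its topology\<close>

text \<open>A strict lower bound on an infimum needs a uniform gap, hence the intermediate
  \<open>r'\<close>; the suprema over representatives and over \<open>N\<close> become plain
  existential quantifiers.\<close>

lemma less_bd_gromov_prod_iff:
  "ereal r < bd_gromov_prod G S \<xi> \<eta> \<longleftrightarrow>
    (\<exists>s\<in>\<xi>. \<exists>t\<in>\<eta>. \<exists>N. \<exists>r'>r. \<forall>m\<ge>N. \<forall>n\<ge>N. r' \<le> gromov_prod G S \<one>\<^bsub>G\<^esub> (s m) (t n))"
proof -
  have *: "ereal r < (INF p\<in>{p. fst p \<ge> N \<and> snd p \<ge> N}. ereal (f (fst p) (snd p))) \<longleftrightarrow>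
      (\<exists>r'>r. \<forall>m\<ge>N. \<forall>n\<ge>N. r' \<le> f m n)" for N :: nat and f :: "nat \<Rightarrow> nat \<Rightarrow> real"
  proof
    assume "ereal r < (INF p\<in>{p. fst p \<ge> N \<and> snd p \<ge> N}. ereal (f (fst p) (snd p)))"
    then obtain r' where r': "ereal r < ereal r'" "ereal r' < (INF p\<in>{p. fst p \<ge> N \<and> snd p \<ge> N}. ereal (f (fst p) (snd p)))"
      using ereal_dense2 by blast
    then have "r' \<le> f m n" if "m \<ge> N" "n \<ge> N" for m n
      using less_INF_D[OF r'(2), of "(m, n)"] that by auto
    then show "\<exists>r'>r. \<forall>m\<ge>N. \<forall>n\<ge>N. r' \<le> f m n" using r' by auto
  next
    assume "\<exists>r'>r. \<forall>m\<ge>N. \<forall>n\<ge>N. r' \<le> f m n"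
    then obtain r' where r': "r < r'" "\<forall>m\<ge>N. \<forall>n\<ge>N. r' \<le> f m n" by auto
    then have "ereal r' \<le> (INF p\<in>{p. fst p \<ge> N \<and> snd p \<ge> N}. ereal (f (fst p) (snd p)))"
      by (intro INF_greatest) auto
    then show "ereal r < (INF p\<in>{p. fst p \<ge> N \<and> snd p \<ge> N}. ereal (f (fst p) (snd p)))"
      by (rule order_less_le_trans[rotated]) (use r'(1) in simp)
  qed
  show ?thesis
    unfolding bd_gromov_prod_def less_SUP_iff
      *[where f = "\<lambda>m n. gromov_prod G S \<one>\<^bsub>G\<^esub> (s m) (t n)" for s t] bex_UNIV ..
qed

text \<open>These are the sets quantified over in \<open>boundary_topology\<close>. They are not
  claimed to be open; for the topology axioms it suffices that they shrink as \<open>r\<close>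
  grows.\<close>

definition bd_ball :: "('g, 'b) monoid_scheme \<Rightarrow> 'g set \<Rightarrow> (nat \<Rightarrow> 'g) set \<Rightarrow> real \<Rightarrow> (nat \<Rightarrow> 'g) set set" where
  "bd_ball G S \<xi> r = {\<eta>\<in>gromov_boundary G S. bd_gromov_prod G S \<xi> \<eta> > ereal r}"

lemma bd_ball_mono: "r \<le> r' \<Longrightarrow> bd_ball G S \<xi> r' \<subseteq> bd_ball G S \<xi> r"
proof -
  assume "r \<le> r'"
  then have "ereal r < x" if "ereal r' < x" for x
    using le_less_trans[OF _ that, of "ereal r"] by simp
  then show "bd_ball G S \<xi> r' \<subseteq> bd_ball G S \<xi> r" unfolding bd_ball_def by (intro Collect_mono conj_mono impI)
qed

lemma boundary_openin:
  "openin (boundary_topology G S) U \<longleftrightarrow>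
    U \<subseteq> gromov_boundary G S \<and> (\<forall>\<xi>\<in>U. \<exists>r. bd_ball G S \<xi> r \<subseteq> U)"
proof -
  have "istopology (\<lambda>U. U \<subseteq> gromov_boundary G S \<and> (\<forall>\<xi>\<in>U. \<exists>r. bd_ball G S \<xi> r \<subseteq> U))" (is "istopology ?P")
    unfolding istopology_def
  proof (rule conjI; intro allI impI)
    fix U V assume UV: "?P U" "?P V"
    have "\<exists>r. bd_ball G S \<xi> r \<subseteq> U \<inter> V" if "\<xi> \<in> U \<inter> V" for \<xi>
    proof -
      have "\<xi> \<in> U" "\<xi> \<in> V" using that by simp_all
      then obtain r r' where "bd_ball G S \<xi> r \<subseteq> U" "bd_ball G S \<xi> r' \<subseteq> V"
        using UV[THEN conjunct2, THEN bspec] by metis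
      then have "bd_ball G S \<xi> (max r r') \<subseteq> U \<inter> V"
        using order_trans[OF bd_ball_mono[OF max.cobounded1]] order_trans[OF bd_ball_mono[OF max.cobounded2]]
        by (intro Int_greatest)
      then show ?thesis ..
    qed
    then show "?P (U \<inter> V)" using UV by (intro conjI ballI le_infI1) simp_all
  next
    fix K assume K: "\<forall>U\<in>K. ?P U"
    have "\<exists>r. bd_ball G S \<xi> r \<subseteq> \<Union> K" if U: "U \<in> K" "\<xi> \<in> U" for \<xi> U
    proof -
      obtain r where "bd_ball G S \<xi> r \<subseteq> U" using K[THEN bspec, OF U(1)] U(2) by metis
      then have "bd_ball G S \<xi> r \<subseteq> \<Union> K" using Union_upper[OF U(1)] by (rule order_trans)
      then show ?thesis ..
    qed
    moreover have "\<Union> K \<subseteq> gromov_boundary G S" using K by (intro Union_least) simp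
    ultimately show "?P (\<Union> K)" by (intro conjI ballI) (auto elim!: UnionE simp del: Union_iff)
  qed
  then have "openin (topology ?P) = ?P" by (rule topology_inverse')
  moreover have "boundary_topology G S = topology ?P"
    unfolding boundary_topology_def bd_ball_def ..
  ultimately show ?thesis by simp
qed

lemma topspace_boundary: "topspace (boundary_topology G S) = gromov_boundary G S"
proof
  show "topspace (boundary_topology G S) \<subseteq> gromov_boundary G S"
    using openin_topspace[of "boundary_topology G S"] unfolding boundary_openin by (rule conjunct1)
  have "openin (boundary_topology G S) (gromov_boundary G S)"
    unfolding boundary_openin by (simp add: bd_ball_def)
  then show "gromov_boundary G S \<subseteq> topspace (boundary_topology G S)" by (rule openin_subset)
qed

lemma space_borel_of: "space (borel_of T) = topspace T"
  and sets_borel_of: "sets (borel_of T) = sigma_sets (topspace T) {U. openin T U}"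
proof -
  have "{U. openin T U} \<subseteq> Pow (topspace T)" by (auto dest: openin_subset)
  then show "space (borel_of T) = topspace T" "sets (borel_of T) = sigma_sets (topspace T) {U. openin T U}"
    by (simp_all add: borel_of_def)
qed

lemma conv_infty_carrier: "conv_infty G S s \<Longrightarrow> s n \<in> carrier G"
  by (simp add: conv_infty_def)

lemma conv_infty_transfer:
  assumes "A > 0" "\<And>a b. \<lbrakk>a \<in> carrier G; b \<in> carrier G\<rbrakk> \<Longrightarrow>
      gromov_prod G S \<one>\<^bsub>G\<^esub> a b \<le> A * gromov_prod G S' \<one>\<^bsub>G\<^esub> a b + B"
    and s: "conv_infty G S s"
  shows "conv_infty G S' s"
  unfolding conv_infty_def
proof (intro conjI allI)
  show "s n \<in> carrier G" for n using conv_infty_carrier[OF s] .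
  fix R
  obtain N where N: "\<And>m n. \<lbrakk>m \<ge> N; n \<ge> N\<rbrakk> \<Longrightarrow> gromov_prod G S \<one>\<^bsub>G\<^esub> (s m) (s n) \<ge> A * R + B"
    using s unfolding conv_infty_def by metis
  have "R \<le> gromov_prod G S' \<one>\<^bsub>G\<^esub> (s m) (s n)" if "m \<ge> N" "n \<ge> N" for m n
  proof -
    have "A * R \<le> A * gromov_prod G S' \<one>\<^bsub>G\<^esub> (s m) (s n)"
      using N[OF that] assms(2)[of "s m" "s n"] conv_infty_carrier[OF s] by fastforce
    then show ?thesis using assms(1) by simp
  qed
  then show "\<exists>N. \<forall>m\<ge>N. \<forall>n\<ge>N. R \<le> gromov_prod G S' \<one>\<^bsub>G\<^esub> (s m) (s n)" by blast
qed

lemma seq_equiv_transfer: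
  assumes "A > 0" "\<And>a b. \<lbrakk>a \<in> carrier G; b \<in> carrier G\<rbrakk> \<Longrightarrow>
      gromov_prod G S \<one>\<^bsub>G\<^esub> a b \<le> A * gromov_prod G S' \<one>\<^bsub>G\<^esub> a b + B"
    and s: "\<And>n. s n \<in> carrier G" "\<And>n. t n \<in> carrier G" "seq_equiv G S s t"
  shows "seq_equiv G S' s t"
  unfolding seq_equiv_def
proof
  fix R
  obtain N where N: "\<And>m n. \<lbrakk>m \<ge> N; n \<ge> N\<rbrakk> \<Longrightarrow> gromov_prod G S \<one>\<^bsub>G\<^esub> (s m) (t n) \<ge> A * R + B"
    using s(3) unfolding seq_equiv_def by metis
  have "R \<le> gromov_prod G S' \<one>\<^bsub>G\<^esub> (s m) (t n)" if "m \<ge> N" "n \<ge> N" for m n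
  proof -
    have "A * R \<le> A * gromov_prod G S' \<one>\<^bsub>G\<^esub> (s m) (t n)"
      using N[OF that] assms(2)[of "s m" "t n"] s by fastforce
    then show ?thesis using assms(1) by simp
  qed
  then show "\<exists>N. \<forall>m\<ge>N. \<forall>n\<ge>N. R \<le> gromov_prod G S' \<one>\<^bsub>G\<^esub> (s m) (t n)" by blast
qed

lemma gromov_boundary_seq:
  assumes "\<xi> \<in> gromov_boundary G S" "s \<in> \<xi>"
  shows "conv_infty G S s"
  using assms by (auto simp: gromov_boundary_def)

lemma bd_gromov_prod_transfer:
  assumes "A > 0" "\<And>a b. \<lbrakk>a \<in> carrier G; b \<in> carrier G\<rbrakk> \<Longrightarrow>
      gromov_prod G S \<one>\<^bsub>G\<^esub> a b \<le> A * gromov_prod G S' \<one>\<^bsub>G\<^esub> a b + B"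
    and "\<xi> \<in> gromov_boundary G S" "\<eta> \<in> gromov_boundary G S"
    and "bd_gromov_prod G S \<xi> \<eta> > ereal (A * r + B)"
  shows "bd_gromov_prod G S' \<xi> \<eta> > ereal r"
proof -
  obtain s t N r' where *: "s \<in> \<xi>" "t \<in> \<eta>" "r' > A * r + B"
    "\<forall>m\<ge>N. \<forall>n\<ge>N. r' \<le> gromov_prod G S \<one>\<^bsub>G\<^esub> (s m) (t n)"
    using assms(5) unfolding less_bd_gromov_prod_iff by blast
  have c: "s n \<in> carrier G" "t n \<in> carrier G" for n
    using * assms(3,4) gromov_boundary_seq conv_infty_carrier by metis+
  have "(r' - B) / A \<le> gromov_prod G S' \<one>\<^bsub>G\<^esub> (s m) (t n)" if "m \<ge> N" "n \<ge> N" for m n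
    using *(4) that assms(1) assms(2)[OF c(1)[of m] c(2)[of n]]
    by (smt (verit, best) pos_divide_le_eq mult.commute)
  moreover have "(r' - B) / A > r" using * assms(1) by (simp add: field_simps)
  ultimately show ?thesis using * unfolding less_bd_gromov_prod_iff by blast
qed

text \<open>Boundary points are sets of sequences in the group, so the two boundaries can be
  literally equal. An affine comparison in both directions preserves divergence of Gromov products
  and nests the balls of either generating set in those of the other.\<close>

lemma boundary_independent:
  assumes A: "A > 0"
    "\<And>a b. \<lbrakk>a \<in> carrier G; b \<in> carrier G\<rbrakk> \<Longrightarrow>
      gromov_prod G S \<one>\<^bsub>G\<^esub> a b \<le> A * gromov_prod G S' \<one>\<^bsub>G\<^esub> a b + B"
    "\<And>a b. \<lbrakk>a \<in> carrier G; b \<in> carrier G\<rbrakk> \<Longrightarrow>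
      gromov_prod G S' \<one>\<^bsub>G\<^esub> a b \<le> A * gromov_prod G S \<one>\<^bsub>G\<^esub> a b + B"
  shows "gromov_boundary G S = gromov_boundary G S'"
    and "boundary_topology G S = boundary_topology G S'"
proof -
  have c: "conv_infty G S = conv_infty G S'"
    using conv_infty_transfer[OF A(1,2)] conv_infty_transfer[OF A(1,3)] by blast
  have e: "seq_equiv G S s t = seq_equiv G S' s t" if "conv_infty G S' s" "conv_infty G S' t" for s t
    using that seq_equiv_transfer[OF A(1,2), of s t] seq_equiv_transfer[OF A(1,3), of s t]
      conv_infty_carrier by metis
  show 1: "gromov_boundary G S = gromov_boundary G S'"
    unfolding gromov_boundary_def c using e by blast
  have *: "bd_ball G S' \<xi> (A * r + B) \<subseteq> bd_ball G S \<xi> r" "bd_ball G S \<xi> (A * r + B) \<subseteq> bd_ball G S' \<xi> r"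
    if "\<xi> \<in> gromov_boundary G S'" for \<xi> r
    using bd_gromov_prod_transfer[OF A(1,3) that, of _ r] bd_gromov_prod_transfer[OF A(1,2) that[folded 1], of _ r]
    unfolding bd_ball_def 1 by blast+
  show "boundary_topology G S = boundary_topology G S'"
    unfolding topology_eq boundary_openin 1
  proof (intro allI conj_cong refl ball_cong iffI; elim exE)
    fix U \<xi> r assume "U \<subseteq> gromov_boundary G S'" "\<xi> \<in> U"
    then have \<xi>: "\<xi> \<in> gromov_boundary G S'" by (rule subsetD)
    show "\<exists>r. bd_ball G S' \<xi> r \<subseteq> U" if "bd_ball G S \<xi> r \<subseteq> U"
      using order_trans[OF *(1)[OF \<xi>] that] by (rule exI)
    show "\<exists>r. bd_ball G S \<xi> r \<subseteq> U" if "bd_ball G S' \<xi> r \<subseteq> U"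
      using order_trans[OF *(2)[OF \<xi>] that] by (rule exI)
  qed
qed

section \<open>The boundary of a hyperbolic group as a Borel space with a group action\<close>

locale hyp_fg_group = fg_group +
  fixes \<delta> :: real
  assumes four_point: "\<forall>w\<in>carrier G. \<forall>x\<in>carrier G. \<forall>y\<in>carrier G. \<forall>z\<in>carrier G.
           gromov_prod G S w x z \<ge> min (gromov_prod G S w x y) (gromov_prod G S w y z) - \<delta>"
begin

sublocale W: gromov_hyperbolic "carrier G" d \<delta>
  by unfold_locales (use four_point in \<open>auto simp: gromov_prod_eq\<close>)

abbreviation gp where "gp \<equiv> gprod d \<one>"

lemma delta_nonneg: "0 \<le> \<delta>"
  using W.delta_nonneg one_closed .

lemma gprod_basepoint:
  assumes "w \<in> carrier G" "w' \<in> carrier G" "a \<in> carrier G" "b \<in> carrier G"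
  shows "gprod d w a b \<le> gprod d w' a b + d w' w"
  using W.dist_tri[of w w' a] W.dist_tri[of w w' b] W.dist_sym[of w w'] assms by (simp add: gprod_def field_simps)

text \<open>By left invariance, translating both points by \<open>x\<close> amounts to moving the
  base point to \<open>inv x\<close>, which lies at distance \<open>d \<one> x\<close> from the old
  one.\<close>

lemma gp_translate:
  assumes "x \<in> carrier G" "a \<in> carrier G" "b \<in> carrier G"
  shows "gp a b - d \<one> x \<le> gp (x \<otimes> a) (x \<otimes> b)"
proof -
  have "d \<one> (x \<otimes> c) = d (inv x) c" if "c \<in> carrier G" for c
    using dist_invariant[of x "inv x" c] assms that by simp
  then have "gp (x \<otimes> a) (x \<otimes> b) = gprod d (inv x) a b"
    using assms dist_invariant by (simp add: gprod_def)
  moreover have "d (inv x) \<one> = d \<one> x" using assms dist_invariant[of x "inv x" \<one>] by simp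
  ultimately show ?thesis using gprod_basepoint[of \<one> "inv x" a b] assms by simp
qed

lemma seq_equiv_sym:
  assumes "conv_infty G S s" "conv_infty G S t" "seq_equiv G S s t"
  shows "seq_equiv G S t s"
  unfolding seq_equiv_def
proof
  fix R
  obtain N where "\<And>m n. \<lbrakk>m \<ge> N; n \<ge> N\<rbrakk> \<Longrightarrow> gromov_prod G S \<one> (s m) (t n) \<ge> R"
    using assms(3) unfolding seq_equiv_def by metis
  then show "\<exists>N. \<forall>m\<ge>N. \<forall>n\<ge>N. R \<le> gromov_prod G S \<one> (t m) (s n)"
    using W.gprod_sym assms(1,2)[THEN conv_infty_carrier] by (intro exI[of _ N]) (simp add: gromov_prod_eq)
qed

lemma seq_equiv_trans:
  assumes "conv_infty G S r" "conv_infty G S s" "conv_infty G S t"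
    "seq_equiv G S r s" "seq_equiv G S s t"
  shows "seq_equiv G S r t"
  unfolding seq_equiv_def
proof
  fix R
  obtain N where N: "\<And>m n. \<lbrakk>m \<ge> N; n \<ge> N\<rbrakk> \<Longrightarrow> gromov_prod G S \<one> (r m) (s n) \<ge> R + \<delta>"
    using assms(4) unfolding seq_equiv_def by metis
  obtain N' where N': "\<And>m n. \<lbrakk>m \<ge> N'; n \<ge> N'\<rbrakk> \<Longrightarrow> gromov_prod G S \<one> (s m) (t n) \<ge> R + \<delta>"
    using assms(5) unfolding seq_equiv_def by metis
  have "R \<le> gromov_prod G S \<one> (r m) (t n)" if "m \<ge> max N N'" "n \<ge> max N N'" for m n
    using N[of m "max N N'"] N'[of "max N N'" n] that
      four_point[rule_format, of \<one> "r m" "s (max N N')" "t n"]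
      assms(1-3)[THEN conv_infty_carrier] by auto
  then show "\<exists>N. \<forall>m\<ge>N. \<forall>n\<ge>N. R \<le> gromov_prod G S \<one> (r m) (t n)" by blast
qed

definition bd_class where "bd_class s = {t. conv_infty G S t \<and> seq_equiv G S s t}"

lemma bd_class_self: "conv_infty G S s \<Longrightarrow> s \<in> bd_class s"
  by (auto simp: bd_class_def conv_infty_def seq_equiv_def)

lemma bd_class_boundary: "conv_infty G S s \<Longrightarrow> bd_class s \<in> gromov_boundary G S"
  by (auto simp: bd_class_def gromov_boundary_def)

lemma bd_class_eq:
  assumes "conv_infty G S s" "conv_infty G S t" "seq_equiv G S s t"
  shows "bd_class s = bd_class t"
proof -
  have "seq_equiv G S s u \<longleftrightarrow> seq_equiv G S t u" if "conv_infty G S u" for u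
    using seq_equiv_trans[OF assms(1,2) that assms(3)] seq_equiv_trans[OF assms(2,1) that]
      seq_equiv_trans[OF assms(1,2) that] seq_equiv_sym[OF assms] assms(3) by blast
  then show ?thesis unfolding bd_class_def by blast
qed

lemma conv_infty_translate:
  assumes "x \<in> carrier G" "conv_infty G S s"
  shows "conv_infty G S (\<lambda>n. x \<otimes> s n)"
  unfolding conv_infty_def
proof (intro conjI allI)
  have c: "s n \<in> carrier G" for n using assms conv_infty_carrier by auto
  show "x \<otimes> s n \<in> carrier G" for n using c assms by auto
  fix R
  obtain N where N: "\<And>m n. \<lbrakk>m \<ge> N; n \<ge> N\<rbrakk> \<Longrightarrow> gp (s m) (s n) \<ge> R + d \<one> x"
    using assms(2) unfolding conv_infty_def gromov_prod_eq by metis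
  have "R \<le> gp (x \<otimes> s m) (x \<otimes> s n)" if "m \<ge> N" "n \<ge> N" for m n
    using N[OF that] gp_translate[OF assms(1) c c, of m n] by linarith
  then show "\<exists>N. \<forall>m\<ge>N. \<forall>n\<ge>N. R \<le> gromov_prod G S \<one> (x \<otimes> s m) (x \<otimes> s n)"
    unfolding gromov_prod_eq by blast
qed

lemma seq_equiv_translate:
  assumes x: "x \<in> carrier G" and st: "conv_infty G S s" "conv_infty G S t" "seq_equiv G S s t"
  shows "seq_equiv G S (\<lambda>n. x \<otimes> s n) (\<lambda>n. x \<otimes> t n)"
  unfolding seq_equiv_def
proof
  fix R
  obtain N where N: "\<And>m n. \<lbrakk>m \<ge> N; n \<ge> N\<rbrakk> \<Longrightarrow> gp (s m) (t n) \<ge> R + d \<one> x"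
    using st(3) unfolding seq_equiv_def gromov_prod_eq by metis
  have "R \<le> gp (x \<otimes> s m) (x \<otimes> t n)" if "m \<ge> N" "n \<ge> N" for m n
    using N[OF that] gp_translate[OF x st(1,2)[THEN conv_infty_carrier], of m n] by linarith
  then show "\<exists>N. \<forall>m\<ge>N. \<forall>n\<ge>N. R \<le> gromov_prod G S \<one> (x \<otimes> s m) (x \<otimes> t n)"
    unfolding gromov_prod_eq by blast
qed

text \<open>\<open>bd_act\<close> is an image of a set of sequences; that this image is a whole
  class, and not only part of one, follows by translating back with \<open>inv x\<close>.\<close>

lemma bd_act_class:
  assumes x: "x \<in> carrier G" and s: "conv_infty G S s"
  shows "bd_act G x (bd_class s) = bd_class (\<lambda>n. x \<otimes> s n)"
proof
  show "bd_act G x (bd_class s) \<subseteq> bd_class (\<lambda>n. x \<otimes> s n)"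
    using conv_infty_translate[OF x] seq_equiv_translate[OF x s]
    by (auto simp: bd_act_def bd_class_def)
  show "bd_class (\<lambda>n. x \<otimes> s n) \<subseteq> bd_act G x (bd_class s)"
  proof
    fix t assume t: "t \<in> bd_class (\<lambda>n. x \<otimes> s n)"
    then have t': "conv_infty G S t" "seq_equiv G S (\<lambda>n. x \<otimes> s n) t" by (simp_all add: bd_class_def)
    have "conv_infty G S (\<lambda>n. inv x \<otimes> t n)" using conv_infty_translate[OF _ t'(1)] x by simp
    moreover have "seq_equiv G S s (\<lambda>n. inv x \<otimes> t n)"
      using seq_equiv_translate[OF _ conv_infty_translate[OF x s] t', of "inv x"] x s[THEN conv_infty_carrier] by simp
    ultimately have "(\<lambda>n. inv x \<otimes> t n) \<in> bd_class s" by (simp add: bd_class_def)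
    moreover have "t = (\<lambda>n. x \<otimes> (inv x \<otimes> t n))" using x t'(1)[THEN conv_infty_carrier] by simp
    ultimately show "t \<in> bd_act G x (bd_class s)"
      unfolding bd_act_def by (rule image_eqI[of t "\<lambda>s n. x \<otimes> s n" "\<lambda>n. inv x \<otimes> t n", rotated])
  qed
qed

lemma boundary_cases:
  assumes "\<xi> \<in> gromov_boundary G S"
  obtains s where "conv_infty G S s" "\<xi> = bd_class s"
  using assms by (auto simp: gromov_boundary_def bd_class_def)

lemma bd_act_boundary:
  assumes "x \<in> carrier G" "\<xi> \<in> gromov_boundary G S"
  shows "bd_act G x \<xi> \<in> gromov_boundary G S"
  using assms(2)
  by (rule boundary_cases) (use assms(1) bd_act_class conv_infty_translate bd_class_boundary in simp)

lemma bd_act_mult: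
  assumes "x \<in> carrier G" "y \<in> carrier G" "\<xi> \<in> gromov_boundary G S"
  shows "bd_act G x (bd_act G y \<xi>) = bd_act G (x \<otimes> y) \<xi>"
  using assms gromov_boundary_seq[OF assms(3), THEN conv_infty_carrier]
  by (auto simp: bd_act_def image_image m_assoc intro!: image_cong)

lemma bd_act_ball:
  assumes "x \<in> carrier G" "\<xi> \<in> gromov_boundary G S" "\<eta> \<in> bd_ball G S \<xi> (r + d \<one> x)"
  shows "bd_act G x \<eta> \<in> bd_ball G S (bd_act G x \<xi>) r"
proof -
  have \<eta>: "\<eta> \<in> gromov_boundary G S" "ereal (r + d \<one> x) < bd_gromov_prod G S \<xi> \<eta>"
    using assms(3) by (auto simp: bd_ball_def)
  then obtain s t N r' where *: "s \<in> \<xi>" "t \<in> \<eta>" "r' > r + d \<one> x"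
    "\<forall>m\<ge>N. \<forall>n\<ge>N. r' \<le> gp (s m) (t n)"
    unfolding less_bd_gromov_prod_iff gromov_prod_eq by blast
  have c: "s n \<in> carrier G" "t n \<in> carrier G" for n
    using * assms(2) \<eta>(1) gromov_boundary_seq conv_infty_carrier by metis+
  have "r' - d \<one> x \<le> gp (x \<otimes> s m) (x \<otimes> t n)" if "m \<ge> N" "n \<ge> N" for m n
    using *(4)[rule_format, OF that] gp_translate[OF assms(1) c, of m n] by linarith
  moreover have "(\<lambda>n. x \<otimes> s n) \<in> bd_act G x \<xi>" "(\<lambda>n. x \<otimes> t n) \<in> bd_act G x \<eta>"
    using * by (auto simp: bd_act_def)
  moreover have "r < r' - d \<one> x" using * by simp
  ultimately have "ereal r < bd_gromov_prod G S (bd_act G x \<xi>) (bd_act G x \<eta>)"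
    unfolding less_bd_gromov_prod_iff gromov_prod_eq
    by (intro bexI[of _ "\<lambda>n. x \<otimes> s n"] bexI[of _ "\<lambda>n. x \<otimes> t n"] exI[of _ N] exI[of _ "r' - d \<one> x"])
      simp_all
  then show ?thesis using bd_act_boundary[OF assms(1) \<eta>(1)] by (simp add: bd_ball_def)
qed

lemma bd_act_preimage_open:
  assumes x: "x \<in> carrier G" and U: "openin (boundary_topology G S) U"
  shows "openin (boundary_topology G S) (bd_act G x -` U \<inter> gromov_boundary G S)"
  unfolding boundary_openin
proof (intro conjI ballI)
  fix \<xi> assume \<xi>: "\<xi> \<in> bd_act G x -` U \<inter> gromov_boundary G S"
  then obtain r where "bd_ball G S (bd_act G x \<xi>) r \<subseteq> U"
    using U unfolding boundary_openin by blast
  then have "bd_ball G S \<xi> (r + d \<one> x) \<subseteq> bd_act G x -` U \<inter> gromov_boundary G S"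
    using bd_act_ball[OF x, of \<xi> _ r] \<xi> by (auto simp: bd_ball_def)
  then show "\<exists>r. bd_ball G S \<xi> r \<subseteq> bd_act G x -` U \<inter> gromov_boundary G S" ..
qed simp

lemma bd_act_measurable:
  assumes x: "x \<in> carrier G"
  shows "bd_act G x \<in> borel_of (boundary_topology G S) \<rightarrow>\<^sub>M borel_of (boundary_topology G S)"
  unfolding borel_of_def topspace_boundary
proof (rule measurable_measure_of)
  show "{U. openin (boundary_topology G S) U} \<subseteq> Pow (gromov_boundary G S)"
    by (auto simp: boundary_openin)
  then have sp: "space (sigma (gromov_boundary G S) {U. openin (boundary_topology G S) U}) = gromov_boundary G S"
    and st: "sets (sigma (gromov_boundary G S) {U. openin (boundary_topology G S) U}) =
      sigma_sets (gromov_boundary G S) {U. openin (boundary_topology G S) U}"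
    by simp_all
  show "bd_act G x \<in> space (sigma (gromov_boundary G S) {U. openin (boundary_topology G S) U}) \<rightarrow> gromov_boundary G S"
    using bd_act_boundary[OF x] by (auto simp: sp)
  fix U assume "U \<in> {U. openin (boundary_topology G S) U}"
  then show "bd_act G x -` U \<inter> space (sigma (gromov_boundary G S) {U. openin (boundary_topology G S) U})
      \<in> sets (sigma (gromov_boundary G S) {U. openin (boundary_topology G S) U})"
    unfolding sp st using bd_act_preimage_open[OF x] by (intro sigma_sets.Basic) simp
qed

end

section \<open>Descending fields on the Cayley graph\<close>

lemma open_bool: "open (A :: bool set)"
  using finite_imp_closed[of "- A"] by (simp add: closed_def)

text \<open>The values are discrete, so a condition on finitely many coordinates is a union of basic
  open sets, one for each configuration that satisfies it. The complement is of the same kind, which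
  gives \<open>closed_cylinder\<close>.\<close>

lemma open_cylinder:
  fixes P :: "('i \<Rightarrow> bool) \<Rightarrow> bool"
  assumes "finite F" "\<And>a b. \<lbrakk>\<And>i. i \<in> F \<Longrightarrow> a i = b i; P a\<rbrakk> \<Longrightarrow> P b"
  shows "open {a. P a}"
proof -
  have "{a. P a} = (\<Union>a0\<in>{a. P a}. {a. \<forall>i\<in>F. a i \<in> {a0 i}})"
  proof
    show "(\<Union>a0\<in>{a. P a}. {a. \<forall>i\<in>F. a i \<in> {a0 i}}) \<subseteq> {a. P a}"
      by (clarsimp simp: subset_iff) (metis assms(2))
  qed auto
  moreover have "open {a. \<forall>i\<in>F. a i \<in> {a0 i}}" for a0 :: "'i \<Rightarrow> bool"
    using product_topology_basis'[OF assms(1), of "\<lambda>i. {a0 i}" "\<lambda>i. i"] open_bool by blast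
  ultimately show ?thesis by (metis (no_types, lifting) open_UN)
qed

lemma closed_cylinder:
  fixes P :: "('i \<Rightarrow> bool) \<Rightarrow> bool"
  assumes "finite F" "\<And>a b. \<lbrakk>\<And>i. i \<in> F \<Longrightarrow> a i = b i; P a\<rbrakk> \<Longrightarrow> P b"
  shows "closed {a. P a}"
  unfolding closed_def Collect_neg_eq[symmetric]
  by (rule open_cylinder[OF assms(1)]) (metis assms(2))

lemma compact_UNIV_fun:
  assumes "compact (UNIV :: 'b::topological_space set)"
  shows "compact (UNIV :: ('a \<Rightarrow> 'b) set)"
proof -
  have "compact_space (euclidean :: ('a \<Rightarrow> 'b) topology)"
    unfolding euclidean_product_topology[symmetric] compact_space_product_topology
    using assms by (simp add: compact_space_def)
  then show ?thesis
    by (simp add: compact_space_def)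
qed

context fg_group
begin

definition agrees :: "('a \<times> 'a \<Rightarrow> bool) \<Rightarrow> 'a \<Rightarrow> 'a set \<Rightarrow> bool" where
  "agrees a z F \<longleftrightarrow> (\<forall>g\<in>F. \<forall>s\<in>T. a (g, s) \<longleftrightarrow> d (g \<otimes> s) z < d g z)"

text \<open>A descending field assigns to each vertex of the Cayley graph the edges pointing towards a
  boundary point; it is locally the field of edges pointing towards some distant vertex \<open>z\<close>.\<close>

definition fields :: "('a \<times> 'a \<Rightarrow> bool) set" where
  "fields = {a. \<forall>F. finite F \<and> F \<subseteq> carrier G \<longrightarrow> (\<exists>z\<in>carrier G - F. agrees a z F)}"

text \<open>Coordinates outside the group are left unchanged, so that the action laws hold for every
  Boolean function \<open>a\<close> and not only on the group part.\<close>

definition field_act :: "'a \<Rightarrow> ('a \<times> 'a \<Rightarrow> bool) \<Rightarrow> 'a \<times> 'a \<Rightarrow> bool" where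
  "field_act x a = (\<lambda>(g, s). if g \<in> carrier G then a (inv x \<otimes> g, s) else a (g, s))"

text \<open>The choice at a vertex depends only on the set of generators that \<open>a\<close> marks
  there, not on the vertex or on the rest of the field. Hence the same canonical choice commutes
  with translations (\<open>walk_translate\<close>) and is local
  (\<open>walk_local\<close>).\<close>

primrec walk :: "('a \<times> 'a \<Rightarrow> bool) \<Rightarrow> 'a \<Rightarrow> nat \<Rightarrow> 'a" where
  "walk a g 0 = g"
| "walk a g (Suc k) = walk a g k \<otimes> (SOME s. s \<in> T \<and> a (walk a g k, s))"

lemma field_act_mult:
  "\<lbrakk>x \<in> carrier G; y \<in> carrier G\<rbrakk> \<Longrightarrow> field_act x (field_act y a) = field_act (x \<otimes> y) a"
  by (auto simp: field_act_def inv_mult_group m_assoc)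

lemma field_act_one: "field_act \<one> a = a"
  by (auto simp: field_act_def)

lemma field_nonempty:
  assumes "a \<in> fields" "g \<in> carrier G"
  shows "\<exists>s\<in>T. a (g, s)"
proof -
  \<comment> \<open>That \<open>z\<close> must avoid the finite set is what excludes
    \<open>z = g\<close>, where no generator descends.\<close>
  obtain z where "z \<in> carrier G - {g}" "agrees a z {g}"
    using assms unfolding fields_def by blast
  then show ?thesis using descending_generator[of g z] assms(2) by (auto simp: agrees_def)
qed

lemma walk_step:
  assumes "a \<in> fields" "walk a g k \<in> carrier G"
  obtains s where "s \<in> T" "a (walk a g k, s)" "walk a g (Suc k) = walk a g k \<otimes> s"
proof -
  have "\<exists>s. s \<in> T \<and> a (walk a g k, s)" using field_nonempty[OF assms] by blast
  from someI_ex[OF this] show thesis by (intro that[of "SOME s. s \<in> T \<and> a (walk a g k, s)"]) auto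
qed

lemma walk_closed:
  assumes "a \<in> fields" "g \<in> carrier G"
  shows "walk a g k \<in> carrier G"
proof (induction k)
  case (Suc k)
  obtain s where "s \<in> T" "walk a g (Suc k) = walk a g k \<otimes> s"
    using walk_step[OF assms(1) Suc] .
  then show ?case using Suc T_carrier by auto
qed (use assms in simp)

text \<open>Only the vertices visited before step \<open>n\<close> need to see the field of
  \<open>z\<close>; there each marked generator brings the walk closer by exactly one, by
  \<open>descending_drop\<close>.\<close>

lemma walk_towards:
  assumes a: "a \<in> fields" and g: "g \<in> carrier G" and z: "z \<in> carrier G"
    and agr: "agrees a z (walk a g ` {..<n})" and k: "k \<le> n"
  shows "d (walk a g k) z = d g z - real k"
  using k
proof (induction k)
  case (Suc k)
  obtain s where s: "s \<in> T" "a (walk a g k, s)" "walk a g (Suc k) = walk a g k \<otimes> s"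
    using walk_step[OF a walk_closed[OF a g]] .
  then have "d (walk a g k \<otimes> s) z < d (walk a g k) z"
    using agr Suc.prems by (auto simp: agrees_def)
  then show ?case
    using descending_drop[OF walk_closed[OF a g] s(1) z, of k] Suc.IH Suc.prems s(3) by simp
qed simp

lemma field_act_fields:
  assumes x: "x \<in> carrier G" and a: "a \<in> fields"
  shows "field_act x a \<in> fields"
  unfolding fields_def
proof (intro CollectI allI impI; elim conjE)
  fix F assume F: "finite F" "F \<subseteq> carrier G"
  define F' where "F' = (\<lambda>g. inv x \<otimes> g) ` F"
  have "finite F'" "F' \<subseteq> carrier G" using F x by (auto simp: F'_def)
  then obtain z where z: "z \<in> carrier G" "z \<notin> F'" "agrees a z F'"
    using a unfolding fields_def by blast
  have "x \<otimes> z \<notin> F"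
  proof
    assume "x \<otimes> z \<in> F"
    then have "inv x \<otimes> (x \<otimes> z) \<in> F'" unfolding F'_def by (rule imageI)
    then show False using x z by simp
  qed
  moreover have "field_act x a (g, s) \<longleftrightarrow> d (g \<otimes> s) (x \<otimes> z) < d g (x \<otimes> z)" if "g \<in> F" "s \<in> T" for g s
  proof -
    have gs: "g \<in> carrier G" "s \<in> carrier G" using that F T_carrier by auto
    have "inv x \<otimes> g \<in> F'" using that by (simp add: F'_def)
    then have "a (inv x \<otimes> g, s) \<longleftrightarrow> d ((inv x \<otimes> g) \<otimes> s) z < d (inv x \<otimes> g) z"
      using z(3) that by (simp add: agrees_def)
    also have "d ((inv x \<otimes> g) \<otimes> s) z = d (g \<otimes> s) (x \<otimes> z)"
      using dist_invariant[of x "inv x \<otimes> g \<otimes> s" z] x z gs by (simp add: m_assoc)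
    also have "d (inv x \<otimes> g) z = d g (x \<otimes> z)"
      using dist_invariant[of x "inv x \<otimes> g" z] x z gs by simp
    finally show ?thesis using gs by (simp add: field_act_def)
  qed
  ultimately show "\<exists>z\<in>carrier G - F. agrees (field_act x a) z F"
    using x z by (intro bexI[of _ "x \<otimes> z"]) (simp_all add: agrees_def)
qed

lemma walk_translate:
  assumes x: "x \<in> carrier G" and a: "a \<in> fields" and g: "g \<in> carrier G"
  shows "walk (field_act x a) (x \<otimes> g) k = x \<otimes> walk a g k"
proof (induction k)
  case (Suc k)
  have w: "walk a g k \<in> carrier G" using walk_closed[OF a g] .
  have "(SOME s. s \<in> T \<and> a (walk a g k, s)) \<in> T"
    using someI_ex[of "\<lambda>s. s \<in> T \<and> a (walk a g k, s)"] field_nonempty[OF a w] by blast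
  moreover have "field_act x a (x \<otimes> walk a g k, s) = a (walk a g k, s)" for s
    using x w by (simp add: field_act_def)
  ultimately show ?case using Suc x w T_carrier by (simp add: m_assoc subset_iff)
qed simp

text \<open>The walk inspects the field only at the vertices it has visited. Each vertex of the walk
  is thus a locally constant function of the field, which makes \<open>clopen_walk\<close>
  hold.\<close>

lemma walk_local: "\<exists>F. finite F \<and> (\<forall>b. (\<forall>i\<in>F. a i = b i) \<longrightarrow> walk b g k = walk a g k)"
proof (intro exI conjI allI impI)
  define F where "F = (\<lambda>j. walk a g j) ` {..<k} \<times> T"
  show "finite F" using T_finite by (simp add: F_def)
  fix b assume b: "\<forall>i\<in>F. a i = b i"
  have "walk b g j = walk a g j" if "j \<le> k" for j
    using that
  proof (induction j)
    case (Suc j)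
    have "(walk a g j, s) \<in> F" if "s \<in> T" for s using that Suc.prems by (auto simp: F_def)
    then have "(\<lambda>s. s \<in> T \<and> b (walk a g j, s)) = (\<lambda>s. s \<in> T \<and> a (walk a g j, s))" using b by auto
    then show ?case using Suc by simp
  qed simp
  then show "walk b g k = walk a g k" by simp
qed

text \<open>Compactness: the field pointing towards one vertex \<open>z\<close> outside the union of
  finitely many finite sets satisfies all the corresponding conditions at once, and such a
  \<open>z\<close> exists because the group is infinite.\<close>

lemma fields_exist:
  assumes inf: "infinite (carrier G)"
  shows "fields \<noteq> {}"
proof -
  define I where "I = {F. finite F \<and> F \<subseteq> carrier G}"
  have "UNIV \<inter> (\<Inter>F\<in>I. {a. \<exists>z\<in>carrier G - F. agrees a z F}) \<noteq> {}"
  proof (rule compact_imp_fip_image)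
    show "compact (UNIV :: ('a \<times> 'a \<Rightarrow> bool) set)"
      by (rule compact_UNIV_fun) (simp add: finite_imp_compact)
    show "closed {a. \<exists>z\<in>carrier G - F. agrees a z F}" if "F \<in> I" for F
    proof (rule closed_cylinder)
      show "finite (F \<times> T)" using that T_finite by (auto simp: I_def)
      fix a b assume eq: "\<And>i. i \<in> F \<times> T \<Longrightarrow> a i = b i" and "\<exists>z\<in>carrier G - F. agrees a z F"
      then obtain z where "z \<in> carrier G - F" "agrees a z F" by blast
      moreover from this(2) have "agrees b z F" using eq by (simp add: agrees_def)
      ultimately show "\<exists>z\<in>carrier G - F. agrees b z F" by blast
    qed
    fix I' assume I': "finite I'" "I' \<subseteq> I"
    have "finite (\<Union>I')" using I' by (auto simp: I_def)
    then obtain z where z: "z \<in> carrier G" "z \<notin> \<Union>I'"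
      using inf by (meson finite_subset subsetI)
    define a where "a = (\<lambda>(g, s). d (g \<otimes> s) z < d g z)"
    have "agrees a z F" for F by (simp add: agrees_def a_def)
    then have "a \<in> (\<Inter>F\<in>I'. {a. \<exists>z\<in>carrier G - F. agrees a z F})" using z by blast
    then show "UNIV \<inter> (\<Inter>F\<in>I'. {a. \<exists>z\<in>carrier G - F. agrees a z F}) \<noteq> {}" by blast
  qed
  then obtain a where "\<And>F. F \<in> I \<Longrightarrow> \<exists>z\<in>carrier G - F. agrees a z F" by blast
  then have "a \<in> fields" by (simp add: fields_def I_def)
  then show ?thesis by blast
qed

end

section \<open>Walks along a field converge; the endpoint map to the boundary\<close>

context hyp_fg_group
begin

text \<open>One vertex \<open>z\<close> can be chosen for the initial segments of both walks. Both
  then head for \<open>z\<close> along geodesics, so each has a large product with \<open>z\<close>,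
  and hyperbolicity compares them with each other.\<close>

lemma walk_gprod:
  assumes a: "a \<in> fields" and g: "g0 \<in> carrier G" "g1 \<in> carrier G"
  shows "min (real m - d \<one> g0) (real n - d \<one> g1) - \<delta> \<le> gp (walk a g0 m) (walk a g1 n)"
proof -
  define F where "F = walk a g0 ` {..<m} \<union> walk a g1 ` {..<n}"
  have "finite F" "F \<subseteq> carrier G" using walk_closed[OF a] g by (auto simp: F_def)
  then obtain z where z: "z \<in> carrier G" "agrees a z F"
    using a unfolding fields_def by blast
  \<comment> \<open>Seen from the start \<open>h\<close>, the product is at least
    \<open>real k\<close>, since the walk has used up \<open>k\<close> of the distance to
    \<open>z\<close>; moving the base point to \<open>\<one>\<close> costs
    \<open>d \<one> h\<close>.\<close>
  have *: "real k - d \<one> h \<le> gp (walk a h k) z"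
    if h: "h \<in> carrier G" "walk a h ` {..<k} \<subseteq> F" for h k
  proof -
    have "agrees a z (walk a h ` {..<k})" using z(2) h(2) by (auto simp: agrees_def)
    then have e: "d (walk a h k) z = d h z - real k" using walk_towards[OF a h(1) z(1)] by blast
    have w: "walk a h k \<in> carrier G" using walk_closed[OF a h(1)] .
    have "real k \<le> gprod d h (walk a h k) z"
      using e W.dist_tri[OF h(1) w z(1)] by (simp add: gprod_def)
    then show ?thesis using gprod_basepoint[OF h(1) one_closed w z(1)] by linarith
  qed
  have "real m - d \<one> g0 \<le> gp (walk a g0 m) z" "real n - d \<one> g1 \<le> gp (walk a g1 n) z"
    using * g by (auto simp: F_def)
  moreover have "gp (walk a g1 n) z = gp z (walk a g1 n)"
    using W.gprod_sym walk_closed[OF a g(2)] z by blast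
  ultimately show ?thesis
    using W.hyp[OF one_closed walk_closed[OF a g(1)] z(1) walk_closed[OF a g(2)], of m n] by auto
qed

text \<open>With equal starting points this gives convergence to infinity, with different ones the
  independence of the endpoint from the start.\<close>

lemma walk_gprod_large:
  assumes a: "a \<in> fields" and g: "g0 \<in> carrier G" "g1 \<in> carrier G"
  shows "\<exists>N. \<forall>m\<ge>N. \<forall>n\<ge>N. R \<le> gromov_prod G S \<one> (walk a g0 m) (walk a g1 n)"
proof -
  define N where "N = nat \<lceil>R + \<delta> + d \<one> g0 + d \<one> g1\<rceil>"
  have "R \<le> gp (walk a g0 m) (walk a g1 n)" if "m \<ge> N" "n \<ge> N" for m n
  proof -
    have "R + \<delta> + d \<one> g0 + d \<one> g1 \<le> real N" unfolding N_def by linarith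
    moreover have "real N \<le> real m" "real N \<le> real n" using that by auto
    moreover have "0 \<le> d \<one> g0" "0 \<le> d \<one> g1" using W.dist_nonneg g by auto
    ultimately have "R \<le> min (real m - d \<one> g0) (real n - d \<one> g1) - \<delta>" by auto
    then show ?thesis using walk_gprod[OF assms, of m n] by linarith
  qed
  then show ?thesis unfolding gromov_prod_eq by blast
qed

lemma walk_conv:
  assumes "a \<in> fields" "g \<in> carrier G"
  shows "conv_infty G S (walk a g)"
  using walk_gprod_large[OF assms assms(2)] walk_closed[OF assms] by (simp add: conv_infty_def)

lemma walk_equiv:
  assumes "a \<in> fields" "g \<in> carrier G" "g' \<in> carrier G"
  shows "seq_equiv G S (walk a g) (walk a g')"
  using walk_gprod_large[OF assms] by (simp add: seq_equiv_def)

definition endpoint where "endpoint a = bd_class (walk a \<one>)"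

lemma endpoint_boundary: "a \<in> fields \<Longrightarrow> endpoint a \<in> gromov_boundary G S"
  unfolding endpoint_def using walk_conv bd_class_boundary by blast

text \<open>A translation also moves the starting point from \<open>\<one>\<close> to
  \<open>x\<close>; equivariance therefore rests on the independence of the start.\<close>

lemma endpoint_act:
  assumes x: "x \<in> carrier G" and a: "a \<in> fields"
  shows "endpoint (field_act x a) = bd_act G x (endpoint a)"
proof -
  have xa: "field_act x a \<in> fields" using field_act_fields[OF x a] .
  have "(\<lambda>n. x \<otimes> walk a \<one> n) = walk (field_act x a) x"
    using walk_translate[OF x a one_closed] x by (simp add: fun_eq_iff)
  moreover have "bd_class (walk (field_act x a) \<one>) = bd_class (walk (field_act x a) x)"
    using walk_conv[OF xa] walk_equiv[OF xa] x by (intro bd_class_eq) auto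
  ultimately show ?thesis
    unfolding endpoint_def using bd_act_class[OF x walk_conv[OF a one_closed]] by simp
qed

text \<open>Only the \<open>k\<close>-th vertices must coincide. Every later vertex of either walk
  has product at least \<open>real k - \<delta>\<close> with this common vertex, and comparing
  through it costs another \<open>\<delta>\<close>; the final 1 makes the inequality strict.\<close>

lemma endpoint_near:
  assumes a: "a \<in> fields" "b \<in> fields" and eq: "walk a \<one> k = walk b \<one> k"
  shows "endpoint b \<in> bd_ball G S (endpoint a) (real k - 2 * \<delta> - 1)"
proof -
  define w where "w = walk a \<one> k"
  have w: "w \<in> carrier G" using walk_closed[OF a(1) one_closed] by (simp add: w_def)
  have "real k - 2 * \<delta> \<le> gp (walk a \<one> m) (walk b \<one> n)" if "m \<ge> k" "n \<ge> k" for m n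
  proof -
    have "d \<one> \<one> = 0" using W.dist_self by simp
    then have "real k - \<delta> \<le> gp (walk a \<one> m) w" "real k - \<delta> \<le> gp w (walk b \<one> n)"
      using walk_gprod[OF a(1) one_closed one_closed, of m k]
        walk_gprod[OF a(2) one_closed one_closed, of k n] that eq by (auto simp: w_def)
    then show ?thesis
      using W.hyp[OF one_closed walk_closed[OF a(1) one_closed] w walk_closed[OF a(2) one_closed], of m n]
      by linarith
  qed
  then have "ereal (real k - 2 * \<delta> - 1) < bd_gromov_prod G S (endpoint a) (endpoint b)"
    unfolding less_bd_gromov_prod_iff gromov_prod_eq
    using bd_class_self[OF walk_conv[OF a(1) one_closed]] bd_class_self[OF walk_conv[OF a(2) one_closed]]
    by (intro bexI[of _ "walk a \<one>"] bexI[of _ "walk b \<one>"] exI[of _ k] exI[of _ "real k - 2 * \<delta>"])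
      (simp_all add: endpoint_def)
  then show ?thesis using endpoint_boundary[OF a(2)] by (simp add: bd_ball_def)
qed

end

section \<open>Contents on clopen sets\<close>

abbreviation clopens :: "'x::topological_space set set" where
  "clopens \<equiv> {A. open A \<and> closed A}"

text \<open>By compactness a decreasing sequence of clopen sets with empty intersection is
  eventually empty, so continuity at the empty set is automatic. The sigma-algebra is generated by
  the clopen sets, since in a product over an arbitrary index type an open set may be an uncountable
  union of them.\<close>

lemma clopen_content_extends:
  fixes c :: "'x::topological_space set \<Rightarrow> real"
  assumes compact: "compact (UNIV :: 'x set)"
    and nonneg: "\<And>A. 0 \<le> c A"
    and add: "\<And>A B. A \<inter> B = {} \<Longrightarrow> c (A \<union> B) = c A + c B"
  obtains M :: "'x measure" where "space M = UNIV" "sets M = sigma_sets UNIV clopens"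
    "\<And>A. A \<in> clopens \<Longrightarrow> emeasure M A = ennreal (c A)"
proof -
  have empty: "c {} = 0" using add[of "{}" "{}"] by simp
  interpret ring_of_sets UNIV "clopens :: 'x set set"
    by (auto simp: ring_of_sets_iff)
  have "\<exists>\<mu> :: 'x set \<Rightarrow> ennreal. (\<forall>A\<in>clopens. \<mu> A = ennreal (c A)) \<and>
      measure_space UNIV (sigma_sets UNIV clopens) \<mu>"
  proof (rule caratheodory_empty_continuous)
    show "positive clopens (\<lambda>A. ennreal (c A))" by (simp add: positive_def empty)
    show "additive clopens (\<lambda>A. ennreal (c A))"
      by (simp add: additive_def add nonneg ennreal_plus)
    fix A :: "nat \<Rightarrow> 'x set"
    assume A: "range A \<subseteq> clopens" "decseq A" "(\<Inter>i. A i) = {}"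
    have "\<not> (UNIV \<inter> (\<Inter>i\<in>UNIV. A i) \<noteq> {})" using A(3) by simp
    then have "\<exists>I'. finite I' \<and> \<not> (UNIV \<inter> (\<Inter>i\<in>I'. A i) \<noteq> {})"
      using compact_imp_fip_image[OF compact, of UNIV A] A(1) by blast
    then obtain I' where I': "finite I'" "(\<Inter>i\<in>I'. A i) = {}" by auto
    have "A n = {}" if "n \<ge> Max (insert 0 I')" for n
    proof -
      have "A n \<subseteq> A i" if "i \<in> I'" for i
        using A(2) I'(1) that \<open>n \<ge> Max (insert 0 I')\<close> by (auto simp: decseq_def Max_ge_iff)
      then show ?thesis using I'(2) by blast
    qed
    then have "eventually (\<lambda>n. ennreal (c (A n)) = 0) sequentially"
      using empty unfolding eventually_sequentially by (intro exI[of _ "Max (insert 0 I')"]) simp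
    then show "(\<lambda>n. ennreal (c (A n))) \<longlonglongrightarrow> 0" by (rule tendsto_eventually)
  qed simp
  then obtain \<mu> :: "'x set \<Rightarrow> ennreal" where \<mu>: "\<And>A. A \<in> clopens \<Longrightarrow> \<mu> A = ennreal (c A)"
    "measure_space UNIV (sigma_sets UNIV clopens) \<mu>" by blast
  define M where "M = measure_of UNIV (clopens :: 'x set set) \<mu>"
  have M: "space M = UNIV" "sets M = sigma_sets UNIV clopens" by (simp_all add: M_def)
  have "emeasure M A = \<mu> A" if "A \<in> clopens" for A
    using \<mu>(2) that by (intro emeasure_measure_of[OF M_def]) (auto simp: measure_space_def M(2))
  then show thesis using that[OF M] \<mu>(1) by simp
qed

lemma integral_finite_range:
  assumes "finite_measure M" "finite R" "\<And>a. a \<in> space M \<Longrightarrow> f a \<in> R"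
    and meas: "\<And>r. r \<in> R \<Longrightarrow> {a\<in>space M. f a = r} \<in> sets M"
  shows "integrable M (\<lambda>a. u (f a) :: real)"
    and "(\<integral>a. u (f a) \<partial>M) = (\<Sum>r\<in>R. u r * measure M {a\<in>space M. f a = r})"
proof -
  interpret finite_measure M by fact
  have eq: "u (f a) = (\<Sum>r\<in>R. u r * indicator {a\<in>space M. f a = r} a)" if "a \<in> space M" for a
  proof -
    have "(\<Sum>r\<in>R. u r * indicator {a\<in>space M. f a = r} a) = (\<Sum>r\<in>R. if r = f a then u r else 0)"
      using that by (intro sum.cong) auto
    then show ?thesis using assms(2) assms(3)[OF that] by simp
  qed
  have int: "integrable M (\<lambda>a. u r * indicator {a\<in>space M. f a = r} a)" if "r \<in> R" for r
    using meas[OF that] by (intro integrable_mult_right) (simp add: emeasure_eq_measure)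
  have "integrable M (\<lambda>a. u (f a)) = integrable M (\<lambda>a. \<Sum>r\<in>R. u r * indicator {a\<in>space M. f a = r} a)"
    by (rule Bochner_Integration.integrable_cong[OF refl eq])
  then show "integrable M (\<lambda>a. u (f a))" using int by auto
  have "(\<integral>a. u (f a) \<partial>M) = (\<integral>a. (\<Sum>r\<in>R. u r * indicator {a\<in>space M. f a = r} a) \<partial>M)"
    by (rule Bochner_Integration.integral_cong[OF refl eq])
  also have "\<dots> = (\<Sum>r\<in>R. \<integral>a. u r * indicator {a\<in>space M. f a = r} a \<partial>M)"
    using int by (rule Bochner_Integration.integral_sum)
  also have "\<dots> = (\<Sum>r\<in>R. u r * measure M {a\<in>space M. f a = r})"
    using meas by (intro sum.cong refl) (simp add: Int_absorb2 Collect_restrict)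
  finally show "(\<integral>a. u (f a) \<partial>M) = (\<Sum>r\<in>R. u r * measure M {a\<in>space M. f a = r})" .
qed

text \<open>These are the simple functions over the algebra of clopen sets: the test functions whose
  integrals are finite sums of values of the content.\<close>

definition clopen_simple :: "('x::topological_space \<Rightarrow> real) \<Rightarrow> bool" where
  "clopen_simple f \<longleftrightarrow> continuous_on UNIV f \<and> finite (range f)"

lemma clopen_simple_level:
  assumes "clopen_simple f"
  shows "{a. f a = r} \<in> clopens"
proof -
  have c: "continuous_on UNIV f" and f: "finite (range f)" using assms by (auto simp: clopen_simple_def)
  have *: "closed (f -` B)" if "closed B" for B
    using closed_vimage[OF that c] .
  have "f -` {r} = - (f -` (range f - {r}))" by auto
  moreover have "closed (f -` (range f - {r}))" by (intro * finite_imp_closed) (use f in auto)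
  ultimately have "open (f -` {r})" by (simp add: closed_def)
  moreover have "{a. f a = r} = f -` {r}" by auto
  ultimately show ?thesis using *[of "{r}"] by simp
qed

lemma clopen_simple_compose:
  assumes "clopen_simple f" "continuous_on UNIV h"
  shows "clopen_simple (\<lambda>a. f (h a))"
proof -
  have "range (\<lambda>a. f (h a)) \<subseteq> range f" by auto
  then show ?thesis
    using assms continuous_on_compose2[of UNIV f UNIV h]
    by (auto simp: clopen_simple_def intro: finite_subset)
qed

lemma clopen_simple_map:
  assumes "clopen_simple f" "continuous_on UNIV u"
  shows "clopen_simple (\<lambda>a. u (f a))"
proof -
  have "range (\<lambda>a. u (f a)) = u ` range f" by auto
  then show ?thesis
    using assms continuous_on_compose2[of UNIV u UNIV f]
    by (auto simp: clopen_simple_def)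
qed

lemma clopen_simple_add:
  assumes "clopen_simple f" "clopen_simple g"
  shows "clopen_simple (\<lambda>a. f a + g a)"
proof -
  have "range (\<lambda>a. f a + g a) \<subseteq> (\<lambda>(x, y). x + y) ` (range f \<times> range g)" by auto
  moreover have "finite ((\<lambda>(x, y). x + y) ` (range f \<times> range g))"
    using assms by (auto simp: clopen_simple_def)
  ultimately have "finite (range (\<lambda>a. f a + g a))" by (rule finite_subset)
  then show ?thesis
    using assms by (simp add: clopen_simple_def continuous_on_add)
qed

lemma clopen_simple_const: "clopen_simple (\<lambda>_. c)"
  by (auto simp: clopen_simple_def)

lemma clopen_simple_indicator:
  assumes "A \<in> clopens"
  shows "clopen_simple (indicator A)"
proof -
  have "continuous_on UNIV (indicator A :: 'a \<Rightarrow> real)"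
  proof -
    have "continuous_on A (indicator A :: 'a \<Rightarrow> real)" "continuous_on (- A) (indicator A :: 'a \<Rightarrow> real)"
      by (auto intro!: continuous_on_eq[OF continuous_on_const])
    then have "continuous_on (A \<union> - A) (indicator A :: 'a \<Rightarrow> real)"
      using assms by (intro continuous_on_open_Un) auto
    then show ?thesis by simp
  qed
  moreover have "range (indicator A :: 'a \<Rightarrow> real) \<subseteq> {0, 1}" by (auto simp: indicator_def)
  ultimately show ?thesis using finite_subset by (auto simp: clopen_simple_def)
qed

lemma clopen_simple_integrable:
  assumes "clopen_simple f" "finite_measure M" "space M = UNIV" "sets M = sigma_sets UNIV clopens"
  shows "integrable M f"
  using integral_finite_range(1)[OF assms(2), of "range f" f "\<lambda>r. r"] assms clopen_simple_level[OF assms(1)]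
  by (auto simp: clopen_simple_def intro: sigma_sets.Basic)

text \<open>Clopen sets are stable under intersection, so Dynkin induction applies: complements
  replace \<open>c\<close> by 1 - c, and a countable disjoint union is first cut down to a finite
  one by continuity from below.\<close>

lemma clopen_simple_dense_set:
  assumes fin: "finite_measure N" and sp: "space N = UNIV" and st: "sets N = sigma_sets UNIV clopens"
    and A: "A \<in> sets N"
  shows "\<forall>\<eta>>0. \<exists>c. clopen_simple c \<and> (\<integral>a. \<bar>indicator A a - c a\<bar> \<partial>N) < \<eta>"
proof -
  interpret finite_measure N by fact
  have csi: "integrable N c" if "clopen_simple c" for c
    using clopen_simple_integrable[OF that fin sp st] .
  have ind: "integrable N (indicator B :: _ \<Rightarrow> real)" if "B \<in> sets N" for B
    using that by (simp add: emeasure_eq_measure)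
  have "Int_stable (clopens :: 'a set set)" "clopens \<subseteq> Pow (UNIV :: 'a set)"
    by (auto simp: Int_stable_def)
  then show ?thesis using A[unfolded st]
  proof (induction A rule: sigma_sets_induct_disjoint)
    fix A :: "'a set" assume "A \<in> clopens"
    then show "\<forall>\<eta>>0. \<exists>c. clopen_simple c \<and> (\<integral>a. \<bar>indicator A a - c a\<bar> \<partial>N) < \<eta>"
      using clopen_simple_indicator[of A] by (intro allI impI exI[of _ "indicator A"]) auto
  next
    show "\<forall>\<eta>>0. \<exists>c. clopen_simple c \<and> (\<integral>a. \<bar>indicator {} a - c a\<bar> \<partial>N) < \<eta>"
      using clopen_simple_const[of 0] by (intro allI impI exI[of _ "\<lambda>_. 0"]) auto
  next
    fix A assume A: "A \<in> sigma_sets UNIV clopens"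
      "\<forall>\<eta>>0. \<exists>c. clopen_simple c \<and> (\<integral>a. \<bar>indicator A a - c a\<bar> \<partial>N) < \<eta>"
    show "\<forall>\<eta>>0. \<exists>c. clopen_simple c \<and> (\<integral>a. \<bar>indicator (UNIV - A) a - c a\<bar> \<partial>N) < \<eta>"
    proof (intro allI impI)
      fix \<eta> :: real assume "\<eta> > 0"
      then obtain c where c: "clopen_simple c" "(\<integral>a. \<bar>indicator A a - c a\<bar> \<partial>N) < \<eta>"
        using A(2) by blast
      have "clopen_simple (\<lambda>a. 1 - c a)"
        by (rule clopen_simple_map[OF c(1), of "\<lambda>t. 1 - t"]) (intro continuous_intros)
      moreover have "(\<lambda>a. \<bar>indicator (UNIV - A) a - (1 - c a)\<bar>) = (\<lambda>a. \<bar>indicator A a - c a\<bar>)"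
        by (auto simp: indicator_def fun_eq_iff)
      ultimately show "\<exists>c. clopen_simple c \<and> (\<integral>a. \<bar>indicator (UNIV - A) a - c a\<bar> \<partial>N) < \<eta>"
        using c(2) by (intro exI[of _ "\<lambda>a. 1 - c a"]) simp
    qed
  next
    fix A :: "nat \<Rightarrow> 'a set"
    assume disj: "disjoint_family A" and A: "range A \<subseteq> sigma_sets UNIV clopens"
      and IH: "\<And>i. \<forall>\<eta>>0. \<exists>c. clopen_simple c \<and> (\<integral>a. \<bar>indicator (A i) a - c a\<bar> \<partial>N) < \<eta>"
    \<comment> \<open>For finite disjoint unions the indicators add, and so do the
      approximants.\<close>
    have IH': "\<forall>\<eta>>0. \<exists>c. clopen_simple c \<and> (\<integral>a. \<bar>indicator (\<Union>i<n. A i) a - c a\<bar> \<partial>N) < \<eta>" for n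
    proof (induction n)
      case 0
      show ?case
        using clopen_simple_const[of 0] by (intro allI impI exI[of _ "\<lambda>_. 0"]) auto
    next
      case (Suc n)
      show ?case
      proof (intro allI impI)
        fix \<eta> :: real assume "\<eta> > 0"
        then have "\<eta> / 2 > 0" by simp
        then obtain c c' where c: "clopen_simple c" "(\<integral>a. \<bar>indicator (\<Union>i<n. A i) a - c a\<bar> \<partial>N) < \<eta> / 2"
          "clopen_simple c'" "(\<integral>a. \<bar>indicator (A n) a - c' a\<bar> \<partial>N) < \<eta> / 2"
          using Suc IH[of n] by meson
        have m: "(\<Union>i<n. A i) \<in> sets N" "A n \<in> sets N" using A by (auto simp: st[symmetric])
        have "(\<Union>i<n. A i) \<inter> A n = {}"
          using disj unfolding disjoint_family_on_def by (auto simp: disjoint_iff) (metis less_irrefl IntI empty_iff)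
        then have e: "indicator (\<Union>i<Suc n. A i) a = indicator (\<Union>i<n. A i) a + (indicator (A n) a :: real)" for a
          by (auto simp: indicator_def lessThan_Suc)
        have "(\<integral>a. \<bar>indicator (\<Union>i<Suc n. A i) a - (c a + c' a)\<bar> \<partial>N) \<le>
            (\<integral>a. \<bar>indicator (\<Union>i<n. A i) a - c a\<bar> + \<bar>indicator (A n) a - c' a\<bar> \<partial>N)"
          unfolding e using ind[OF m(1)] ind[OF m(2)] csi[OF c(1)] csi[OF c(3)]
          by (intro integral_mono) auto
        also have "\<dots> = (\<integral>a. \<bar>indicator (\<Union>i<n. A i) a - c a\<bar> \<partial>N) + (\<integral>a. \<bar>indicator (A n) a - c' a\<bar> \<partial>N)"
          using ind[OF m(1)] ind[OF m(2)] csi[OF c(1)] csi[OF c(3)]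
          by (intro Bochner_Integration.integral_add) auto
        also have "\<dots> < \<eta>" using c by simp
        finally show "\<exists>c. clopen_simple c \<and> (\<integral>a. \<bar>indicator (\<Union>i<Suc n. A i) a - c a\<bar> \<partial>N) < \<eta>"
          using clopen_simple_add[OF c(1,3)] by (intro exI[of _ "\<lambda>a. c a + c' a"]) simp
      qed
    qed
    show "\<forall>\<eta>>0. \<exists>c. clopen_simple c \<and> (\<integral>a. \<bar>indicator (\<Union>i. A i) a - c a\<bar> \<partial>N) < \<eta>"
    proof (intro allI impI)
      fix \<eta> :: real assume \<eta>: "\<eta> > 0"
      define B where "B n = (\<Union>i<n. A i)" for n
      have Bm: "B n \<in> sets N" "(\<Union>i. A i) \<in> sets N" for n using A by (auto simp: B_def st[symmetric])
      have "incseq B" unfolding B_def incseq_def by (intro allI impI UN_mono) auto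
      then have "(\<lambda>n. measure N (B n)) \<longlonglongrightarrow> measure N (\<Union>n. B n)"
        using Bm by (intro finite_Lim_measure_incseq) auto
      moreover have "(\<Union>n. B n) = (\<Union>i. A i)" by (auto simp: B_def)
      ultimately have "(\<lambda>n. measure N (B n)) \<longlonglongrightarrow> measure N (\<Union>i. A i)" by simp
      then have "eventually (\<lambda>n. dist (measure N (B n)) (measure N (\<Union>i. A i)) < \<eta> / 2) sequentially"
        by (rule tendstoD) (use \<eta> in simp)
      then obtain n where n: "dist (measure N (B n)) (measure N (\<Union>i. A i)) < \<eta> / 2"
        by (meson eventually_happens sequentially_bot)
      obtain c where c: "clopen_simple c" "(\<integral>a. \<bar>indicator (B n) a - c a\<bar> \<partial>N) < \<eta> / 2"
        using IH'[of n] \<eta> unfolding B_def by (meson half_gt_zero)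
      have sub: "B n \<subseteq> (\<Union>i. A i)" by (auto simp: B_def)
      have "\<bar>indicator (\<Union>i. A i) a - c a\<bar> \<le>
          (indicator (\<Union>i. A i) a - indicator (B n) a) + \<bar>indicator (B n) a - c a\<bar>" for a
        using sub by (auto simp: indicator_def)
      then have "(\<integral>a. \<bar>indicator (\<Union>i. A i) a - c a\<bar> \<partial>N) \<le>
          (\<integral>a. (indicator (\<Union>i. A i) a - indicator (B n) a) + \<bar>indicator (B n) a - c a\<bar> \<partial>N)"
        using ind[OF Bm(1)[of n]] ind[OF Bm(2)] csi[OF c(1)]
        by (intro integral_mono Bochner_Integration.integrable_add Bochner_Integration.integrable_diff
            integrable_abs)
      also have "\<dots> = (\<integral>a. indicator (\<Union>i. A i) a - indicator (B n) a \<partial>N) + (\<integral>a. \<bar>indicator (B n) a - c a\<bar> \<partial>N)"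
        using ind[OF Bm(1)[of n]] ind[OF Bm(2)] csi[OF c(1)]
        by (intro Bochner_Integration.integral_add) auto
      also have "(\<integral>a. indicator (\<Union>i. A i) a - indicator (B n) a \<partial>N) = measure N (\<Union>i. A i) - measure N (B n)"
        using ind[OF Bm(1)[of n]] ind[OF Bm(2)] sp by (subst Bochner_Integration.integral_diff) auto
      also have "\<dots> + (\<integral>a. \<bar>indicator (B n) a - c a\<bar> \<partial>N) < \<eta>"
        using n c(2) unfolding dist_real_def by linarith
      finally show "\<exists>c. clopen_simple c \<and> (\<integral>a. \<bar>indicator (\<Union>i. A i) a - c a\<bar> \<partial>N) < \<eta>"
        using c(1) by blast
    qed
  qed
qed

text \<open>This carries inequalities known for locally constant test functions over to bounded
  measurable ones. The induction goes through multiples of indicators, sums and dominated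
  limits.\<close>

lemma clopen_simple_dense:
  assumes fin: "finite_measure N" and sp: "space N = UNIV" and st: "sets N = sigma_sets UNIV clopens"
    and f: "integrable N f"
  shows "\<forall>\<eta>>0. \<exists>c. clopen_simple c \<and> (\<integral>a. \<bar>f a - c a\<bar> \<partial>N) < \<eta>"
  using f
proof (induction f rule: integrable_induct)
  case (base A b)
  have csi: "integrable N c" if "clopen_simple c" for c
    using clopen_simple_integrable[OF that fin sp st] .
  have ind: "integrable N (indicator A :: _ \<Rightarrow> real)"
    using base by simp
  show ?case
  proof (intro allI impI)
    fix \<eta> :: real assume "\<eta> > 0"
    \<comment> \<open>The added 1 covers the case \<open>b = 0\<close>.\<close>
    then have "\<eta> / (\<bar>b\<bar> + 1) > 0" by (intro divide_pos_pos) auto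
    then obtain c where c: "clopen_simple c" "(\<integral>a. \<bar>indicator A a - c a\<bar> \<partial>N) < \<eta> / (\<bar>b\<bar> + 1)"
      using clopen_simple_dense_set[OF fin sp st base(1)] by blast
    have "(\<integral>a. \<bar>indicator A a *\<^sub>R b - b * c a\<bar> \<partial>N) = (\<integral>a. \<bar>b\<bar> * \<bar>indicator A a - c a\<bar> \<partial>N)"
      by (intro Bochner_Integration.integral_cong refl) (simp add: abs_mult[symmetric] algebra_simps)
    also have "\<dots> = \<bar>b\<bar> * (\<integral>a. \<bar>indicator A a - c a\<bar> \<partial>N)" by simp
    also have "\<dots> \<le> (\<bar>b\<bar> + 1) * (\<integral>a. \<bar>indicator A a - c a\<bar> \<partial>N)"
      by (intro mult_right_mono) auto
    also have "\<dots> < \<eta>" using c(2) by (simp add: pos_less_divide_eq mult.commute)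
    finally have "(\<integral>a. \<bar>indicator A a *\<^sub>R b - b * c a\<bar> \<partial>N) < \<eta>" .
    moreover have "clopen_simple (\<lambda>a. b * c a)"
      by (rule clopen_simple_map[OF c(1)]) (intro continuous_intros)
    ultimately show "\<exists>c. clopen_simple c \<and> (\<integral>a. \<bar>indicator A a *\<^sub>R b - c a\<bar> \<partial>N) < \<eta>" by blast
  qed
next
  case (add f g)
  have csi: "integrable N c" if "clopen_simple c" for c
    using clopen_simple_integrable[OF that fin sp st] .
  show ?case
  proof (intro allI impI)
    fix \<eta> :: real assume "\<eta> > 0"
    then have "\<eta> / 2 > 0" by simp
    then obtain c c' where c: "clopen_simple c" "(\<integral>a. \<bar>f a - c a\<bar> \<partial>N) < \<eta> / 2"
      "clopen_simple c'" "(\<integral>a. \<bar>g a - c' a\<bar> \<partial>N) < \<eta> / 2"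
      using add.IH by meson
    have "(\<integral>a. \<bar>f a + g a - (c a + c' a)\<bar> \<partial>N) \<le> (\<integral>a. \<bar>f a - c a\<bar> + \<bar>g a - c' a\<bar> \<partial>N)"
      using add.hyps csi[OF c(1)] csi[OF c(3)] by (intro integral_mono) auto
    also have "\<dots> = (\<integral>a. \<bar>f a - c a\<bar> \<partial>N) + (\<integral>a. \<bar>g a - c' a\<bar> \<partial>N)"
      using add.hyps csi[OF c(1)] csi[OF c(3)] by (intro Bochner_Integration.integral_add) auto
    also have "\<dots> < \<eta>" using c by simp
    finally show "\<exists>c. clopen_simple c \<and> (\<integral>a. \<bar>f a + g a - c a\<bar> \<partial>N) < \<eta>"
      using clopen_simple_add[OF c(1,3)] by (intro exI[of _ "\<lambda>a. c a + c' a"]) simp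
  qed
next
  case (lim f s)
  have csi: "integrable N c" if "clopen_simple c" for c
    using clopen_simple_integrable[OF that fin sp st] .
  have "(\<lambda>i. \<integral>a. \<bar>f a - s i a\<bar> \<partial>N) \<longlonglongrightarrow> (\<integral>a. 0 \<partial>N)"
  proof (rule integral_dominated_convergence[where w = "\<lambda>a. 3 * \<bar>f a\<bar>"])
    show "AE a in N. (\<lambda>i. \<bar>f a - s i a\<bar>) \<longlonglongrightarrow> 0"
    proof (rule AE_I2)
      fix a assume "a \<in> space N"
      then have "(\<lambda>i. s i a) \<longlonglongrightarrow> f a" using lim by blast
      then have "(\<lambda>i. \<bar>f a - s i a\<bar>) \<longlonglongrightarrow> \<bar>f a - f a\<bar>" by (intro tendsto_intros)
      then show "(\<lambda>i. \<bar>f a - s i a\<bar>) \<longlonglongrightarrow> 0" by simp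
    qed
    show "AE a in N. norm \<bar>f a - s i a\<bar> \<le> 3 * \<bar>f a\<bar>" for i
    proof (rule AE_I2)
      fix a assume "a \<in> space N"
      then have "\<bar>s i a\<bar> \<le> 2 * \<bar>f a\<bar>" using lim by fastforce
      then show "norm \<bar>f a - s i a\<bar> \<le> 3 * \<bar>f a\<bar>" by simp
    qed
  qed (use lim in \<open>auto intro: borel_measurable_integrable\<close>)
  then have L: "(\<lambda>i. \<integral>a. \<bar>f a - s i a\<bar> \<partial>N) \<longlonglongrightarrow> 0" by simp
  show ?case
  proof (intro allI impI)
    fix \<eta> :: real assume \<eta>: "\<eta> > 0"
    then have "eventually (\<lambda>i. dist (\<integral>a. \<bar>f a - s i a\<bar> \<partial>N) 0 < \<eta> / 2) sequentially"
      using tendstoD[OF L, of "\<eta> / 2"] by simp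
    then obtain i where i: "dist (\<integral>a. \<bar>f a - s i a\<bar> \<partial>N) 0 < \<eta> / 2"
      by (meson eventually_happens sequentially_bot)
    obtain c where c: "clopen_simple c" "(\<integral>a. \<bar>s i a - c a\<bar> \<partial>N) < \<eta> / 2"
      using lim.IH[of i] \<eta> by (meson half_gt_zero)
    have si: "integrable N (s i)" "integrable N f" "integrable N c" using lim csi[OF c(1)] by auto
    have "(\<integral>a. \<bar>f a - c a\<bar> \<partial>N) \<le> (\<integral>a. \<bar>f a - s i a\<bar> + \<bar>s i a - c a\<bar> \<partial>N)"
      using si by (intro integral_mono) auto
    also have "\<dots> = (\<integral>a. \<bar>f a - s i a\<bar> \<partial>N) + (\<integral>a. \<bar>s i a - c a\<bar> \<partial>N)"
      using si by (intro Bochner_Integration.integral_add) auto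
    also have "\<dots> < \<eta>" using i c(2) unfolding dist_real_def by linarith
    finally show "\<exists>c. clopen_simple c \<and> (\<integral>a. \<bar>f a - c a\<bar> \<partial>N) < \<eta>" using c(1) by blast
  qed
qed

section \<open>Averaged measures and the Hellinger affinity\<close>

text \<open>\<open>N\<close> is the mixture of the push-forwards of \<open>M\<close> under
  \<open>act n\<close> with weights 2^-(n+1), built as an image of the product of a geometric law
  with \<open>M\<close> so that its integrals are iterated integrals. All weights are positive,
  which gives the null sets; keeping a single term gives the domination by the factor
  2^(n+1).\<close>

lemma average_measure:
  fixes M :: "'x measure" and act :: "nat \<Rightarrow> 'x \<Rightarrow> 'x"
  assumes fin: "finite_measure M" and act: "\<And>n. act n \<in> M \<rightarrow>\<^sub>M M"
  obtains N where "space N = space M" "sets N = sets M" "finite_measure N"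
    "\<And>A. A \<in> sets M \<Longrightarrow> emeasure N A = 0 \<longleftrightarrow> (\<forall>n. emeasure M (act n -` A \<inter> space M) = 0)"
    "\<And>n (f :: 'x \<Rightarrow> real). \<lbrakk>integrable N f; \<And>a. 0 \<le> f a\<rbrakk> \<Longrightarrow>
      integrable M (\<lambda>a. f (act n a)) \<and> (\<integral>a. f (act n a) \<partial>M) \<le> 2 ^ (n + 1) * (\<integral>a. f a \<partial>N)"
proof -
  interpret M: finite_measure M by fact
  define p :: "nat pmf" where "p = geometric_pmf (1/2)"
  have pn: "pmf p n = 1 / 2 ^ (n + 1)" for n by (simp add: p_def power_divide)
  have pU: "set_pmf p = UNIV" by (simp add: p_def set_pmf_geometric)
  interpret P: pair_sigma_finite "measure_pmf p" M
    by (simp add: pair_sigma_finite_def measure_pmf.sigma_finite_measure_axioms M.sigma_finite_measure_axioms)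
  have meas: "(\<lambda>(n, a). act n a) \<in> measure_pmf p \<Otimes>\<^sub>M M \<rightarrow>\<^sub>M M"
  proof -
    have "(\<lambda>(n, a). act n a) \<in> count_space UNIV \<Otimes>\<^sub>M M \<rightarrow>\<^sub>M M"
      by (rule measurable_pair_measure_countable1) (use act in auto)
    then show ?thesis by (simp cong: measurable_cong_sets sets_pair_measure_cong)
  qed
  define N where "N = distr (measure_pmf p \<Otimes>\<^sub>M M) M (\<lambda>(n, a). act n a)"
  have sp: "space N = space M" "sets N = sets M" by (simp_all add: N_def)
  have nn: "(\<integral>\<^sup>+a. f a \<partial>N) = (\<integral>\<^sup>+n. (\<integral>\<^sup>+a. f (act n a) \<partial>M) \<partial>measure_pmf p)"
    if f: "f \<in> borel_measurable M" for f :: "'x \<Rightarrow> ennreal"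
  proof -
    have "(\<integral>\<^sup>+a. f a \<partial>N) = (\<integral>\<^sup>+x. f ((\<lambda>(n, a). act n a) x) \<partial>(measure_pmf p \<Otimes>\<^sub>M M))"
      unfolding N_def by (rule nn_integral_distr[OF meas]) (use f in simp)
    also have "\<dots> = (\<integral>\<^sup>+n. (\<integral>\<^sup>+a. f ((\<lambda>(n, a). act n a) (n, a)) \<partial>M) \<partial>measure_pmf p)"
      using measurable_compose[OF meas f] by (rule M.nn_integral_fst[symmetric])
    finally show ?thesis by simp
  qed
  have em: "emeasure N A = (\<integral>\<^sup>+n. emeasure M (act n -` A \<inter> space M) \<partial>measure_pmf p)"
    if A: "A \<in> sets M" for A
  proof -
    have "emeasure N A = (\<integral>\<^sup>+a. indicator A a \<partial>N)" using A sp by simp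
    also have "\<dots> = (\<integral>\<^sup>+n. (\<integral>\<^sup>+a. indicator A (act n a) \<partial>M) \<partial>measure_pmf p)"
      using A by (intro nn) simp
    also have "\<dots> = (\<integral>\<^sup>+n. emeasure M (act n -` A \<inter> space M) \<partial>measure_pmf p)"
    proof (intro nn_integral_cong)
      fix n
      have "(\<integral>\<^sup>+a. indicator A (act n a) \<partial>M) = (\<integral>\<^sup>+a. indicator (act n -` A \<inter> space M) a \<partial>M)"
        by (intro nn_integral_cong) (auto simp: indicator_def)
      also have "\<dots> = emeasure M (act n -` A \<inter> space M)"
        using measurable_sets[OF act A] by simp
      finally show "(\<integral>\<^sup>+a. indicator A (act n a) \<partial>M) = emeasure M (act n -` A \<inter> space M)" .
    qed
    finally show ?thesis .
  qed
  have zero: "emeasure N A = 0 \<longleftrightarrow> (\<forall>n. emeasure M (act n -` A \<inter> space M) = 0)" if "A \<in> sets M" for A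
    unfolding em[OF that] by (simp add: nn_integral_0_iff_AE AE_measure_pmf_iff pU)
  have finN: "finite_measure N"
  proof
    have "emeasure N (space N) = (\<integral>\<^sup>+n. emeasure M (act n -` space M \<inter> space M) \<partial>measure_pmf p)"
      unfolding sp by (rule em) simp
    also have "\<dots> \<le> (\<integral>\<^sup>+n. emeasure M (space M) \<partial>measure_pmf p)"
      by (intro nn_integral_mono emeasure_mono) auto
    also have "\<dots> = emeasure M (space M)" by (simp add: measure_pmf.emeasure_space_1)
    also have "\<dots> < \<infinity>" using M.emeasure_finite by (simp add: less_top[symmetric])
    finally show "emeasure N (space N) \<noteq> \<infinity>" by simp
  qed
  have dom: "(\<integral>\<^sup>+a. f (act n a) \<partial>M) \<le> 2 ^ (n + 1) * (\<integral>\<^sup>+a. f a \<partial>N)"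
    if f: "f \<in> borel_measurable M" for f n
  proof -
    have "(\<integral>\<^sup>+a. f (act n a) \<partial>M) * ennreal (1 / 2 ^ (n + 1)) =
        (\<integral>\<^sup>+m. (\<integral>\<^sup>+a. f (act n a) \<partial>M) * indicator {n} m \<partial>measure_pmf p)"
      by (simp add: nn_integral_cmult emeasure_pmf_single pn)
    also have "\<dots> \<le> (\<integral>\<^sup>+m. (\<integral>\<^sup>+a. f (act m a) \<partial>M) \<partial>measure_pmf p)"
      by (intro nn_integral_mono) (auto simp: indicator_def)
    also have "\<dots> = (\<integral>\<^sup>+a. f a \<partial>N)" using nn[OF f] by simp
    finally have "2 ^ (n + 1) * ((\<integral>\<^sup>+a. f (act n a) \<partial>M) * ennreal (1 / 2 ^ (n + 1))) \<le> 2 ^ (n + 1) * (\<integral>\<^sup>+a. f a \<partial>N)"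
      by (rule mult_left_mono) simp
    moreover have "2 ^ (n + 1) * ennreal (1 / 2 ^ (n + 1)) = 1"
    proof -
      have "(2 :: ennreal) ^ (n + 1) = ennreal (2 ^ (n + 1))"
        using ennreal_power[of 2 "n + 1"] by simp
      then have "2 ^ (n + 1) * ennreal (1 / 2 ^ (n + 1)) = ennreal (2 ^ (n + 1)) * ennreal (1 / 2 ^ (n + 1))"
        by (rule arg_cong)
      also have "\<dots> = ennreal (2 ^ (n + 1) * (1 / 2 ^ (n + 1)))" by (rule ennreal_mult[symmetric]) auto
      finally show ?thesis by simp
    qed
    ultimately show ?thesis by (metis mult.commute mult.left_commute mult.right_neutral)
  qed
  have "integrable M (\<lambda>a. f (act n a)) \<and> (\<integral>a. f (act n a) \<partial>M) \<le> 2 ^ (n + 1) * (\<integral>a. f a \<partial>N)"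
    if f: "integrable N f" "\<And>a. 0 \<le> f a" for f :: "'x \<Rightarrow> real" and n
  proof -
    have fm: "f \<in> borel_measurable M" using f(1) sp by (metis borel_measurable_integrable measurable_cong_sets)
    have fam: "(\<lambda>a. f (act n a)) \<in> borel_measurable M" using measurable_compose[OF act fm] .
    have I: "(\<integral>\<^sup>+a. ennreal (f a) \<partial>N) = ennreal (\<integral>a. f a \<partial>N)"
      using f by (intro nn_integral_eq_integral) auto
    have "(\<integral>\<^sup>+a. ennreal (f (act n a)) \<partial>M) \<le> 2 ^ (n + 1) * (\<integral>\<^sup>+a. ennreal (f a) \<partial>N)"
      using fm by (intro dom) simp
    also have "\<dots> = ennreal (2 ^ (n + 1) * (\<integral>a. f a \<partial>N))"
      unfolding I using f by (simp add: ennreal_mult ennreal_power[symmetric])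
    finally have le: "(\<integral>\<^sup>+a. ennreal (f (act n a)) \<partial>M) \<le> ennreal (2 ^ (n + 1) * (\<integral>a. f a \<partial>N))" .
    then have int: "integrable M (\<lambda>a. f (act n a))"
      using fam f(2) by (intro integrableI_bounded) (auto simp: less_top[symmetric] top_unique)
    have "(\<integral>\<^sup>+a. ennreal (f (act n a)) \<partial>M) = ennreal (\<integral>a. f (act n a) \<partial>M)"
      using int f by (intro nn_integral_eq_integral) auto
    then have "ennreal (\<integral>a. f (act n a) \<partial>M) \<le> ennreal (2 ^ (n + 1) * (\<integral>a. f a \<partial>N))" using le by simp
    moreover have "0 \<le> 2 ^ (n + 1) * (\<integral>a. f a \<partial>N)" using f by simp
    ultimately show ?thesis using int by (simp add: ennreal_le_iff)
  qed
  then show thesis using that[OF sp finN zero] by blast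
qed

text \<open>Twice the Hellinger affinity is the infimum of \<open>\<integral> g d\<nu> + \<integral> 1/g d\<mu>\<close>; the infimum is approached by
  truncations of \<open>g = (d\<nu>/d\<mu>)\<^sup>-\<^sup>1\<^sup>/\<^sup>2\<close>.\<close>

lemma hellinger_lower_bound:
  fixes \<mu> :: "'x measure"
  assumes fin: "finite_measure \<mu>" and T: "T \<in> \<mu> \<rightarrow>\<^sub>M \<mu>"
    and null: "null_sets (distr \<mu> \<mu> T) = null_sets \<mu>"
    and bound: "\<And>g a b. \<lbrakk>g \<in> borel_measurable \<mu>; 0 < a; \<And>\<omega>. a \<le> g \<omega> \<and> g \<omega> \<le> b\<rbrakk> \<Longrightarrow>
      B \<le> (\<integral>\<omega>. g (T \<omega>) \<partial>\<mu>) + (\<integral>\<omega>. 1 / g \<omega> \<partial>\<mu>)"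
  shows "B \<le> 2 * (\<integral>\<omega>. sqrt (enn2real (RN_deriv \<mu> (distr \<mu> \<mu> T) \<omega>)) \<partial>\<mu>)"
proof -
  interpret finite_measure \<mu> by fact
  define \<nu> where "\<nu> = distr \<mu> \<mu> T"
  define P where "P \<omega> = enn2real (RN_deriv \<mu> \<nu> \<omega>)" for \<omega>
  have fin\<nu>: "finite_measure \<nu>" unfolding \<nu>_def using T by (rule finite_measure_distr)
  then interpret N: finite_measure \<nu> .
  have sets\<nu>: "sets \<nu> = sets \<mu>" by (simp add: \<nu>_def)
  have ac: "absolutely_continuous \<mu> \<nu>" using null by (simp add: absolutely_continuous_def \<nu>_def)
  have Pm[measurable]: "P \<in> borel_measurable \<mu>" unfolding P_def by measurable
  have P0: "0 \<le> P \<omega>" for \<omega> by (simp add: P_def)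
  \<comment> \<open>The push-forward is finite, so its derivative is finite almost everywhere and
    \<open>enn2real\<close> loses nothing.\<close>
  have "AE \<omega> in \<mu>. RN_deriv \<mu> \<nu> \<omega> \<noteq> \<infinity>"
    using N.sigma_finite_measure_axioms ac sets\<nu> by (rule RN_deriv_finite)
  then have "AE \<omega> in \<mu>. RN_deriv \<mu> \<nu> \<omega> = ennreal (P \<omega>)"
    by eventually_elim (simp add: P_def less_top)
  then have "density \<mu> (RN_deriv \<mu> \<nu>) = density \<mu> (\<lambda>\<omega>. ennreal (P \<omega>))"
    by (intro density_cong) auto
  then have dens: "density \<mu> (\<lambda>\<omega>. ennreal (P \<omega>)) = \<nu>"
    using density_RN_deriv[OF ac sets\<nu>] by simp
  have intP: "integrable \<mu> P"
  proof (rule integrableI_bounded)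
    have "(\<integral>\<^sup>+\<omega>. ennreal (norm (P \<omega>)) \<partial>\<mu>) = emeasure (density \<mu> (\<lambda>\<omega>. ennreal (P \<omega>))) (space \<mu>)"
      using P0 by (subst emeasure_density) (auto intro!: nn_integral_cong)
    also have "\<dots> < \<infinity>" unfolding dens using N.emeasure_finite[of "space \<mu>"] by (simp add: less_top[symmetric])
    finally show "(\<integral>\<^sup>+\<omega>. ennreal (norm (P \<omega>)) \<partial>\<mu>) < \<infinity>" .
  qed simp
  have sq: "sqrt (P \<omega>) \<le> 1 + P \<omega>" for \<omega>
  proof -
    have "sqrt (P \<omega>) \<le> sqrt ((1 + P \<omega>)\<^sup>2)"
      using P0[of \<omega>] by (intro real_sqrt_le_mono) (simp add: power2_eq_square algebra_simps)
    then show ?thesis using P0[of \<omega>] by simp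
  qed
  have intS: "integrable \<mu> (\<lambda>\<omega>. sqrt (P \<omega>))"
    by (rule Bochner_Integration.integrable_bound[of _ "\<lambda>\<omega>. 1 + P \<omega>"]) (use intP sq P0 in auto)
  define I where "I = (\<integral>\<omega>. sqrt (P \<omega>) \<partial>\<mu>)"
  define c where "c = (\<integral>\<omega>. P \<omega> \<partial>\<mu>) + measure \<mu> (space \<mu>)"
  have c0: "0 \<le> c" unfolding c_def using P0 by simp
  have key: "B \<le> 2 * I + \<eta> * c" if \<eta>: "\<eta> > 0" for \<eta>
  proof -
    \<comment> \<open>The added \<open>\<eta>\<close> bounds \<open>g\<close> above where
      \<open>P\<close> vanishes, and the maximum keeps it away from 0 where \<open>P\<close> is
      large. The price is P g <= sqrt P + \<eta> P and 1/g <= sqrt P + \<eta>, so the total error is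
      \<open>\<eta> * c\<close>.\<close>
    define g where "g \<omega> = max (1 / (sqrt (P \<omega>) + \<eta>)) \<eta>" for \<omega>
    have gm[measurable]: "g \<in> borel_measurable \<mu>" unfolding g_def by measurable
    have pos: "sqrt (P \<omega>) + \<eta> > 0" for \<omega> using \<eta> P0[of \<omega>] by (simp add: add_nonneg_pos)
    have gb: "\<eta> \<le> g \<omega> \<and> g \<omega> \<le> max (1 / \<eta>) \<eta>" for \<omega>
    proof -
      have "1 / (sqrt (P \<omega>) + \<eta>) \<le> 1 / \<eta>"
        using \<eta> P0[of \<omega>] pos[of \<omega>] by (intro divide_left_mono) auto
      then show ?thesis unfolding g_def by (auto simp: max_def)
    qed
    have "B \<le> (\<integral>\<omega>. g (T \<omega>) \<partial>\<mu>) + (\<integral>\<omega>. 1 / g \<omega> \<partial>\<mu>)"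
      using bound[OF gm \<eta>] gb by blast
    also have "(\<integral>\<omega>. g (T \<omega>) \<partial>\<mu>) = (\<integral>\<omega>. g \<omega> \<partial>\<nu>)"
      unfolding \<nu>_def using T gm by (intro integral_distr[symmetric])
    also have "\<dots> = (\<integral>\<omega>. P \<omega> * g \<omega> \<partial>\<mu>)"
      unfolding dens[symmetric] using P0 by (subst integral_density) auto
    also have "\<dots> \<le> (\<integral>\<omega>. sqrt (P \<omega>) + \<eta> * P \<omega> \<partial>\<mu>)"
    proof (rule integral_mono)
      show "integrable \<mu> (\<lambda>\<omega>. P \<omega> * g \<omega>)"
      proof (rule Bochner_Integration.integrable_bound[of _ "\<lambda>\<omega>. max (1 / \<eta>) \<eta> * P \<omega>"])
        have "P \<omega> * g \<omega> \<le> max (1 / \<eta>) \<eta> * P \<omega>" "0 \<le> P \<omega> * g \<omega>" for \<omega>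
          using gb[of \<omega>] P0[of \<omega>] \<eta> by (auto simp: mult.commute[of "P \<omega>"] intro!: mult_right_mono)
        then show "AE \<omega> in \<mu>. norm (P \<omega> * g \<omega>) \<le> norm (max (1 / \<eta>) \<eta> * P \<omega>)"
          by (intro AE_I2) (metis abs_ge_self abs_of_nonneg order_trans real_norm_def)
      qed (use intP in auto)
      show "integrable \<mu> (\<lambda>\<omega>. sqrt (P \<omega>) + \<eta> * P \<omega>)" using intS intP by auto
      fix \<omega>
      have "P \<omega> * (1 / (sqrt (P \<omega>) + \<eta>)) \<le> sqrt (P \<omega>)"
      proof -
        have "P \<omega> = sqrt (P \<omega>) * sqrt (P \<omega>)" using P0 by simp
        also have "\<dots> \<le> sqrt (P \<omega>) * (sqrt (P \<omega>) + \<eta>)" using P0[of \<omega>] \<eta> by (intro mult_left_mono) auto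
        finally show ?thesis using pos[of \<omega>] by (simp add: pos_divide_le_eq)
      qed
      moreover have "0 \<le> \<eta> * P \<omega>" "0 \<le> sqrt (P \<omega>)" using P0[of \<omega>] \<eta> by auto
      ultimately show "P \<omega> * g \<omega> \<le> sqrt (P \<omega>) + \<eta> * P \<omega>"
        unfolding g_def max_def by (auto simp: mult.commute)
    qed
    also have "\<dots> = I + \<eta> * (\<integral>\<omega>. P \<omega> \<partial>\<mu>)" using intS intP by (simp add: I_def)
    also have "(\<integral>\<omega>. 1 / g \<omega> \<partial>\<mu>) \<le> (\<integral>\<omega>. sqrt (P \<omega>) + \<eta> \<partial>\<mu>)"
    proof (rule integral_mono)
      have gpos: "0 < g \<omega>" for \<omega> using gb[of \<omega>] \<eta> by linarith
      have *: "1 / g \<omega> \<le> sqrt (P \<omega>) + \<eta>" for \<omega>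
      proof -
        have "1 \<le> (sqrt (P \<omega>) + \<eta>) * g \<omega>"
          using mult_left_mono[of "1 / (sqrt (P \<omega>) + \<eta>)" "g \<omega>" "sqrt (P \<omega>) + \<eta>"] pos[of \<omega>]
          by (simp add: g_def)
        then show ?thesis using gpos[of \<omega>] by (simp add: pos_divide_le_eq)
      qed
      show "integrable \<mu> (\<lambda>\<omega>. sqrt (P \<omega>) + \<eta>)" using intS by auto
      then show "integrable \<mu> (\<lambda>\<omega>. 1 / g \<omega>)"
      proof (rule Bochner_Integration.integrable_bound)
        show "AE \<omega> in \<mu>. norm (1 / g \<omega>) \<le> norm (sqrt (P \<omega>) + \<eta>)"
          using * gpos pos by (intro AE_I2) (simp add: less_imp_le)
      qed simp
      show "1 / g \<omega> \<le> sqrt (P \<omega>) + \<eta>" for \<omega> by (rule *)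
    qed
    also have "\<dots> = I + \<eta> * measure \<mu> (space \<mu>)" using intS by (simp add: I_def)
    finally show ?thesis by (simp add: c_def algebra_simps)
  qed
  have "B \<le> 2 * I + e" if e: "e > 0" for e
  proof -
    \<comment> \<open>Dividing by \<open>c + 1\<close> instead of \<open>c\<close> allows
      \<open>c\<close> to be 0.\<close>
    have "B \<le> 2 * I + (e / (c + 1)) * c" using e c0 by (intro key divide_pos_pos) auto
    also have "(e / (c + 1)) * c \<le> e" using e c0 by (simp add: pos_divide_le_eq)
    finally show ?thesis by simp
  qed
  then have "B \<le> 2 * I" by (rule field_le_epsilon)
  then show ?thesis by (simp add: I_def P_def \<nu>_def)
qed

section \<open>Limits of weights on the group\<close>

lemma has_sum_levels:
  fixes w u :: "_ \<Rightarrow> real"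
  assumes w: "w summable_on C" and R: "finite R"
  shows "((\<lambda>y. u (h y) * w y) has_sum (\<Sum>r\<in>R. u r * infsum w {y\<in>C. h y = r})) {y\<in>C. h y \<in> R}"
  using R
proof (induction R)
  case (insert r R)
  have "(w has_sum infsum w {y\<in>C. h y = r}) {y\<in>C. h y = r}"
    using summable_on_subset_banach[OF w, of "{y\<in>C. h y = r}"] by (auto intro: has_sum_infsum)
  then have "((\<lambda>y. u r * w y) has_sum (u r * infsum w {y\<in>C. h y = r})) {y\<in>C. h y = r}"
    by (rule has_sum_cmult_right)
  then have 1: "((\<lambda>y. u (h y) * w y) has_sum (u r * infsum w {y\<in>C. h y = r})) {y\<in>C. h y = r}"
    by (rule has_sum_cong[THEN iffD1, rotated]) simp
  have "((\<lambda>y. u (h y) * w y) has_sum (u r * infsum w {y\<in>C. h y = r} +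
      (\<Sum>r\<in>R. u r * infsum w {y\<in>C. h y = r}))) ({y\<in>C. h y = r} \<union> {y\<in>C. h y \<in> R})"
    using insert by (intro has_sum_Un_disjoint[OF 1]) auto
  moreover have "{y\<in>C. h y = r} \<union> {y\<in>C. h y \<in> R} = {y\<in>C. h y \<in> insert r R}" by auto
  ultimately show ?case using insert by simp
qed simp

lemma infsum_levels:
  fixes w u :: "_ \<Rightarrow> real"
  assumes w: "w summable_on C" and R: "finite R" "\<And>y. y \<in> C \<Longrightarrow> h y \<in> R"
  shows "(\<lambda>y. u (h y) * w y) summable_on C"
    and "infsum (\<lambda>y. u (h y) * w y) C = (\<Sum>r\<in>R. u r * infsum w {y\<in>C. h y = r})"
proof -
  have "{y\<in>C. h y \<in> R} = C" using R(2) by auto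
  then have *: "((\<lambda>y. u (h y) * w y) has_sum (\<Sum>r\<in>R. u r * infsum w {y\<in>C. h y = r})) C"
    using has_sum_levels[OF w R(1), of u h] by simp
  show "(\<lambda>y. u (h y) * w y) summable_on C" using * by (auto simp: summable_on_def)
  show "infsum (\<lambda>y. u (h y) * w y) C = (\<Sum>r\<in>R. u r * infsum w {y\<in>C. h y = r})"
    using * by (rule infsumI)
qed

section \<open>Weights with large affinities and their finitely additive limits\<close>

context group
begin

text \<open>The mass bound \<open>C\<close> is fixed before \<open>K\<close> and
  \<open>\<epsilon>\<close>; this uniformity confines all the resulting contents to one compact
  cube.\<close>

definition affinity_dominated :: "('a \<Rightarrow> real) \<Rightarrow> real \<Rightarrow> bool" where
  "affinity_dominated \<psi> C \<longleftrightarrow> (\<forall>K \<epsilon>. finite K \<and> K \<subseteq> carrier G \<and> \<epsilon> > 0 \<longrightarrow>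
     (\<exists>w. (\<forall>y. 0 \<le> w y) \<and> w summable_on carrier G \<and> infsum w (carrier G) \<le> C \<and>
       (\<forall>x\<in>K. \<psi> x - \<epsilon> \<le> infsum (\<lambda>y. sqrt (w (inv x \<otimes> y) * w y)) (carrier G))))"

text \<open>The two sums are the integrals of y -> f(xy) and of 1/f against \<open>m\<close>,
  written over the levels of \<open>f\<close>. This is the dual form of the affinity: it makes sense
  without countable additivity, and each instance is a closed condition on finitely many values of
  \<open>m\<close>.\<close>

definition content_bound :: "('a \<Rightarrow> real) \<Rightarrow> 'a \<Rightarrow> real \<Rightarrow> ('a set \<Rightarrow> real) \<Rightarrow> bool" where
  "content_bound \<psi> x \<epsilon> m \<longleftrightarrow> (\<forall>f::'a \<Rightarrow> real. \<forall>R. finite R \<and> range f \<subseteq> R \<and> (\<forall>r\<in>R. 0 < r) \<longrightarrow>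
     2 * (\<psi> x - \<epsilon>) \<le> (\<Sum>r\<in>R. r * m {y\<in>carrier G. f (x \<otimes> y) = r}) +
       (\<Sum>r\<in>R. 1 / r * m {y\<in>carrier G. f y = r}))"

lemma bij_betw_translate: "x \<in> carrier G \<Longrightarrow> bij_betw (\<lambda>y. x \<otimes> y) (carrier G) (carrier G)"
  by (rule bij_betw_byWitness[where f' = "\<lambda>y. inv x \<otimes> y"]) (auto simp: m_assoc[symmetric])

text \<open>Pointwise, the arithmetic-geometric mean inequality gives 2 sqrt(w' w) <= f w' + w / f
  for the translated weight \<open>w'\<close>; after summation the substitution y -> xy moves the
  translation from the weight to \<open>f\<close>.\<close>

lemma weight_content_bound:
  assumes w: "\<And>y. 0 \<le> w y" "w summable_on carrier G" and x: "x \<in> carrier G"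
    and le: "\<psi> x - \<epsilon> \<le> infsum (\<lambda>y. sqrt (w (inv x \<otimes> y) * w y)) (carrier G)"
  shows "content_bound \<psi> x \<epsilon> (\<lambda>A. infsum w (A \<inter> carrier G))"
  unfolding content_bound_def
proof (intro allI impI; elim conjE)
  fix f :: "'a \<Rightarrow> real" and R
  assume R: "finite R" "range f \<subseteq> R" "\<forall>r\<in>R. 0 < r"
  have fpos: "0 < f y" for y using R by auto
  define w' where "w' y = w (inv x \<otimes> y)" for y
  have b: "bij_betw (\<lambda>y. inv x \<otimes> y) (carrier G) (carrier G)" "bij_betw (\<lambda>y. x \<otimes> y) (carrier G) (carrier G)"
    using x by (auto intro: bij_betw_translate)
  have w's: "w' summable_on carrier G"
    unfolding w'_def using summable_on_reindex_bij_betw[OF b(1), of w] w(2) by simp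
  have sq: "2 * sqrt (w' y * w y) \<le> f y * w' y + 1 / f y * w y" for y
  proof -
    have "sqrt ((f y * w' y) * (1 / f y * w y)) \<le> (f y * w' y + 1 / f y * w y) / 2"
      using w(1) fpos[of y] by (intro arith_geo_mean_sqrt) (auto simp: w'_def)
    moreover have "(f y * w' y) * (1 / f y * w y) = w' y * w y" using fpos[of y] by simp
    ultimately show ?thesis by simp
  qed
  have lev1: "(\<lambda>y. f y * w' y) summable_on carrier G"
    using infsum_levels(1)[OF w's R(1), of f "\<lambda>r. r"] R(2) by auto
  have lev2: "(\<lambda>y. 1 / f y * w y) summable_on carrier G"
    "infsum (\<lambda>y. 1 / f y * w y) (carrier G) = (\<Sum>r\<in>R. 1 / r * infsum w {y\<in>carrier G. f y = r})"
    using infsum_levels[OF w(2) R(1), of f "\<lambda>r. 1 / r"] R(2) by auto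
  have lev3: "infsum (\<lambda>y. f (x \<otimes> y) * w y) (carrier G) = (\<Sum>r\<in>R. r * infsum w {y\<in>carrier G. f (x \<otimes> y) = r})"
    using infsum_levels[OF w(2) R(1), of "\<lambda>y. f (x \<otimes> y)" "\<lambda>r. r"] R(2) by auto
  have "infsum (\<lambda>y. f y * w' y) (carrier G) = infsum (\<lambda>y. f (x \<otimes> y) * w' (x \<otimes> y)) (carrier G)"
    using infsum_reindex_bij_betw[OF b(2), of "\<lambda>y. f y * w' y"] by simp
  also have "\<dots> = infsum (\<lambda>y. f (x \<otimes> y) * w y) (carrier G)"
    using x by (intro infsum_cong) (simp add: w'_def m_assoc[symmetric])
  finally have tr: "infsum (\<lambda>y. f y * w' y) (carrier G) = infsum (\<lambda>y. f (x \<otimes> y) * w y) (carrier G)" .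
  have "(\<lambda>y. norm (2 * sqrt (w' y * w y))) summable_on carrier G"
  proof (rule Infinite_Sum.abs_summable_on_comparison_test)
    show "(\<lambda>y. norm (f y * w' y + 1 / f y * w y)) summable_on carrier G"
      by (rule summable_on_iff_abs_summable_on_real[THEN iffD1, OF summable_on_add[OF lev1 lev2(1)]])
    show "norm (2 * sqrt (w' y * w y)) \<le> norm (f y * w' y + 1 / f y * w y)" for y
      using sq[of y] w(1) by (simp add: w'_def)
  qed
  then have sqs: "(\<lambda>y. 2 * sqrt (w' y * w y)) summable_on carrier G"
    by (rule summable_on_iff_abs_summable_on_real[THEN iffD2])
  have "2 * (\<psi> x - \<epsilon>) \<le> 2 * infsum (\<lambda>y. sqrt (w' y * w y)) (carrier G)"
    using le by (simp add: w'_def)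
  also have "\<dots> = infsum (\<lambda>y. 2 * sqrt (w' y * w y)) (carrier G)"
    by (rule infsum_cmult_right'[symmetric])
  also have "\<dots> \<le> infsum (\<lambda>y. f y * w' y + 1 / f y * w y) (carrier G)"
    using sqs summable_on_add[OF lev1 lev2(1)] sq by (rule infsum_mono)
  also have "\<dots> = infsum (\<lambda>y. f y * w' y) (carrier G) + infsum (\<lambda>y. 1 / f y * w y) (carrier G)"
    using lev1 lev2(1) by (rule infsum_add)
  finally have "2 * (\<psi> x - \<epsilon>) \<le> (\<Sum>r\<in>R. r * infsum w {y\<in>carrier G. f (x \<otimes> y) = r}) +
       (\<Sum>r\<in>R. 1 / r * infsum w {y\<in>carrier G. f y = r})"
    unfolding tr lev2(2) lev3 .
  moreover have "{y\<in>carrier G. P y} \<inter> carrier G = {y\<in>carrier G. P y}" for P by auto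
  ultimately show "2 * (\<psi> x - \<epsilon>) \<le> (\<Sum>r\<in>R. r * infsum w ({y\<in>carrier G. f (x \<otimes> y) = r} \<inter> carrier G)) +
       (\<Sum>r\<in>R. 1 / r * infsum w ({y\<in>carrier G. f y = r} \<inter> carrier G))" by simp
qed

lemma closed_content_bound: "closed {m. content_bound \<psi> x \<epsilon> m}"
  unfolding content_bound_def
  by (intro closed_Collect_all closed_Collect_imp closed_Collect_le continuous_intros
      continuous_on_product_coordinates) simp

text \<open>The additive set functions with values in [0, C] form a closed subset of a compact
  product. Any finitely many pairs \<open>(x, \<epsilon>)\<close> are served by one weight, chosen
  for the smallest of their tolerances, so the finite intersection property applies.\<close>

lemma limit_content:
  assumes dom: "affinity_dominated \<psi> C"
  obtains m :: "'a set \<Rightarrow> real" where "\<And>A. 0 \<le> m A"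
    "\<And>A B. A \<inter> B = {} \<Longrightarrow> m (A \<union> B) = m A + m B"
    "\<And>x \<epsilon>. \<lbrakk>x \<in> carrier G; 0 < \<epsilon>\<rbrakk> \<Longrightarrow> content_bound \<psi> x \<epsilon> m"
proof -
  define S0 where "S0 = {m :: 'a set \<Rightarrow> real. (\<forall>A. m A \<in> {0..C}) \<and>
    (\<forall>A B. A \<inter> B = {} \<longrightarrow> m (A \<union> B) = m A + m B)}"
  have "compact (PiE (UNIV :: 'a set set) (\<lambda>_. {0..C}))"
    using compactin_PiE[of "\<lambda>_. euclidean" "UNIV :: 'a set set" "\<lambda>_. {0..C}"]
    by (simp add: euclidean_product_topology compactin_euclidean_iff)
  moreover have "closed {m :: 'a set \<Rightarrow> real. \<forall>A B. A \<inter> B = {} \<longrightarrow> m (A \<union> B) = m A + m B}"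
    by (intro closed_Collect_all closed_Collect_imp closed_Collect_eq continuous_intros
      continuous_on_product_coordinates) simp
  ultimately have "compact (PiE (UNIV :: 'a set set) (\<lambda>_. {0..C}) \<inter>
      {m :: 'a set \<Rightarrow> real. \<forall>A B. A \<inter> B = {} \<longrightarrow> m (A \<union> B) = m A + m B})"
    by (rule compact_Int_closed)
  moreover have "PiE (UNIV :: 'a set set) (\<lambda>_. {0..C}) \<inter>
      {m :: 'a set \<Rightarrow> real. \<forall>A B. A \<inter> B = {} \<longrightarrow> m (A \<union> B) = m A + m B} = S0"
    by (auto simp: S0_def PiE_UNIV_domain)
  ultimately have "compact S0" by simp
  then have "S0 \<inter> (\<Inter>i\<in>carrier G \<times> {0::real<..}. {m. content_bound \<psi> (fst i) (snd i) m}) \<noteq> {}"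
  proof (rule compact_imp_fip_image)
    show "closed {m. content_bound \<psi> (fst i) (snd i) m}" for i by (rule closed_content_bound)
    fix I' assume I': "finite I'" "I' \<subseteq> carrier G \<times> {0::real<..}"
    define K where "K = fst ` I'"
    \<comment> \<open>The inserted 1 provides a tolerance when the finite family is empty.\<close>
    define \<epsilon> where "\<epsilon> = Min (insert 1 (snd ` I'))"
    have K: "finite K" "K \<subseteq> carrier G" using I' by (auto simp: K_def)
    have "\<epsilon> \<in> insert 1 (snd ` I')" unfolding \<epsilon>_def using I' by (intro Min_in) auto
    then have \<epsilon>: "0 < \<epsilon>" using I' by auto
    have \<epsilon>_le: "\<epsilon> \<le> snd i" if "i \<in> I'" for i unfolding \<epsilon>_def using I' that by (intro Min_le) auto
    obtain w where w: "\<forall>y. 0 \<le> w y" "w summable_on carrier G" "infsum w (carrier G) \<le> C"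
      "\<forall>x\<in>K. \<psi> x - \<epsilon> \<le> infsum (\<lambda>y. sqrt (w (inv x \<otimes> y) * w y)) (carrier G)"
      using dom[unfolded affinity_dominated_def, rule_format, of K \<epsilon>] K \<epsilon> by blast
    define m where "m A = infsum w (A \<inter> carrier G)" for A
    have sub: "w summable_on (A \<inter> carrier G)" for A
      using summable_on_subset_banach[OF w(2)] by auto
    have "m A \<in> {0..C}" for A
    proof -
      have "m A \<le> infsum w (carrier G)"
        unfolding m_def using sub w(1,2) by (intro infsum_mono2) auto
      moreover have "0 \<le> m A" unfolding m_def using w(1) by (intro infsum_nonneg) auto
      ultimately show ?thesis using w(3) by auto
    qed
    moreover have "m (A \<union> B) = m A + m B" if "A \<inter> B = {}" for A B
      unfolding m_def Int_Un_distrib2 using that sub by (intro infsum_Un_disjoint) auto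
    ultimately have "m \<in> S0" by (simp add: S0_def)
    moreover have "content_bound \<psi> (fst i) (snd i) m" if i: "i \<in> I'" for i
    proof -
      have "fst i \<in> K" using i by (simp add: K_def)
      then have "\<psi> (fst i) - snd i \<le> infsum (\<lambda>y. sqrt (w (inv (fst i) \<otimes> y) * w y)) (carrier G)"
        using w(4) \<epsilon>_le[OF i] by force
      then show ?thesis
        unfolding m_def using w(1,2) K(2) \<open>fst i \<in> K\<close> by (intro weight_content_bound) auto
    qed
    ultimately show "S0 \<inter> (\<Inter>i\<in>I'. {m. content_bound \<psi> (fst i) (snd i) m}) \<noteq> {}" by blast
  qed
  then obtain m where m: "m \<in> S0" "\<And>i. i \<in> carrier G \<times> {0::real<..} \<Longrightarrow> content_bound \<psi> (fst i) (snd i) m"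
    by blast
  show thesis
  proof (rule that[of m])
    show "content_bound \<psi> x \<epsilon> m" if "x \<in> carrier G" "0 < \<epsilon>" for x \<epsilon>
      using m(2)[of "(x, \<epsilon>)"] that by simp
  qed (use m(1) in \<open>auto simp: S0_def\<close>)
qed

end

section \<open>From contents on the group to measures on the space of fields\<close>

context fg_group
begin

lemma field_act_continuous: "continuous_on UNIV (field_act x)"
proof (rule continuous_on_coordinatewise_then_product)
  fix i :: "'a \<times> 'a"
  show "continuous_on UNIV (\<lambda>a. field_act x a i)"
    by (cases i; cases "fst i \<in> carrier G") (auto simp: field_act_def)
qed

lemma field_act_measurable:
  assumes "space M = UNIV" "sets M = sigma_sets UNIV clopens"
  shows "field_act x \<in> M \<rightarrow>\<^sub>M M"
proof (rule measurable_sigma_sets[OF assms(2)])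
  fix A :: "('a \<times> 'a \<Rightarrow> bool) set" assume A: "A \<in> clopens"
  then have "field_act x -` A \<in> clopens"
    using open_vimage[OF _ field_act_continuous, of A x] closed_vimage[OF _ field_act_continuous, of A x] by simp
  then show "field_act x -` A \<inter> space M \<in> sets M" using assms by (simp add: sigma_sets.Basic)
qed (use assms in auto)

lemma clopen_walk: "{a. Q (walk a g k)} \<in> clopens"
proof -
  have *: "open {a. Q (walk a g k)}" for Q
  proof (subst open_subopen, intro ballI)
    fix a assume a: "a \<in> {a. Q (walk a g k)}"
    obtain F where F: "finite F" "\<And>b. (\<forall>i\<in>F. a i = b i) \<Longrightarrow> walk b g k = walk a g k"
      using walk_local[of a g k] by blast
    have "open {b. \<forall>i\<in>F. a i = b i}" by (rule open_cylinder[OF F(1)]) simp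
    moreover have "{b. \<forall>i\<in>F. a i = b i} \<subseteq> {a. Q (walk a g k)}"
    proof
      fix b assume "b \<in> {b. \<forall>i\<in>F. a i = b i}"
      then have "walk b g k = walk a g k" unfolding mem_Collect_eq by (rule F(2))
      then show "b \<in> {a. Q (walk a g k)}" using a by simp
    qed
    ultimately show "\<exists>U. open U \<and> a \<in> U \<and> U \<subseteq> {a. Q (walk a g k)}"
      by (intro exI[of _ "{b. \<forall>i\<in>F. a i = b i}"]) simp
  qed
  have "- {a. Q (walk a g k)} = {a. \<not> Q (walk a g k)}" by auto
  then show ?thesis using *[of Q] *[of "\<lambda>x. \<not> Q x"] by (simp add: closed_def)
qed

text \<open>An exhaustion of the countable group by finite sets turns the condition for all finite
  sets into countably many. This is needed because the sigma-algebra generated by clopen sets admits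
  only countable intersections.\<close>

lemma fields_clopen_Inter:
  obtains E :: "nat \<Rightarrow> ('a \<times> 'a \<Rightarrow> bool) set" where "\<And>n. E n \<in> clopens" "fields = (\<Inter>n. E n)"
proof -
  define F where "F n = from_nat_into (carrier G) ` {..<n}" for n
  define E where "E n = {a. \<exists>z\<in>carrier G - F n. agrees a z (F n)}" for n
  have ne: "carrier G \<noteq> {}" using one_closed by blast
  have F: "finite (F n)" "F n \<subseteq> carrier G" for n
    using from_nat_into[OF ne] by (auto simp: F_def)
  have "E n \<in> clopens" for n
  proof -
    have *: "\<exists>z\<in>carrier G - F n. agrees b z (F n)"
      if "\<And>i. i \<in> F n \<times> T \<Longrightarrow> a i = b i" "\<exists>z\<in>carrier G - F n. agrees a z (F n)" for a b
      using that by (auto simp: agrees_def)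
    have fin: "finite (F n \<times> T)" using F T_finite by simp
    have "open (E n)" unfolding E_def by (rule open_cylinder[OF fin *])
    moreover have "closed (E n)" unfolding E_def by (rule closed_cylinder[OF fin *])
    ultimately show ?thesis by simp
  qed
  moreover have "fields = (\<Inter>n. E n)"
  proof
    show "fields \<subseteq> (\<Inter>n. E n)"
    proof (intro subsetI INT_I)
      fix a n assume "a \<in> fields"
      then show "a \<in> E n" using F[of n] unfolding fields_def E_def by simp
    qed
    show "(\<Inter>n. E n) \<subseteq> fields"
      unfolding fields_def
    proof (intro subsetI CollectI allI impI; elim conjE)
      fix a F' assume a: "a \<in> (\<Inter>n. E n)" and F': "finite F'" "F' \<subseteq> carrier G"
      define n where "n = Suc (Max (insert 0 (to_nat_on (carrier G) ` F')))"
      have "F' \<subseteq> F n"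
      proof
        fix g assume g: "g \<in> F'"
        then have "to_nat_on (carrier G) g \<le> Max (insert 0 (to_nat_on (carrier G) ` F'))"
          using F' by (intro Max_ge) auto
        then have "to_nat_on (carrier G) g < n" by (simp add: n_def)
        moreover have "from_nat_into (carrier G) (to_nat_on (carrier G) g) = g"
          using countable_carrier F' g by auto
        ultimately show "g \<in> F n" unfolding F_def by (metis image_eqI lessThan_iff)
      qed
      moreover obtain z where "z \<in> carrier G - F n" "agrees a z (F n)" using a by (auto simp: E_def)
      ultimately show "\<exists>z\<in>carrier G - F'. agrees a z F'" by (auto simp: agrees_def)
    qed
  qed
  ultimately show thesis by (rule that)
qed

lemma fields_measurable: "fields \<in> sigma_sets UNIV clopens"
proof -
  obtain E :: "nat \<Rightarrow> ('a \<times> 'a \<Rightarrow> bool) set" where E: "\<And>n. E n \<in> clopens" "fields = (\<Inter>n. E n)"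
    using fields_clopen_Inter by blast
  have "(\<Inter>n. E n) \<in> sigma_sets UNIV clopens"
    by (rule sigma_sets_Inter) (use E(1) in \<open>auto intro: sigma_sets.Basic\<close>)
  then show ?thesis by (simp add: E(2))
qed

text \<open>\<open>M\<close> extends the push-forward of the limit content under the orbit map y ->
  y a0. This map intertwines left translation with \<open>field_act\<close>, so
  \<open>content_bound\<close> for a function on the group that factors through the orbit becomes
  the stated inequality.\<close>

lemma field_measure_exists:
  assumes inf: "infinite (carrier G)" and dom: "affinity_dominated \<psi> C"
  obtains M where "space M = UNIV" "sets M = sigma_sets UNIV clopens" "finite_measure M"
    "emeasure M (- fields) = 0"
    "\<And>x c. \<lbrakk>x \<in> carrier G; clopen_simple c; \<And>a. 0 < c a\<rbrakk> \<Longrightarrow>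
      2 * \<psi> x \<le> (\<integral>a. c (field_act x a) \<partial>M) + (\<integral>a. 1 / c a \<partial>M)"
proof -
  obtain m where m: "\<And>A. 0 \<le> m A" "\<And>A B. A \<inter> B = {} \<Longrightarrow> m (A \<union> B) = m A + m B"
    "\<And>x \<epsilon>. \<lbrakk>x \<in> carrier G; 0 < \<epsilon>\<rbrakk> \<Longrightarrow> content_bound \<psi> x \<epsilon> m"
    using limit_content[OF dom] by blast
  obtain a0 where a0: "a0 \<in> fields" using fields_exist[OF inf] by blast
  have cpt: "compact (UNIV :: ('a \<times> 'a \<Rightarrow> bool) set)"
    by (rule compact_UNIV_fun) (simp add: finite_imp_compact)
  obtain M :: "('a \<times> 'a \<Rightarrow> bool) measure" where M: "space M = UNIV" "sets M = sigma_sets UNIV clopens"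
    "\<And>A. A \<in> clopens \<Longrightarrow> emeasure M A = ennreal (m {y\<in>carrier G. field_act y a0 \<in> A})"
  proof (rule clopen_content_extends[OF cpt, of "\<lambda>A. m {y\<in>carrier G. field_act y a0 \<in> A}"])
    show "m {y \<in> carrier G. field_act y a0 \<in> A \<union> B} =
       m {y \<in> carrier G. field_act y a0 \<in> A} + m {y \<in> carrier G. field_act y a0 \<in> B}"
      if "A \<inter> B = {}" for A B
    proof -
      have "m ({y \<in> carrier G. field_act y a0 \<in> A} \<union> {y \<in> carrier G. field_act y a0 \<in> B}) =
          m {y \<in> carrier G. field_act y a0 \<in> A} + m {y \<in> carrier G. field_act y a0 \<in> B}"
        using that by (intro m(2)) auto
      moreover have "{y \<in> carrier G. field_act y a0 \<in> A} \<union> {y \<in> carrier G. field_act y a0 \<in> B} =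
          {y \<in> carrier G. field_act y a0 \<in> A \<union> B}" by auto
      ultimately show ?thesis by simp
    qed
  qed (use m(1) in auto)
  have fin: "finite_measure M"
  proof
    show "emeasure M (space M) \<noteq> \<infinity>" unfolding M(1) by (subst M(3)) auto
  qed
  then interpret finite_measure M .
  have measure_eq: "measure M A = m {y\<in>carrier G. field_act y a0 \<in> A}" if "A \<in> clopens" for A
    using M(3)[OF that] m(1) by (simp add: measure_def)
  \<comment> \<open>The complement of \<open>fields\<close> is a countable union of clopen sets that
    the orbit never meets; each has content 0, and countable additivity of the extension
    finishes.\<close>
  have "emeasure M (- fields) = 0"
  proof -
    obtain E :: "nat \<Rightarrow> ('a \<times> 'a \<Rightarrow> bool) set" where E: "\<And>n. E n \<in> clopens" "fields = (\<Inter>n. E n)"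
      using fields_clopen_Inter by blast
    have E': "- E n \<in> clopens" for n using E(1)[of n] by auto
    have "emeasure M (- E n) = 0" for n
    proof -
      have "{y\<in>carrier G. field_act y a0 \<in> - E n} = {}"
        using field_act_fields[OF _ a0] E(2) by auto
      moreover have "m {} = 0" using m(2)[of "{}" "{}"] by simp
      ultimately show ?thesis using M(3)[OF E'[of n]] by (simp only: ennreal_0)
    qed
    then have "(\<Union>n. - E n) \<in> null_sets M"
      using E' M(2) by (intro null_sets_UN null_setsI) (auto intro: sigma_sets.Basic)
    moreover have "(\<Union>n. - E n) = - fields" by (auto simp: E(2))
    ultimately show ?thesis by auto
  qed
  moreover have "2 * \<psi> x \<le> (\<integral>a. c (field_act x a) \<partial>M) + (\<integral>a. 1 / c a \<partial>M)"
    if x: "x \<in> carrier G" and c: "clopen_simple c" "\<And>a. 0 < c a" for x c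
  proof -
    define R where "R = range c"
    have R: "finite R" "\<forall>r\<in>R. 0 < r" "\<And>a. c a \<in> R" using c by (auto simp: R_def clopen_simple_def)
    have lev: "{a. c a = r} \<in> clopens" "{a. c (field_act x a) = r} \<in> clopens" for r
      using clopen_simple_level[OF c(1), of r]
        clopen_simple_level[OF clopen_simple_compose[OF c(1) field_act_continuous[of x]], of r] by auto
    have 1: "(\<integral>a. c (field_act x a) \<partial>M) = (\<Sum>r\<in>R. r * m {y\<in>carrier G. c (field_act (x \<otimes> y) a0) = r})"
    proof -
      have "(\<integral>a. c (field_act x a) \<partial>M) = (\<Sum>r\<in>R. r * measure M {a\<in>space M. c (field_act x a) = r})"
        using lev by (intro integral_finite_range(2)[OF fin R(1), of "\<lambda>a. c (field_act x a)" "\<lambda>r. r"])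
          (auto simp: R M intro: sigma_sets.Basic)
      also have "\<dots> = (\<Sum>r\<in>R. r * m {y\<in>carrier G. c (field_act (x \<otimes> y) a0) = r})"
        using lev(2) x by (intro sum.cong refl) (simp add: M measure_eq field_act_mult cong: conj_cong)
      finally show ?thesis .
    qed
    have 2: "(\<integral>a. 1 / c a \<partial>M) = (\<Sum>r\<in>R. 1 / r * m {y\<in>carrier G. c (field_act y a0) = r})"
    proof -
      have "(\<integral>a. 1 / c a \<partial>M) = (\<Sum>r\<in>R. 1 / r * measure M {a\<in>space M. c a = r})"
        using lev by (intro integral_finite_range(2)[OF fin R(1), of c "\<lambda>r. 1 / r"])
          (auto simp: R M intro: sigma_sets.Basic)
      also have "\<dots> = (\<Sum>r\<in>R. 1 / r * m {y\<in>carrier G. c (field_act y a0) = r})"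
        using lev(1) by (intro sum.cong refl) (simp add: M measure_eq)
      finally show ?thesis .
    qed
    have "2 * \<psi> x \<le> (\<integral>a. c (field_act x a) \<partial>M) + (\<integral>a. 1 / c a \<partial>M) + e" if "0 < e" for e
    proof -
      \<comment> \<open>Half of \<open>e\<close> is taken because \<open>content_bound\<close>
        doubles its tolerance. It is applied to the values of \<open>c\<close> along the orbit of
        \<open>a0\<close>.\<close>
      have "content_bound \<psi> x (e / 2) m" using m(3) x that by simp
      then have "2 * (\<psi> x - e / 2) \<le> (\<Sum>r\<in>R. r * m {y\<in>carrier G. c (field_act (x \<otimes> y) a0) = r}) +
          (\<Sum>r\<in>R. 1 / r * m {y\<in>carrier G. c (field_act y a0) = r})"
        unfolding content_bound_def
        using R(1,2) by (elim allE[of _ "\<lambda>y. c (field_act y a0)"] allE[of _ R] impE) (auto simp: R_def)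
      then show ?thesis unfolding 1 2 by simp
    qed
    then show ?thesis by (rule field_le_epsilon)
  qed
  ultimately show thesis using that[OF M(1,2) fin] by blast
qed

text \<open>The inequality on \<open>M\<close> is extended from locally constant to bounded
  measurable \<open>g\<close> by approximating in L1 of \<open>N\<close>. Since \<open>N\<close>
  dominates both \<open>M\<close> and its translate by \<open>x\<close>, one approximant controls
  \<open>g\<close> and its translate at the same time.\<close>

lemma averaged_field_measure:
  assumes inf: "infinite (carrier G)" and dom: "affinity_dominated \<psi> C"
    and n1: "from_nat_into (carrier G) n1 = \<one>"
  obtains M N where "space M = UNIV" "sets M = sigma_sets UNIV clopens" "finite_measure M"
    "space N = UNIV" "sets N = sigma_sets UNIV clopens" "finite_measure N"
    "emeasure M (- fields) = 0"
    "\<forall>A\<in>sets M. emeasure N A = 0 \<longleftrightarrow> (\<forall>y\<in>carrier G. emeasure M (field_act y -` A) = 0)"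
    "\<forall>f :: _ \<Rightarrow> real. integrable N f \<and> (\<forall>a. 0 \<le> f a) \<longrightarrow>
      integrable M f \<and> (\<integral>a. f a \<partial>M) \<le> 2 ^ (n1 + 1) * (\<integral>a. f a \<partial>N)"
    "\<forall>x\<in>carrier G. \<forall>g\<in>borel_measurable M. \<forall>\<alpha> \<beta>. 0 < \<alpha> \<and> (\<forall>a. \<alpha> \<le> g a \<and> g a \<le> \<beta>) \<longrightarrow>
      2 * \<psi> x \<le> (\<integral>a. g (field_act x a) \<partial>M) + (\<integral>a. 1 / g a \<partial>M)"
proof -
  obtain M where M: "space M = UNIV" "sets M = sigma_sets UNIV clopens" "finite_measure M"
    "emeasure M (- fields) = 0"
    and simple: "\<And>x c. \<lbrakk>x \<in> carrier G; clopen_simple c; \<And>a. 0 < c a\<rbrakk> \<Longrightarrow>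
      2 * \<psi> x \<le> (\<integral>a. c (field_act x a) \<partial>M) + (\<integral>a. 1 / c a \<partial>M)"
    using field_measure_exists[OF inf dom] by blast
  interpret M: finite_measure M by fact
  define e where "e = from_nat_into (carrier G)"
  have e: "range e = carrier G"
    unfolding e_def using countable_carrier one_closed by (intro range_from_nat_into) auto
  have act: "field_act x \<in> M \<rightarrow>\<^sub>M M" for x using field_act_measurable[OF M(1,2)] .
  obtain N where N: "space N = space M" "sets N = sets M" "finite_measure N"
    "\<And>A. A \<in> sets M \<Longrightarrow> emeasure N A = 0 \<longleftrightarrow> (\<forall>n. emeasure M (field_act (e n) -` A \<inter> space M) = 0)"
    "\<And>n (f :: _ \<Rightarrow> real). \<lbrakk>integrable N f; \<And>a. 0 \<le> f a\<rbrakk> \<Longrightarrow>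
      integrable M (\<lambda>a. f (field_act (e n) a)) \<and> (\<integral>a. f (field_act (e n) a) \<partial>M) \<le> 2 ^ (n + 1) * (\<integral>a. f a \<partial>N)"
    by (rule average_measure[OF M(3), of "\<lambda>n. field_act (e n)", OF act]) (rule that; blast)
  have N': "space N = UNIV" "sets N = sigma_sets UNIV clopens" using N M by auto
  interpret N: finite_measure N by fact
  have e1: "field_act (e n1) a = a" for a using n1 field_act_one by (simp add: e_def)
  have domM: "integrable M f \<and> (\<integral>a. f a \<partial>M) \<le> 2 ^ (n1 + 1) * (\<integral>a. f a \<partial>N)"
    if "integrable N f" "\<And>a. 0 \<le> f a" for f :: "_ \<Rightarrow> real"
    using N(5)[of f n1] that unfolding e1 by blast
  have null: "emeasure N A = 0 \<longleftrightarrow> (\<forall>y\<in>carrier G. emeasure M (field_act y -` A) = 0)" if "A \<in> sets M" for A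
    using N(4)[OF that] unfolding e[symmetric] M(1) by simp
  have main: "2 * \<psi> x \<le> (\<integral>a. g (field_act x a) \<partial>M) + (\<integral>a. 1 / g a \<partial>M)"
    if x: "x \<in> carrier G" and g: "g \<in> borel_measurable M" and \<alpha>: "0 < \<alpha>" and gb: "\<And>a. \<alpha> \<le> g a \<and> g a \<le> \<beta>"
    for x g \<alpha> \<beta>
  proof -
    have "x \<in> range e" using x e by simp
    then obtain n where "x = e n" by (rule rangeE)
    then have n: "e n = x" ..
    have gN: "g \<in> borel_measurable N" using g N(2) by (metis measurable_cong_sets)
    have gx: "(\<lambda>a. g (field_act x a)) \<in> borel_measurable M" using measurable_compose[OF act g] .
    have \<alpha>\<beta>: "\<alpha> \<le> \<beta>" using gb order_trans by blast
    have bnd: "\<bar>g a\<bar> \<le> \<beta>" for a using gb[of a] \<alpha> by auto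
    have intgN: "integrable N g"
      by (rule N.integrable_const_bound[of _ \<beta>]) (use bnd gN in auto)
    have intgx: "integrable M (\<lambda>a. g (field_act x a))"
      by (rule M.integrable_const_bound[of _ \<beta>]) (use bnd gx in auto)
    have intig: "integrable M (\<lambda>a. 1 / g a)"
    proof (rule M.integrable_const_bound[of _ "1 / \<alpha>"])
      have "norm (1 / g a) \<le> 1 / \<alpha>" for a
        using gb[of a] \<alpha> by (simp add: frac_le)
      then show "AE a in M. norm (1 / g a) \<le> 1 / \<alpha>" by simp
    qed (use g in measurable)
    \<comment> \<open>The error of the translated term is at most 2^(n+1) \<open>\<eta>\<close> and
      that of the reciprocal term at most 2^(n1+1) \<open>\<eta>\<close> /
      \<open>\<alpha>\<close>^2; their sum is \<open>k * \<eta>\<close>.\<close>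
    define k where "k = 2 ^ (n + 1) + 2 ^ (n1 + 1) / \<alpha>\<^sup>2"
    have k: "0 < k" unfolding k_def using \<alpha> by (intro add_pos_nonneg) auto
    have "2 * \<psi> x \<le> (\<integral>a. g (field_act x a) \<partial>M) + (\<integral>a. 1 / g a \<partial>M) + \<epsilon>" if \<epsilon>: "0 < \<epsilon>" for \<epsilon>
    proof -
      define \<eta> where "\<eta> = \<epsilon> / k"
      have \<eta>: "0 < \<eta>" using \<epsilon> k by (simp add: \<eta>_def)
      obtain c where c: "clopen_simple c" "(\<integral>a. \<bar>g a - c a\<bar> \<partial>N) < \<eta>"
        using clopen_simple_dense[OF N(3) N' intgN] \<eta> by blast
      \<comment> \<open>Clipping to the interval that contains the values of \<open>g\<close> only
        brings the approximant closer to \<open>g\<close>, and it keeps the reciprocal bounded by 1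
        / \<open>\<alpha>\<close>.\<close>
      define c' where "c' a = max \<alpha> (min \<beta> (c a))" for a
      have c': "clopen_simple c'"
        unfolding c'_def by (rule clopen_simple_map[OF c(1)]) (intro continuous_intros)
      have cb: "\<alpha> \<le> c' a" "c' a \<le> \<beta>" for a using \<alpha>\<beta> by (auto simp: c'_def)
      have ci: "integrable N c" "integrable N c'" "integrable M c'"
        using clopen_simple_integrable c(1) c' N(3) N' M by blast+
      define D where "D a = \<bar>g a - c' a\<bar>" for a
      have D: "integrable N D" "\<And>a. 0 \<le> D a" unfolding D_def using intgN ci by auto
      have "(\<integral>a. D a \<partial>N) \<le> (\<integral>a. \<bar>g a - c a\<bar> \<partial>N)"
      proof (rule integral_mono)
        fix a show "D a \<le> \<bar>g a - c a\<bar>" using gb[of a] by (auto simp: D_def c'_def)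
      qed (use D intgN ci in auto)
      then have DN: "(\<integral>a. D a \<partial>N) \<le> \<eta>" using c(2) by simp
      have DNm: "2 ^ (j + 1) * (\<integral>a. D a \<partial>N) \<le> 2 ^ (j + 1) * \<eta>" for j :: nat
        using DN by (rule mult_left_mono) simp
      have Dx: "integrable M (\<lambda>a. D (field_act x a))" "(\<integral>a. D (field_act x a) \<partial>M) \<le> 2 ^ (n + 1) * \<eta>"
        using N(5)[OF D, of n, unfolded n] order_trans[OF _ DNm[of n]] by blast+
      have D1: "integrable M D" "(\<integral>a. D a \<partial>M) \<le> 2 ^ (n1 + 1) * \<eta>"
        using domM[OF D] order_trans[OF _ DNm[of n1]] by blast+
      have "2 * \<psi> x \<le> (\<integral>a. c' (field_act x a) \<partial>M) + (\<integral>a. 1 / c' a \<partial>M)"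
        using simple[OF x c'] cb \<alpha> by (metis less_le_trans)
      also have "(\<integral>a. c' (field_act x a) \<partial>M) \<le> (\<integral>a. g (field_act x a) + D (field_act x a) \<partial>M)"
      proof (rule integral_mono)
        show "integrable M (\<lambda>a. c' (field_act x a))"
          using clopen_simple_integrable[OF clopen_simple_compose[OF c' field_act_continuous] M(3,1,2)] .
      qed (use intgx Dx in \<open>auto simp: D_def\<close>)
      also have "\<dots> \<le> (\<integral>a. g (field_act x a) \<partial>M) + 2 ^ (n + 1) * \<eta>" using intgx Dx by simp
      also have "(\<integral>a. 1 / c' a \<partial>M) \<le> (\<integral>a. 1 / g a + D a / \<alpha>\<^sup>2 \<partial>M)"
      proof (rule integral_mono)
        show "integrable M (\<lambda>a. 1 / c' a)"
        proof (rule M.integrable_const_bound[of _ "1 / \<alpha>"])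
          have "norm (1 / c' a) \<le> 1 / \<alpha>" for a
            using cb(1)[of a] \<alpha> by (simp add: frac_le)
          then show "AE a in M. norm (1 / c' a) \<le> 1 / \<alpha>" by simp
        qed (use ci in measurable)
        fix a
        have p: "0 < g a" "0 < c' a" using gb[of a] cb(1)[of a] \<alpha> by linarith+
        have "1 / c' a - 1 / g a = (g a - c' a) / (c' a * g a)" using p by (simp add: field_simps)
        also have "\<dots> \<le> D a / (c' a * g a)" using p by (intro divide_right_mono) (auto simp: D_def)
        also have "\<dots> \<le> D a / \<alpha>\<^sup>2"
          using p gb[of a] cb(1)[of a] \<alpha> D(2)[of a]
          by (intro divide_left_mono) (auto simp: power2_eq_square intro!: mult_mono)
        finally show "1 / c' a \<le> 1 / g a + D a / \<alpha>\<^sup>2" by simp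
      qed (use intig D1 in auto)
      also have "\<dots> \<le> (\<integral>a. 1 / g a \<partial>M) + 2 ^ (n1 + 1) * \<eta> / \<alpha>\<^sup>2"
        using intig D1 \<alpha> by (simp add: divide_right_mono)
      finally have "2 * \<psi> x \<le> (\<integral>a. g (field_act x a) \<partial>M) + (\<integral>a. 1 / g a \<partial>M) + k * \<eta>"
        by (simp add: k_def algebra_simps)
      then show ?thesis using k by (simp add: \<eta>_def)
    qed
    then show ?thesis by (rule field_le_epsilon)
  qed
  show thesis
  proof (rule that[OF M(1-3) N' N(3) M(4)])
    show "\<forall>A\<in>sets M. emeasure N A = 0 \<longleftrightarrow> (\<forall>y\<in>carrier G. emeasure M (field_act y -` A) = 0)"
      using null by blast
    show "\<forall>f :: _ \<Rightarrow> real. integrable N f \<and> (\<forall>a. 0 \<le> f a) \<longrightarrow>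
        integrable M f \<and> (\<integral>a. f a \<partial>M) \<le> 2 ^ (n1 + 1) * (\<integral>a. f a \<partial>N)"
      using domM by simp
    show "\<forall>x\<in>carrier G. \<forall>g\<in>borel_measurable M. \<forall>\<alpha> \<beta>. 0 < \<alpha> \<and> (\<forall>a. \<alpha> \<le> g a \<and> g a \<le> \<beta>) \<longrightarrow>
        2 * \<psi> x \<le> (\<integral>a. g (field_act x a) \<partial>M) + (\<integral>a. 1 / g a \<partial>M)"
    proof (intro ballI allI impI; elim conjE)
      fix x \<alpha> \<beta> and g :: "_ \<Rightarrow> real" assume "x \<in> carrier G" "g \<in> borel_measurable M" "0 < \<alpha>" "\<forall>a. \<alpha> \<le> g a \<and> g a \<le> \<beta>"
      then show "2 * \<psi> x \<le> (\<integral>a. g (field_act x a) \<partial>M) + (\<integral>a. 1 / g a \<partial>M)"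
        by (intro main[of x g \<alpha> \<beta>]) simp_all
    qed
  qed
qed

end

section \<open>Quasi-invariant measures on the boundary\<close>

context hyp_fg_group
begin

text \<open>Measurability needs a countable union. By \<open>endpoint_near\<close>, every field
  mapped into \<open>U\<close> has a step \<open>k\<close> such that all fields with the same
  \<open>k\<close>-th vertex are mapped into \<open>U\<close>, and there are only countably many
  pairs of a step and a vertex.\<close>

lemma endpoint_preimage_measurable:
  assumes U: "openin (boundary_topology G S) U"
  shows "{a\<in>fields. endpoint a \<in> U} \<in> sigma_sets UNIV clopens"
proof -
  define W where "W k w = {a. walk a \<one> k = w}" for k w
  define Good where "Good = {(k, w). w \<in> carrier G \<and> (\<forall>a\<in>fields. walk a \<one> k = w \<longrightarrow> endpoint a \<in> U)}"
  have "Good \<subseteq> UNIV \<times> carrier G" by (auto simp: Good_def)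
  then have cnt: "countable Good"
    using countable_subset[OF _ countable_SIGMA[OF _ countable_carrier]] by blast
  have "{a\<in>fields. endpoint a \<in> U} = fields \<inter> (\<Union>(k, w)\<in>Good. W k w)"
  proof
    show "fields \<inter> (\<Union>(k, w)\<in>Good. W k w) \<subseteq> {a\<in>fields. endpoint a \<in> U}"
      by (auto simp: Good_def W_def)
    show "{a\<in>fields. endpoint a \<in> U} \<subseteq> fields \<inter> (\<Union>(k, w)\<in>Good. W k w)"
    proof
      fix a assume "a \<in> {a\<in>fields. endpoint a \<in> U}"
      then have a: "a \<in> fields" "endpoint a \<in> U" by auto
      obtain r where r: "bd_ball G S (endpoint a) r \<subseteq> U"
        using U a(2) unfolding boundary_openin by blast
      define k where "k = nat \<lceil>r + 2 * \<delta> + 1\<rceil>"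
      have k: "r \<le> real k - 2 * \<delta> - 1" unfolding k_def by linarith
      have "endpoint b \<in> U" if b: "b \<in> fields" "walk b \<one> k = walk a \<one> k" for b
        using endpoint_near[OF a(1) b(1) b(2)[symmetric]] bd_ball_mono[OF k] r by blast
      then have "(k, walk a \<one> k) \<in> Good"
        using walk_closed[OF a(1) one_closed] by (simp add: Good_def)
      moreover have "a \<in> W k (walk a \<one> k)" by (simp add: W_def)
      ultimately show "a \<in> fields \<inter> (\<Union>(k, w)\<in>Good. W k w)" using a(1) by blast
    qed
  qed
  moreover have "fields \<inter> (\<Union>(k, w)\<in>Good. W k w) \<in> sigma_sets UNIV clopens"
  proof -
    interpret sigma_algebra UNIV "sigma_sets UNIV (clopens :: ('a \<times> 'a \<Rightarrow> bool) set set)"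
      by (rule sigma_algebra_sigma_sets) simp
    have "W k w \<in> sigma_sets UNIV clopens" for k w
      unfolding W_def using clopen_walk[of "\<lambda>x. x = w"] by (rule sigma_sets.Basic)
    then show ?thesis using cnt fields_measurable by (intro Int countable_UN'') auto
  qed
  ultimately show ?thesis by simp
qed

text \<open>\<open>\<mu>\<close> is the image of \<open>N\<close> under the endpoint map. Its null
  sets are those whose translates are all null for the image of \<open>M\<close>, a condition
  invariant under the group. The affinity bound holds because both integrals of positive functions
  over \<open>M\<close> grow at most by the factor 2^(n1+1) when \<open>M\<close> is replaced by
  \<open>N\<close>.\<close>

lemma boundary_measure_exists:
  assumes inf: "infinite (carrier G)" and dom: "affinity_dominated \<psi> C"
    and n1: "from_nat_into (carrier G) n1 = \<one>"
  shows "\<exists>\<mu>. space \<mu> = gromov_boundary G S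
          \<and> sets \<mu> = sets (borel_of (boundary_topology G S))
          \<and> finite_measure \<mu>
          \<and> quasi_invariant G (bd_act G) \<mu>
          \<and> (\<forall>x\<in>carrier G. \<psi> x \<le> 2 ^ (n1 + 1) * (\<integral>\<omega>. sqrt (RN_cocycle (bd_act G) \<mu> x \<omega>) \<partial>\<mu>))"
proof -
  obtain M N where M: "space M = UNIV" "sets M = sigma_sets UNIV clopens" "finite_measure M"
    and N: "space N = UNIV" "sets N = sigma_sets UNIV clopens" "finite_measure N"
    and Mf: "emeasure M (- fields) = 0"
    and null': "\<forall>A\<in>sets M. emeasure N A = 0 \<longleftrightarrow> (\<forall>y\<in>carrier G. emeasure M (field_act y -` A) = 0)"
    and dom': "\<forall>f :: _ \<Rightarrow> real. integrable N f \<and> (\<forall>a. 0 \<le> f a) \<longrightarrow>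
      integrable M f \<and> (\<integral>a. f a \<partial>M) \<le> 2 ^ (n1 + 1) * (\<integral>a. f a \<partial>N)"
    and bound': "\<forall>x\<in>carrier G. \<forall>g\<in>borel_measurable M. \<forall>\<alpha> \<beta>. 0 < \<alpha> \<and> (\<forall>a. \<alpha> \<le> g a \<and> g a \<le> \<beta>) \<longrightarrow>
      2 * \<psi> x \<le> (\<integral>a. g (field_act x a) \<partial>M) + (\<integral>a. 1 / g a \<partial>M)"
    by (rule averaged_field_measure[OF inf dom n1]) (rule that)
  note null = null'[rule_format]
  have dom: "integrable M f \<and> (\<integral>a. f a \<partial>M) \<le> 2 ^ (n1 + 1) * (\<integral>a. f a \<partial>N)"
    if "integrable N f" "\<And>a. 0 \<le> f a" for f :: "_ \<Rightarrow> real"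
    using dom' that by simp
  interpret M: finite_measure M by fact
  interpret N: finite_measure N by fact
  have MN: "sets M = sets N" using M N by simp
  define bd where "bd = borel_of (boundary_topology G S)"
  have bd: "space bd = gromov_boundary G S"
    "sets bd = sigma_sets (gromov_boundary G S) {U. openin (boundary_topology G S) U}"
    by (simp_all add: bd_def space_borel_of sets_borel_of topspace_boundary)
  obtain a0 where a0: "a0 \<in> fields" using fields_exist[OF inf] by blast
  \<comment> \<open>Off \<open>fields\<close> the value is a fixed boundary point, so that
    \<open>p\<close> is a total measurable map; that set is null for \<open>M\<close> and for
    \<open>N\<close>.\<close>
  define p where "p a = (if a \<in> fields then endpoint a else endpoint a0)" for a
  have p_bd: "p a \<in> gromov_boundary G S" for a using a0 endpoint_boundary by (simp add: p_def)
  have fm: "fields \<in> sets M" "- fields \<in> sets M"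
    using fields_measurable sigma_sets.Compl[OF fields_measurable] by (simp_all add: M(2) Compl_eq_Diff_UNIV)
  have pM: "p \<in> M \<rightarrow>\<^sub>M bd"
  proof (rule measurable_sigma_sets[OF bd(2)])
    show "{U. openin (boundary_topology G S) U} \<subseteq> Pow (gromov_boundary G S)"
      by (auto simp: boundary_openin)
    show "p \<in> space M \<rightarrow> gromov_boundary G S" using p_bd by simp
    fix U assume "U \<in> {U. openin (boundary_topology G S) U}"
    then have "{a\<in>fields. endpoint a \<in> U} \<in> sets M"
      using endpoint_preimage_measurable by (simp add: M(2))
    moreover have "p -` U \<inter> space M = {a\<in>fields. endpoint a \<in> U} \<union> (if endpoint a0 \<in> U then - fields else {})"
      by (intro Set.set_eqI) (simp add: p_def M(1))
    ultimately show "p -` U \<inter> space M \<in> sets M" using fm by simp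
  qed
  then have pN: "p \<in> N \<rightarrow>\<^sub>M bd" by (subst measurable_cong_sets[OF MN[symmetric] refl])
  have act: "field_act x \<in> M \<rightarrow>\<^sub>M M" for x using field_act_measurable[OF M(1,2)] .
  have bact: "bd_act G x \<in> bd \<rightarrow>\<^sub>M bd" if "x \<in> carrier G" for x
    unfolding bd_def using bd_act_measurable[OF that] .
  have equiv: "p (field_act x a) = bd_act G x (p a)" if "x \<in> carrier G" "a \<in> fields" for x a
    using that field_act_fields[OF that] endpoint_act[OF that] by (simp add: p_def)
  have inv: "field_act x a \<in> fields \<longleftrightarrow> a \<in> fields" if x: "x \<in> carrier G" for x a
  proof
    assume "field_act x a \<in> fields"
    then have "field_act (inv x) (field_act x a) \<in> fields" by (rule field_act_fields[OF inv_closed[OF x]])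
    then show "a \<in> fields" using x by (simp add: field_act_mult field_act_one)
  qed (rule field_act_fields[OF x])
  have Nf: "emeasure N (- fields) = 0"
  proof -
    have "field_act y -` (- fields) = - fields" if "y \<in> carrier G" for y using inv[OF that] by auto
    then show ?thesis using null[OF fm(2)] Mf by simp
  qed
  have AEN: "AE a in N. a \<in> fields"
    by (rule AE_I[of _ _ "- fields"]) (use Nf fm(2) MN in auto)
  define \<mu> where "\<mu> = distr N bd p"
  have \<mu>: "space \<mu> = gromov_boundary G S" "sets \<mu> = sets bd" by (simp_all add: \<mu>_def bd)
  have fin\<mu>: "finite_measure \<mu>" unfolding \<mu>_def by (rule N.finite_measure_distr[OF pN])
  interpret mu: finite_measure \<mu> by fact
  have bact\<mu>: "bd_act G x \<in> \<mu> \<rightarrow>\<^sub>M \<mu>" if "x \<in> carrier G" for x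
    using bact[OF that] by (subst measurable_cong_sets[OF \<mu>(2) \<mu>(2)])
  \<comment> \<open>Up to a null set this is the preimage of \<open>A\<close> under \<open>p\<close>
    composed with \<open>field_act y\<close>, expressed through the action on the boundary.\<close>
  define Z where "Z A y = {a\<in>fields. bd_act G y (p a) \<in> A}" for A y
  have zero: "emeasure \<mu> A = 0 \<longleftrightarrow> (\<forall>y\<in>carrier G. emeasure M (Z A y) = 0)" if A: "A \<in> sets bd" for A
  proof -
    have pA: "p -` A \<in> sets M" using measurable_sets[OF pM A] by (simp add: M(1))
    have "emeasure M (field_act y -` (p -` A)) = emeasure M (Z A y)" if y: "y \<in> carrier G" for y
    proof -
      have S: "field_act y -` (p -` A) \<in> sets M" using measurable_sets[OF act pA] by (simp add: M(1))
      have "Z A y = field_act y -` (p -` A) - (- fields)"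
        using equiv[OF y] by (auto simp: Z_def)
      moreover have nf: "- fields \<in> null_sets M" using fm Mf by auto
      ultimately show ?thesis using emeasure_Diff_null_set[OF nf S] by (simp only:)
    qed
    then have "(\<forall>y\<in>carrier G. emeasure M (Z A y) = 0) \<longleftrightarrow> emeasure N (p -` A) = 0"
      using null[OF pA] by simp
    moreover have "emeasure \<mu> A = emeasure N (p -` A)"
      unfolding \<mu>_def using emeasure_distr[OF pN A] by (simp add: N(1))
    ultimately show ?thesis by simp
  qed
  have nullsets: "null_sets (distr \<mu> \<mu> (bd_act G x)) = null_sets \<mu>" if x: "x \<in> carrier G" for x
  proof (rule Set.set_eqI)
    fix A
    have "emeasure (distr \<mu> \<mu> (bd_act G x)) A = 0 \<longleftrightarrow> emeasure \<mu> A = 0" if A: "A \<in> sets \<mu>"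
    proof -
      have A': "A \<in> sets bd" using A \<mu>(2) by simp
      define B where "B = bd_act G x -` A \<inter> space \<mu>"
      have B: "B \<in> sets bd" using measurable_sets[OF bact\<mu>[OF x] A] by (simp add: B_def \<mu>(2))
      \<comment> \<open>Passing to the preimage under \<open>x\<close> shifts the index from
        \<open>y\<close> to \<open>x \<otimes> y\<close>; this permutes the group, so the condition
        for all indices is unchanged.\<close>
      have ZB: "Z B y = Z A (x \<otimes> y)" if "y \<in> carrier G" for y
        using bd_act_mult[OF x that p_bd] bd_act_boundary[OF that p_bd] by (auto simp: Z_def B_def \<mu>(1))
      have "emeasure (distr \<mu> \<mu> (bd_act G x)) A = emeasure \<mu> B"
        unfolding B_def by (rule emeasure_distr[OF bact\<mu>[OF x] A])
      then have "emeasure (distr \<mu> \<mu> (bd_act G x)) A = 0 \<longleftrightarrow> (\<forall>y\<in>carrier G. emeasure M (Z A (x \<otimes> y)) = 0)"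
        using zero[OF B] ZB by simp
      also have "\<dots> \<longleftrightarrow> (\<forall>y\<in>carrier G. emeasure M (Z A y) = 0)"
      proof
        assume *: "\<forall>y\<in>carrier G. emeasure M (Z A (x \<otimes> y)) = 0"
        show "\<forall>y\<in>carrier G. emeasure M (Z A y) = 0"
        proof
          fix y assume y: "y \<in> carrier G"
          then show "emeasure M (Z A y) = 0"
            using bspec[OF *, of "inv x \<otimes> y"] x by simp
        qed
      qed (use x in simp)
      finally show ?thesis using zero[OF A'] by simp
    qed
    then show "A \<in> null_sets (distr \<mu> \<mu> (bd_act G x)) \<longleftrightarrow> A \<in> null_sets \<mu>"
      by (auto simp: null_sets_def)
  qed
  have "\<psi> x \<le> 2 ^ (n1 + 1) * (\<integral>\<omega>. sqrt (RN_cocycle (bd_act G) \<mu> x \<omega>) \<partial>\<mu>)" if x: "x \<in> carrier G" for x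
  proof -
    define \<kappa> :: real where "\<kappa> = 2 ^ (n1 + 1)"
    have \<kappa>: "0 < \<kappa>" by (simp add: \<kappa>_def)
    have "2 * \<psi> x / \<kappa> \<le> 2 * (\<integral>\<omega>. sqrt (enn2real (RN_deriv \<mu> (distr \<mu> \<mu> (bd_act G x)) \<omega>)) \<partial>\<mu>)"
    proof (rule hellinger_lower_bound[OF fin\<mu> bact\<mu>[OF x] nullsets[OF x]])
      fix g :: "_ \<Rightarrow> real" and \<alpha> \<beta>
      assume g: "g \<in> borel_measurable \<mu>" and \<alpha>: "0 < \<alpha>" and gb: "\<And>\<omega>. \<alpha> \<le> g \<omega> \<and> g \<omega> \<le> \<beta>"
      have gbd: "g \<in> borel_measurable bd" using g by (subst measurable_cong_sets[OF \<mu>(2)[symmetric] refl])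
      have gpM: "(\<lambda>a. g (p a)) \<in> borel_measurable M" using measurable_compose[OF pM gbd] .
      have gpN: "(\<lambda>a. g (p a)) \<in> borel_measurable N" using measurable_compose[OF pN gbd] .
      have pos: "0 < g \<omega>" for \<omega> using gb[of \<omega>] \<alpha> by linarith
      have le\<beta>: "\<bar>g \<omega>\<bar> \<le> \<beta>" "norm (1 / g \<omega>) \<le> 1 / \<alpha>" for \<omega>
        using gb[of \<omega>] \<alpha> by (auto simp: frac_le)
      have actN: "field_act x \<in> N \<rightarrow>\<^sub>M M" using act[of x] by (subst measurable_cong_sets[OF MN[symmetric] refl])
      have i1: "integrable N (\<lambda>a. g (p (field_act x a)))"
        by (rule N.integrable_const_bound[of _ \<beta>]) (use le\<beta> measurable_compose[OF actN gpM] in auto)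
      have i2: "integrable N (\<lambda>a. 1 / g (p a))"
        by (rule N.integrable_const_bound[of _ "1 / \<alpha>"]) (use le\<beta> gpN in auto)
      have "2 * \<psi> x \<le> (\<integral>a. g (p (field_act x a)) \<partial>M) + (\<integral>a. 1 / g (p a) \<partial>M)"
        using bound'[rule_format, OF x gpM] \<alpha> gb by blast
      also have "(\<integral>a. g (p (field_act x a)) \<partial>M) \<le> \<kappa> * (\<integral>a. g (p (field_act x a)) \<partial>N)"
        using dom[OF i1] pos less_imp_le unfolding \<kappa>_def by blast
      \<comment> \<open>The map \<open>p\<close> is equivariant only on \<open>fields\<close>, so
        the integrands agree almost everywhere but not necessarily everywhere.\<close>
      also have "(\<integral>a. g (p (field_act x a)) \<partial>N) = (\<integral>a. g (bd_act G x (p a)) \<partial>N)"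
      proof (rule integral_cong_AE)
        show "AE a in N. g (p (field_act x a)) = g (bd_act G x (p a))"
          using AEN by eventually_elim (simp add: equiv[OF x])
        show "(\<lambda>a. g (bd_act G x (p a))) \<in> borel_measurable N"
          using measurable_compose[OF measurable_compose[OF pN bact[OF x]] gbd] .
      qed (use i1 in auto)
      also have "\<dots> = (\<integral>\<omega>. g (bd_act G x \<omega>) \<partial>\<mu>)"
        unfolding \<mu>_def using integral_distr[OF pN measurable_compose[OF bact[OF x] gbd]] by simp
      also have "(\<integral>a. 1 / g (p a) \<partial>M) \<le> \<kappa> * (\<integral>a. 1 / g (p a) \<partial>N)"
        using dom[OF i2] pos unfolding \<kappa>_def by (simp add: less_imp_le)
      also have "(\<integral>a. 1 / g (p a) \<partial>N) = (\<integral>\<omega>. 1 / g \<omega> \<partial>\<mu>)"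
        unfolding \<mu>_def using gbd by (intro integral_distr[OF pN, symmetric]) measurable
      finally have "2 * \<psi> x \<le> \<kappa> * ((\<integral>\<omega>. g (bd_act G x \<omega>) \<partial>\<mu>) + (\<integral>\<omega>. 1 / g \<omega> \<partial>\<mu>))"
        by (simp add: algebra_simps)
      then show "2 * \<psi> x / \<kappa> \<le> (\<integral>\<omega>. g (bd_act G x \<omega>) \<partial>\<mu>) + (\<integral>\<omega>. 1 / g \<omega> \<partial>\<mu>)"
        using \<kappa> by (simp add: pos_divide_le_eq mult.commute)
    qed
    then show ?thesis using \<kappa> unfolding \<kappa>_def[symmetric] RN_cocycle_def by (simp add: pos_divide_le_eq mult.commute)
  qed
  then show ?thesis
    using \<mu> fin\<mu> bact\<mu> nullsets unfolding bd_def
    by (intro exI[of _ \<mu>]) (simp add: quasi_invariant_def)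
qed

end

section \<open>Coefficients of tempered representations\<close>

lemma has_sum_finite_sum:
  fixes h :: "'i \<Rightarrow> 'a \<Rightarrow> real"
  assumes "finite I" "\<And>i. i \<in> I \<Longrightarrow> h i summable_on A"
  shows "((\<lambda>y. \<Sum>i\<in>I. h i y) has_sum (\<Sum>i\<in>I. infsum (h i) A)) A"
  using assms
proof (induction I)
  case (insert i I)
  then show ?case
    using has_sum_add[OF has_sum_infsum[of "h i" A], of "\<lambda>y. \<Sum>i\<in>I. h i y"] by simp
qed simp

context group
begin

text \<open>Through this value at the identity, the approximation of a coefficient also controls the
  total mass of the weights.\<close>

lemma reg_coeff_one:
  assumes "ell2 G f"
  shows "reg_coeff G f \<one> = complex_of_real (infsum (\<lambda>y. (cmod (f y))\<^sup>2) (carrier G))"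
proof -
  have "((\<lambda>y. complex_of_real ((cmod (f y))\<^sup>2)) has_sum
      complex_of_real (infsum (\<lambda>y. (cmod (f y))\<^sup>2) (carrier G))) (carrier G)"
    using assms unfolding ell2_def by (intro has_sum_of_real has_sum_infsum)
  moreover have "reg_coeff G f \<one> = infsum (\<lambda>y. complex_of_real ((cmod (f y))\<^sup>2)) (carrier G)"
    unfolding reg_coeff_def by (intro infsum_cong) (simp only: inv_one l_one complex_norm_square)
  ultimately show ?thesis by (simp add: infsumI)
qed

lemma reg_coeff_bound:
  assumes f: "ell2 G f" and x: "x \<in> carrier G"
  shows "(\<lambda>y. cmod (f (inv x \<otimes> y)) * cmod (f y)) summable_on carrier G"
    and "cmod (reg_coeff G f x) \<le> infsum (\<lambda>y. cmod (f (inv x \<otimes> y)) * cmod (f y)) (carrier G)"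
proof -
  have s: "(\<lambda>y. (cmod (f y))\<^sup>2) summable_on carrier G" using f by (simp add: ell2_def)
  have "(\<lambda>y. (cmod (f (inv x \<otimes> y)))\<^sup>2) summable_on carrier G"
    using summable_on_reindex_bij_betw[OF bij_betw_translate[of "inv x"], of "\<lambda>y. (cmod (f y))\<^sup>2"] s x by simp
  then have s2: "(\<lambda>y. (cmod (f (inv x \<otimes> y)))\<^sup>2 + (cmod (f y))\<^sup>2) summable_on carrier G"
    using s by (rule summable_on_add)
  have "(\<lambda>y. norm (f (inv x \<otimes> y) * cnj (f y))) summable_on carrier G"
  proof (rule Infinite_Sum.abs_summable_on_comparison_test)
    show "(\<lambda>y. norm ((cmod (f (inv x \<otimes> y)))\<^sup>2 + (cmod (f y))\<^sup>2)) summable_on carrier G"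
      by (rule summable_on_iff_abs_summable_on_real[THEN iffD1, OF s2])
    fix y
    have "2 * cmod (f (inv x \<otimes> y)) * cmod (f y) \<le> (cmod (f (inv x \<otimes> y)))\<^sup>2 + (cmod (f y))\<^sup>2"
      by (rule sum_squares_bound)
    moreover have "0 \<le> cmod (f (inv x \<otimes> y)) * cmod (f y)" by simp
    ultimately have "cmod (f (inv x \<otimes> y)) * cmod (f y) \<le> (cmod (f (inv x \<otimes> y)))\<^sup>2 + (cmod (f y))\<^sup>2" by linarith
    then show "norm (f (inv x \<otimes> y) * cnj (f y)) \<le> norm ((cmod (f (inv x \<otimes> y)))\<^sup>2 + (cmod (f y))\<^sup>2)"
      by (simp add: norm_mult)
  qed
  then show "(\<lambda>y. cmod (f (inv x \<otimes> y)) * cmod (f y)) summable_on carrier G"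
    and "cmod (reg_coeff G f x) \<le> infsum (\<lambda>y. cmod (f (inv x \<otimes> y)) * cmod (f y)) (carrier G)"
    using norm_infsum_bound[of "\<lambda>y. f (inv x \<otimes> y) * cnj (f y)" "carrier G"]
    by (simp_all add: norm_mult reg_coeff_def)
qed

text \<open>The weight is \<open>k\<close> times the sum of the squared moduli of the approximating
  functions. Cauchy-Schwarz over these functions, for fixed \<open>y\<close>, bounds the sum of
  their products by the geometric mean of the weight and its translate.\<close>

lemma tempered_affinity_dominated:
  fixes \<pi> :: "'a \<Rightarrow> 'h::complex_hilbert \<Rightarrow> 'h"
  assumes rep: "unitary_rep G \<pi>" and temp: "tempered G \<pi>" and k: "0 < k"
  shows "affinity_dominated (\<lambda>x. k * cmod (cinner (\<pi> x v) v)) (k * ((norm v)\<^sup>2 + 1))"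
  unfolding affinity_dominated_def
proof (intro allI impI; elim conjE)
  fix K and \<epsilon> :: real
  assume K: "finite K" "K \<subseteq> carrier G" and \<epsilon>: "0 < \<epsilon>"
  define \<phi> where "\<phi> x = cinner (\<pi> x v) v" for x
  \<comment> \<open>The term \<epsilon>/k yields the tolerance after multiplication by
    \<open>k\<close>; the term 1 yields the summand 1 in the mass bound.\<close>
  define \<eta> where "\<eta> = min (\<epsilon> / k) 1"
  have \<eta>: "0 < \<eta>" "\<eta> \<le> 1" "k * \<eta> \<le> \<epsilon>"
    using \<epsilon> k by (auto simp: \<eta>_def min_def field_simps)
  \<comment> \<open>The identity is added to \<open>K\<close> because the value there bounds the
    total mass by the squared norm of \<open>v\<close> plus 1, uniformly in \<open>K\<close> and
    \<open>\<epsilon>\<close>.\<close>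
  obtain fs where fs: "\<forall>f\<in>set fs. ell2 G f"
    "\<forall>x\<in>insert \<one> K. cmod (\<phi> x - (\<Sum>f\<leftarrow>fs. reg_coeff G f x)) < \<eta>"
    using temp[unfolded tempered_def, rule_format, of "insert \<one> K" \<eta> v] K \<eta> unfolding \<phi>_def by auto
  define n where "n = length fs"
  define F where "F i = fs ! i" for i
  have F: "ell2 G (F i)" if "i < n" for i using fs(1) that by (simp add: F_def n_def)
  have sum: "(\<Sum>f\<leftarrow>fs. h f) = (\<Sum>i<n. h (F i))" for h :: "_ \<Rightarrow> complex"
    by (simp add: sum_list_sum_nth F_def n_def atLeast0LessThan)
  define w where "w y = k * (\<Sum>i<n. (cmod (F i y))\<^sup>2)" for y
  have w0: "0 \<le> w y" for y using k by (simp add: w_def sum_nonneg)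
  have hs: "((\<lambda>y. \<Sum>i<n. (cmod (F i y))\<^sup>2) has_sum (\<Sum>i<n. infsum (\<lambda>y. (cmod (F i y))\<^sup>2) (carrier G))) (carrier G)"
    using F by (intro has_sum_finite_sum) (auto simp: ell2_def)
  have hw: "(w has_sum k * (\<Sum>i<n. infsum (\<lambda>y. (cmod (F i y))\<^sup>2) (carrier G))) (carrier G)"
    unfolding w_def using has_sum_cmult_right[OF hs] .
  have ws: "w summable_on carrier G" using hw by (auto simp: summable_on_def)
  have "infsum w (carrier G) \<le> k * ((norm v)\<^sup>2 + 1)"
  proof -
    have "\<phi> \<one> = complex_of_real ((norm v)\<^sup>2)"
      using rep by (simp add: \<phi>_def unitary_rep_def cinner_self_norm)
    moreover have "(\<Sum>f\<leftarrow>fs. reg_coeff G f \<one>) =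
        complex_of_real (\<Sum>i<n. infsum (\<lambda>y. (cmod (F i y))\<^sup>2) (carrier G))"
      unfolding sum using F reg_coeff_one by simp
    ultimately have "cmod (complex_of_real ((norm v)\<^sup>2 - (\<Sum>i<n. infsum (\<lambda>y. (cmod (F i y))\<^sup>2) (carrier G)))) < \<eta>"
      using fs(2) by simp
    then have "\<bar>(norm v)\<^sup>2 - (\<Sum>i<n. infsum (\<lambda>y. (cmod (F i y))\<^sup>2) (carrier G))\<bar> < \<eta>"
      unfolding norm_of_real .
    then have "(\<Sum>i<n. infsum (\<lambda>y. (cmod (F i y))\<^sup>2) (carrier G)) \<le> (norm v)\<^sup>2 + 1" using \<eta>(2) by linarith
    then show ?thesis unfolding infsumI[OF hw] using k by (intro mult_left_mono) auto
  qed
  moreover have "k * cmod (\<phi> x) - \<epsilon> \<le> infsum (\<lambda>y. sqrt (w (inv x \<otimes> y) * w y)) (carrier G)" if x: "x \<in> K" for x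
  proof -
    have xG: "x \<in> carrier G" using x K by blast
    define h where "h i y = cmod (F i (inv x \<otimes> y)) * cmod (F i y)" for i y
    have hss: "h i summable_on carrier G" if "i < n" for i
      unfolding h_def using reg_coeff_bound(1)[OF F[OF that] xG] .
    have hsum: "((\<lambda>y. \<Sum>i<n. h i y) has_sum (\<Sum>i<n. infsum (h i) (carrier G))) (carrier G)"
      using hss by (intro has_sum_finite_sum) auto
    have hk: "((\<lambda>y. k * (\<Sum>i<n. h i y)) has_sum (k * (\<Sum>i<n. infsum (h i) (carrier G)))) (carrier G)"
      by (rule has_sum_cmult_right[OF hsum])
    have le: "k * (\<Sum>i<n. h i y) \<le> sqrt (w (inv x \<otimes> y) * w y)" for y
    proof -
      have "(\<Sum>i<n. h i y) \<le> L2_set (\<lambda>i. cmod (F i (inv x \<otimes> y))) {..<n} * L2_set (\<lambda>i. cmod (F i y)) {..<n}"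
        using L2_set_mult_ineq[of "\<lambda>i. cmod (F i (inv x \<otimes> y))" "\<lambda>i. cmod (F i y)" "{..<n}"] by (simp add: h_def)
      then have "k * (\<Sum>i<n. h i y) \<le> k * (L2_set (\<lambda>i. cmod (F i (inv x \<otimes> y))) {..<n} * L2_set (\<lambda>i. cmod (F i y)) {..<n})"
        using k by (intro mult_left_mono) auto
      also have "\<dots> = sqrt (w (inv x \<otimes> y) * w y)"
        using k by (simp add: w_def L2_set_def real_sqrt_mult)
      finally show ?thesis .
    qed
    have sqs: "(\<lambda>y. sqrt (w (inv x \<otimes> y) * w y)) summable_on carrier G"
    proof -
      have w's: "(\<lambda>y. w (inv x \<otimes> y)) summable_on carrier G"
        using summable_on_reindex_bij_betw[OF bij_betw_translate[of "inv x"], of w] ws xG by simp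
      have "(\<lambda>y. norm (sqrt (w (inv x \<otimes> y) * w y))) summable_on carrier G"
      proof (rule Infinite_Sum.abs_summable_on_comparison_test)
        show "(\<lambda>y. norm (w (inv x \<otimes> y) + w y)) summable_on carrier G"
          by (rule summable_on_iff_abs_summable_on_real[THEN iffD1, OF summable_on_add[OF w's ws]])
        show "norm (sqrt (w (inv x \<otimes> y) * w y)) \<le> norm (w (inv x \<otimes> y) + w y)" for y
          using arith_geo_mean_sqrt[OF w0[of "inv x \<otimes> y"] w0[of y]] w0[of "inv x \<otimes> y"] w0[of y] by simp
      qed
      then show ?thesis by (rule summable_on_iff_abs_summable_on_real[THEN iffD2])
    qed
    have "cmod (\<phi> x) \<le> \<eta> + cmod (\<Sum>i<n. reg_coeff G (F i) x)"
      using fs(2) x norm_triangle_sub[of "\<phi> x" "\<Sum>i<n. reg_coeff G (F i) x"] unfolding sum by fastforce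
    also have "cmod (\<Sum>i<n. reg_coeff G (F i) x) \<le> (\<Sum>i<n. infsum (h i) (carrier G))"
      unfolding h_def using reg_coeff_bound(2)[OF F xG] by (intro sum_norm_le) auto
    finally have "k * cmod (\<phi> x) \<le> k * (\<eta> + (\<Sum>i<n. infsum (h i) (carrier G)))"
      using k by (intro mult_left_mono) auto
    also have "\<dots> \<le> \<epsilon> + infsum (\<lambda>y. k * (\<Sum>i<n. h i y)) (carrier G)"
      using \<eta>(3) unfolding infsumI[OF hk] by (simp add: distrib_left)
    also have "infsum (\<lambda>y. k * (\<Sum>i<n. h i y)) (carrier G) \<le> infsum (\<lambda>y. sqrt (w (inv x \<otimes> y) * w y)) (carrier G)"
      using hk sqs le by (intro infsum_mono) (auto simp: summable_on_def)
    finally show ?thesis by simp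
  qed
  ultimately show "\<exists>w. (\<forall>y. 0 \<le> w y) \<and> w summable_on carrier G \<and> infsum w (carrier G) \<le> k * ((norm v)\<^sup>2 + 1) \<and>
       (\<forall>x\<in>K. k * cmod (cinner (\<pi> x v) v) - \<epsilon> \<le> infsum (\<lambda>y. sqrt (w (inv x \<otimes> y) * w y)) (carrier G))"
    using w0 ws unfolding \<phi>_def by blast
qed

text \<open>In a finite group the trivial subgroup is cyclic of finite index. Infinitude is what
  \<open>fields_exist\<close> asks for.\<close>

lemma infinite_of_not_almost_cyclic:
  assumes "\<not> almost_cyclic G"
  shows "infinite (carrier G)"
proof
  assume fin: "finite (carrier G)"
  have "generate G {\<one>} \<subseteq> carrier G" by (rule generate_incl) simp
  then have "rcosets (generate G {\<one>}) \<subseteq> Pow (carrier G)"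
    using rcosets_part_G[OF generate_is_subgroup[of "{\<one>}"]] by auto
  then have "finite (rcosets (generate G {\<one>}))" using fin by (meson finite_Pow_iff finite_subset)
  then show False using assms unfolding almost_cyclic_def by blast
qed

end

lemma cinner_zero_left: "cinner (0 :: 'h::complex_hilbert) y = 0"
  using cinner_add_left[of 0 0 y] by simp

lemma cmod_quasi_regular_one:
  "cmod (L2_inner \<mu> (quasi_regular G act \<mu> x (\<lambda>_. 1)) (\<lambda>_. 1)) = (\<integral>\<omega>. sqrt (RN_cocycle act \<mu> x \<omega>) \<partial>\<mu>)"
proof -
  have "L2_inner \<mu> (quasi_regular G act \<mu> x (\<lambda>_. 1)) (\<lambda>_. 1) =
      complex_of_real (\<integral>\<omega>. sqrt (RN_cocycle act \<mu> x \<omega>) \<partial>\<mu>)"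
    by (simp add: L2_inner_def quasi_regular_def)
  moreover have "0 \<le> (\<integral>\<omega>. sqrt (RN_cocycle act \<mu> x \<omega>) \<partial>\<mu>)"
    by (intro Bochner_Integration.integral_nonneg) (simp add: RN_cocycle_def)
  ultimately show ?thesis by simp
qed

theorem theorem4p7:
  fixes G :: "('g, 'b) monoid_scheme"
    and S :: "'g set"
    and \<pi> :: "'g \<Rightarrow> 'h::complex_hilbert \<Rightarrow> 'h"
    and v :: 'h
  assumes "group G"
    and "hyperbolic_group G"
    and "torsion_free G"
    and "\<not> almost_cyclic G"
    and "fin_gen_set G S"
    and "unitary_rep G \<pi>"
    and "tempered G \<pi>"
  shows "\<exists>\<mu>. space \<mu> = gromov_boundary G S
          \<and> sets \<mu> = sets (borel_of (boundary_topology G S))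
          \<and> finite_measure \<mu>
          \<and> quasi_invariant G (bd_act G) \<mu>
          \<and> (\<forall>x\<in>carrier G.
               cmod (cinner (\<pi> x v) v)
                 \<le> (norm v)\<^sup>2 * cmod (L2_inner \<mu> (quasi_regular G (bd_act G) \<mu> x (\<lambda>_. 1)) (\<lambda>_. 1)))"
proof -
  interpret group G by fact
  obtain S' \<delta> where S': "fin_gen_set G S'"
    and hyp: "\<forall>w\<in>carrier G. \<forall>x\<in>carrier G. \<forall>y\<in>carrier G. \<forall>z\<in>carrier G.
           gromov_prod G S' w x z \<ge> min (gromov_prod G S' w x y) (gromov_prod G S' w y z) - \<delta>"
    using assms(2) unfolding hyperbolic_group_def by blast
  \<comment> \<open>The measure is built with the generating set \<open>S'\<close> that witnesses
    hyperbolicity; its boundary and topology are afterwards identified with those of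
    \<open>S\<close>.\<close>
  interpret H: hyp_fg_group G S' \<delta>
    by unfold_locales (fact S' hyp)+
  obtain A B where AB: "A > 0"
    "\<And>w a b. \<lbrakk>w \<in> carrier G; a \<in> carrier G; b \<in> carrier G\<rbrakk> \<Longrightarrow> gromov_prod G S' w a b \<le> A * gromov_prod G S w a b + B"
    "\<And>w a b. \<lbrakk>w \<in> carrier G; a \<in> carrier G; b \<in> carrier G\<rbrakk> \<Longrightarrow> gromov_prod G S w a b \<le> A * gromov_prod G S' w a b + B"
    using gromov_prod_comparable[OF assms(1) S' assms(5) hyp] by blast
  have bd: "gromov_boundary G S' = gromov_boundary G S" "boundary_topology G S' = boundary_topology G S"
    using boundary_independent[OF AB(1) AB(2)[OF one_closed] AB(3)[OF one_closed]] by auto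
  obtain n1 where n1: "from_nat_into (carrier G) n1 = \<one>\<^bsub>G\<^esub>"
    using from_nat_into_surj[OF H.countable_carrier one_closed] by blast
  define \<kappa> :: real where "\<kappa> = 2 ^ (n1 + 1)"
  \<comment> \<open>Scaling the coefficient by \<open>k\<close> puts \<open>\<kappa>\<close> on the
    left to cancel the factor lost in averaging, and leaves the squared norm as the only constant.
    For \<open>v = 0\<close> both sides of the claim vanish, and any positive value serves.\<close>
  define k where "k = (if v = 0 then 1 else \<kappa> / (norm v)\<^sup>2)"
  have \<kappa>: "0 < \<kappa>" by (simp add: \<kappa>_def)
  then have k: "0 < k" by (simp add: k_def)
  obtain \<mu> where \<mu>: "space \<mu> = gromov_boundary G S"
    "sets \<mu> = sets (borel_of (boundary_topology G S))"
    "finite_measure \<mu>" "quasi_invariant G (bd_act G) \<mu>"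
    "\<forall>x\<in>carrier G. k * cmod (cinner (\<pi> x v) v) \<le> \<kappa> * (\<integral>\<omega>. sqrt (RN_cocycle (bd_act G) \<mu> x \<omega>) \<partial>\<mu>)"
    using H.boundary_measure_exists[OF infinite_of_not_almost_cyclic[OF assms(4)]
        tempered_affinity_dominated[OF assms(6,7) k, of v] n1]
    unfolding bd \<kappa>_def by blast
  have "cmod (cinner (\<pi> x v) v)
      \<le> (norm v)\<^sup>2 * cmod (L2_inner \<mu> (quasi_regular G (bd_act G) \<mu> x (\<lambda>_. 1)) (\<lambda>_. 1))"
    if x: "x \<in> carrier G" for x
  proof (cases "v = 0")
    case True
    then have "cinner (\<pi> x v) v = cnj (cinner v (\<pi> x v))" by (intro cinner_conj)
    then show ?thesis using True cinner_zero_left by simp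
  next
    case False
    then have "\<kappa> * (cmod (cinner (\<pi> x v) v) / (norm v)\<^sup>2) \<le> \<kappa> * (\<integral>\<omega>. sqrt (RN_cocycle (bd_act G) \<mu> x \<omega>) \<partial>\<mu>)"
      using \<mu>(5) x by (simp add: k_def)
    then have "cmod (cinner (\<pi> x v) v) / (norm v)\<^sup>2 \<le> (\<integral>\<omega>. sqrt (RN_cocycle (bd_act G) \<mu> x \<omega>) \<partial>\<mu>)"
      unfolding mult_le_cancel_left_pos[OF \<kappa>] .
    then show ?thesis
      using False unfolding cmod_quasi_regular_one by (simp add: pos_divide_le_eq mult.commute)
  qed
  then show ?thesis using \<mu> by blast
qed

end
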